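(* Let $\alpha\in\mathbb{R}$ with $\alpha\neq 0$, and let $\Phi\colon\Sigma\to\mathbb{R}^3$ be a smooth immersion of a connected, oriented surface $\Sigma$ with $0\notin\Phi(\Sigma)$. Suppose that $\Sigma$ is an $\alpha$-stationary surface and that one of the principal curvatures of $\Sigma$ is constant. Then $\Sigma$ is a plane or a sphere, that is, $\Phi(\Sigma)$ is contained in an affine plane or in a round sphere of $\mathbb{R}^3$.
   Context: For $\alpha\in\mathbb{R}$, the energy of an immersion $\Phi\colon\Sigma\to\mathbb{R}^3$ is $E_\alpha[\Sigma]=\int_\Sigma|\Phi|^\alpha\,d\Sigma$, where $d\Sigma$ is the area element induced on $\Sigma$. Critical points of $E_\alpha$ are called $\alpha$-stationary surfaces (or simply stationary surfaces). When $0\notin\Phi(\Sigma)$, being $\alpha$-stationary is equivalent to the Euler-Lagrange equation $$H=\alpha\,\frac{\langle N,\Phi\rangle}{|\Phi|^2}\quad\text{on }\Sigma,$$ where $N$ is the unit normal (Gauss map) of $\Sigma$, the shape operator is $SX=-\overline{\nabla}_XN$ ($\overline{\nabla}$ the Levi-Civita connection of $\mathbb{R}^3$), $\kappa_1,\kappa_2$ are the principal curvatures (eigenvalues of $S$), and $H=\kappa_1+\kappa_2$ is the mean curvature (sum, not average). Surfaces are not assumed complete or closed, so "a plane or a sphere" is understood as an open piece of one. *)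

theory Defs
  imports "HOL-Analysis.Analysis"
begin

section \<open>Smoothness on open sets\<close>

text \<open>Meant for open \<open>S\<close>: \<open>f\<close> is of class \<open>C\<^sup>k\<close> on \<open>S\<close>.  The clause for \<open>Suc k\<close> asks for
  differentiability with all directional derivatives of class \<open>C\<^sup>k\<close>.\<close>

primrec Ck_on ::
  "nat \<Rightarrow> 'a::euclidean_space set \<Rightarrow> ('a \<Rightarrow> 'b::real_normed_vector) \<Rightarrow> bool" where
  "Ck_on 0 S f \<longleftrightarrow> continuous_on S f"
| "Ck_on (Suc k) S f \<longleftrightarrow>
     (\<forall>x\<in>S. f differentiable (at x)) \<and>
     (\<forall>v. Ck_on k S (\<lambda>x. frechet_derivative f (at x) v))"

definition smooth_on ::
  "'a::euclidean_space set \<Rightarrow> ('a \<Rightarrow> 'b::real_normed_vector) \<Rightarrow> bool" where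
  "smooth_on S f \<longleftrightarrow> (\<forall>k. Ck_on k S f)"


section \<open>Oriented smooth surfaces\<close>

text \<open>The surface is the whole type \<open>'s\<close>.  A chart is a pair of its domain and its coordinate
  map; the coordinate map is irrelevant outside the domain.\<close>

type_synonym 's chart = "'s set \<times> ('s \<Rightarrow> real^2)"

abbreviation chart_dom :: "'s chart \<Rightarrow> 's set" where
  "chart_dom c \<equiv> fst c"

abbreviation chart_map :: "'s chart \<Rightarrow> 's \<Rightarrow> real^2" where
  "chart_map c \<equiv> snd c"

definition chart_img :: "'s chart \<Rightarrow> (real^2) set" where
  "chart_img c = chart_map c ` chart_dom c"

definition chart_inv :: "'s chart \<Rightarrow> real^2 \<Rightarrow> 's" where
  "chart_inv c = inv_into (chart_dom c) (chart_map c)"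

definition is_chart :: "'s::topological_space chart \<Rightarrow> bool" where
  "is_chart c \<longleftrightarrow>
     open (chart_dom c) \<and> open (chart_img c) \<and>
     homeomorphism (chart_dom c) (chart_img c) (chart_map c) (chart_inv c)"

text \<open>An atlas whose transition maps are smooth with positive Jacobian determinant.  The atlas
  need not be maximal.\<close>

definition oriented_smooth_atlas ::
  "'s::{t2_space,second_countable_topology} chart set \<Rightarrow> bool" where
  "oriented_smooth_atlas A \<longleftrightarrow>
     (\<forall>c\<in>A. is_chart c) \<and>
     (\<Union>c\<in>A. chart_dom c) = UNIV \<and>
     (\<forall>c\<in>A. \<forall>d\<in>A.
        smooth_on (chart_map c ` (chart_dom c \<inter> chart_dom d)) (chart_map d \<circ> chart_inv c) \<and>
        (\<forall>x \<in> chart_map c ` (chart_dom c \<inter> chart_dom d).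
           det (matrix (frechet_derivative (chart_map d \<circ> chart_inv c) (at x))) > 0))"

definition local_rep :: "'s chart \<Rightarrow> ('s \<Rightarrow> 'b) \<Rightarrow> real^2 \<Rightarrow> 'b" where
  "local_rep c f = f \<circ> chart_inv c"

definition smooth_immersion :: "'s chart set \<Rightarrow> ('s \<Rightarrow> real^3) \<Rightarrow> bool" where
  "smooth_immersion A f \<longleftrightarrow>
     (\<forall>c\<in>A. smooth_on (chart_img c) (local_rep c f) \<and>
            (\<forall>x\<in>chart_img c. inj (frechet_derivative (local_rep c f) (at x))))"


section \<open>Local geometry of a parametrized surface\<close>

definition coord_normal :: "(real^2 \<Rightarrow> real^3) \<Rightarrow> real^2 \<Rightarrow> real^3" where
  "coord_normal X x =
     cross3 (frechet_derivative X (at x) (axis 1 1)) (frechet_derivative X (at x) (axis 2 1))"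

definition area_density :: "(real^2 \<Rightarrow> real^3) \<Rightarrow> real^2 \<Rightarrow> real" where
  "area_density X x = norm (coord_normal X x)"

definition unit_normal :: "(real^2 \<Rightarrow> real^3) \<Rightarrow> real^2 \<Rightarrow> real^3" where
  "unit_normal X x = sgn (coord_normal X x)"

definition tangent_plane :: "(real^2 \<Rightarrow> real^3) \<Rightarrow> real^2 \<Rightarrow> (real^3) set" where
  "tangent_plane X x = range (frechet_derivative X (at x))"

text \<open>\<open>S w = - \<nabla>\<^sub>w N\<close> for \<open>w\<close> in the tangent plane: \<open>w\<close> is pulled back to the parameter plane
  by the (injective) differential of \<open>X\<close>.  The value is meaningless for other \<open>w\<close>.\<close>

definition shape_operator :: "(real^2 \<Rightarrow> real^3) \<Rightarrow> real^2 \<Rightarrow> real^3 \<Rightarrow> real^3" where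
  "shape_operator X x w =
     - frechet_derivative (unit_normal X) (at x) (inv (frechet_derivative X (at x)) w)"

definition principal_curvatures :: "(real^2 \<Rightarrow> real^3) \<Rightarrow> real^2 \<Rightarrow> real set" where
  "principal_curvatures X x =
     {k. \<exists>w \<in> tangent_plane X x. w \<noteq> 0 \<and> shape_operator X x w = k *\<^sub>R w}"


section \<open>The energy and its critical points\<close>

text \<open>The measure \<open>d\<Sigma>\<close> induced by \<open>f\<close>: the unique Borel measure that in every chart of the
  atlas has density \<open>area_density\<close> with respect to Lebesgue measure.\<close>

definition area_measure ::
  "'s::{t2_space,second_countable_topology} chart set \<Rightarrow> ('s \<Rightarrow> real^3) \<Rightarrow> 's measure" where
  "area_measure A f =
     (THE \<mu>. sets \<mu> = sets borel \<and>
        (\<forall>c\<in>A. \<forall>B\<in>sets borel. B \<subseteq> chart_dom c \<longrightarrow>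
           emeasure \<mu> B =
             (\<integral>\<^sup>+x\<in>chart_map c ` B. ennreal (area_density (local_rep c f) x) \<partial>lborel)))"

text \<open>The part of the energy carried by \<open>K\<close>.  The energy of the whole surface may be infinite, so
  criticality is tested on compact sets supporting the variation.\<close>

definition energy ::
  "'s::{t2_space,second_countable_topology} chart set \<Rightarrow> real \<Rightarrow> 's set \<Rightarrow> ('s \<Rightarrow> real^3) \<Rightarrow> real"
  where
  "energy A \<alpha> K f = (LINT p:K|area_measure A f. norm (f p) powr \<alpha>)"

definition variation ::
  "'s::{t2_space,second_countable_topology} chart set \<Rightarrow> ('s \<Rightarrow> real^3) \<Rightarrow>
     's set \<Rightarrow> real \<Rightarrow> (real \<Rightarrow> 's \<Rightarrow> real^3) \<Rightarrow> bool" where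
  "variation A \<Phi> K \<epsilon> F \<longleftrightarrow>
     compact K \<and> \<epsilon> > 0 \<and>
     (\<forall>c\<in>A. smooth_on ({-\<epsilon><..<\<epsilon>} \<times> chart_img c) (\<lambda>(t, x). F t (chart_inv c x))) \<and>
     (\<forall>t\<in>{-\<epsilon><..<\<epsilon>}. smooth_immersion A (F t)) \<and>
     F 0 = \<Phi> \<and>
     (\<forall>t\<in>{-\<epsilon><..<\<epsilon>}. \<forall>p. p \<notin> K \<longrightarrow> F t p = \<Phi> p)"

definition stationary_surface ::
  "'s::{t2_space,second_countable_topology} chart set \<Rightarrow> real \<Rightarrow> ('s \<Rightarrow> real^3) \<Rightarrow> bool" where
  "stationary_surface A \<alpha> \<Phi> \<longleftrightarrow>
     (\<forall>K \<epsilon> F. variation A \<Phi> K \<epsilon> F \<longrightarrow>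
        ((\<lambda>t. energy A \<alpha> K (F t)) has_real_derivative 0) (at 0))"

end

theory Submission
  imports Defs
begin

text \<open>Let \<open>X\<close> be the immersion in a chart, \<open>N\<close> its unit normal, \<open>c\<close> the constant principal curvature, and let
subscripts denote directional derivatives.  The proof has an analytic half, which extracts a
pointwise equation from stationarity, and a geometric half, which uses it to show that every point is
umbilic.

\<^bold>\<open>From stationarity to a pointwise equation.\<close>  The surface is moved to \<open>\<Phi> + t \<eta> e\<close> with a fixed vector
\<open>e\<close> and a bump function \<open>\<eta>\<close> supported in one chart.  To compute the energy of such a variation the area
measure must be understood: it exists because the area densities of two charts correspond under the
change of variables formula, and it is unique because countably many charts cover the surface
(\<open>is_area_measure_area_measure\<close>).  The first variation is then an integral over a box of the parameter
plane (\<open>first_variation_vanishes\<close>).  Integrating by parts, shrinking the support of \<open>\<eta>\<close> to a point \<open>p\<close> and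
taking \<open>e = N p\<close> gives
\<open>(N \<bullet> (X\<^sub>w \<times> N\<^sub>v + N\<^sub>w \<times> X\<^sub>v)) |X|\<^sup>2 = \<alpha> (N \<bullet> X) (N \<bullet> (X\<^sub>v \<times> X\<^sub>w))\<close>,
which is \<open>H |X|\<^sup>2 = \<alpha> (N \<bullet> X)\<close> multiplied by the area of the parallelogram of \<open>X\<^sub>v\<close> and \<open>X\<^sub>w\<close>
(\<open>stationary_Euler_Lagrange\<close>).

\<^bold>\<open>Umbilicity.\<close>  Put \<open>Z = N + c X\<close>.  Since \<open>c\<close> is a principal curvature, the differential of \<open>Z\<close> has a
nontrivial kernel at every point.  If it vanishes everywhere, then \<open>Z\<close> is constant, because the
surface is connected; for \<open>c = 0\<close> this means a constant normal, hence a plane, and otherwise \<open>\<Phi>\<close> has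
constant distance \<open>1 / |c|\<close> from \<open>Z / c\<close>, hence lies on a sphere (\<open>plane_or_sphere_if_umbilic\<close>).

Suppose \<open>dZ \<noteq> 0\<close> at some point.  Near it the image of \<open>Z\<close> is a curve, with unit tangent \<open>T\<close> and curvature
vector \<open>K\<close>, and \<open>Z\<close>, \<open>T\<close>, \<open>K\<close> are constant along the direction field \<open>l\<close> spanning the kernel of \<open>dZ\<close>
(locale \<open>rank_one_direction\<close>).

If \<open>c = 0\<close>, then \<open>N\<close> is constant along \<open>l\<close> and the surface is ruled by straight lines.  Along a ruling
\<open>|X|\<^sup>2\<close> is a quadratic polynomial with leading coefficient 1, while the equation expresses it as
\<open>-\<alpha> h w\<close> with \<open>h = N \<bullet> X\<close> constant and \<open>w\<close> affine (\<open>no_developable\<close>).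

If \<open>c \<noteq> 0\<close>, then along \<open>l\<close> the normal rotates in the plane orthogonal to \<open>T\<close>, and the surface is a tube around the
curve \<open>Z / c\<close>.  The equation becomes a polynomial identity in \<open>x = N \<bullet> K\<close> and \<open>z = N \<bullet> Z\<close>, which are pure first
harmonics of the rotation angle.  Separating its harmonics yields
\<open>|Z|\<^sup>2 = - 1 - \<alpha>\<close>, so \<open>|Z|\<close> is constant, whence \<open>Z \<bullet> T = 0\<close> and, differentiating along the curve,
\<open>Z \<bullet> K = - 1\<close>.  The remaining harmonics contradict this (\<open>no_tube\<close>).\<close>


section \<open>Calculus of smooth maps\<close>

lemma Ck_on_cong:
  assumes "open S" and "\<And>x. x \<in> S \<Longrightarrow> f x = g x" and "Ck_on k S f"
  shows "Ck_on k S g"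
  using assms(2,3)
proof (induction k arbitrary: f g)
  case 0
  then show ?case by (simp add: continuous_on_eq)
next
  case (Suc k)
  have D: "(g has_derivative frechet_derivative f (at x)) (at x)" if "x \<in> S" for x
    using Suc.prems that assms(1)
    by (intro has_derivative_transform_within_open[of f _ x UNIV S g])
       (auto simp: frechet_derivative_works)
  have eq: "frechet_derivative g (at x) = frechet_derivative f (at x)" if "x \<in> S" for x
    using D[OF that] frechet_derivative_at by metis
  show ?case
    using Suc.prems D eq Suc.IH[of "\<lambda>x. frechet_derivative f (at x) v" "\<lambda>x. frechet_derivative g (at x) v" for v]
    by (auto simp: differentiable_def)
qed

lemma Ck_on_SucI:
  assumes "open S" and "\<And>x. x \<in> S \<Longrightarrow> (f has_derivative f' x) (at x)"
    and "\<And>v. Ck_on k S (\<lambda>x. f' x v)"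
  shows "Ck_on (Suc k) S f"
proof -
  have "frechet_derivative f (at x) = f' x" if "x \<in> S" for x
    using assms(2)[OF that] frechet_derivative_at by metis
  then show ?thesis
    using assms Ck_on_cong[OF assms(1), of "\<lambda>x. f' x v" "\<lambda>x. frechet_derivative f (at x) v" for v]
    by (auto simp: differentiable_def)
qed

lemma Ck_on_SucD:
  "Ck_on (Suc k) S f \<Longrightarrow> x \<in> S \<Longrightarrow> (f has_derivative frechet_derivative f (at x)) (at x)"
  by (auto simp: frechet_derivative_works)

lemma Ck_on_Suc_imp: "Ck_on (Suc k) S f \<Longrightarrow> Ck_on k S f"
proof (induction k arbitrary: f)
  case 0
  then show ?case
    by (auto intro!: continuous_at_imp_continuous_on differentiable_imp_continuous_within)
next
  case (Suc k)
  then show ?case by (metis Ck_on.simps(2))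
qed

lemma Ck_on_imp_continuous_on: "Ck_on k S f \<Longrightarrow> continuous_on S f"
  by (induction k arbitrary: f) (simp, metis Ck_on_Suc_imp)

lemma Ck_on_subset: "Ck_on k S f \<Longrightarrow> T \<subseteq> S \<Longrightarrow> Ck_on k T f"
  by (induction k arbitrary: f) (auto intro: continuous_on_subset)

text \<open>Used for maps that are defined by cases, such as a function extended by zero outside the support of a
bump.\<close>

lemma Ck_on_locally:
  assumes "\<And>x. x \<in> S \<Longrightarrow> \<exists>U. open U \<and> x \<in> U \<and> Ck_on k U f"
  shows "Ck_on k S f"
  using assms
proof (induction k arbitrary: f)
  case 0
  have "isCont f x" if "x \<in> S" for x
    using 0[OF that] by (auto simp: continuous_on_eq_continuous_at)
  then show ?case by (auto intro: continuous_at_imp_continuous_on)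
next
  case (Suc k)
  show ?case
    unfolding Ck_on.simps
  proof (intro conjI allI ballI)
    show "f differentiable at x" if "x \<in> S" for x
      using Suc.prems[OF that] by auto
    show "Ck_on k S (\<lambda>x. frechet_derivative f (at x) v)" for v
      by (rule Suc.IH) (use Suc.prems in \<open>simp, blast\<close>)
  qed
qed

lemma Ck_on_const: "open S \<Longrightarrow> Ck_on k S (\<lambda>x. c)"
proof (induction k arbitrary: c)
  case (Suc k)
  show ?case
    by (rule Ck_on_SucI[OF Suc.prems has_derivative_const]) (use Suc in simp)
qed simp

lemma Ck_on_linear: "bounded_linear L \<Longrightarrow> open S \<Longrightarrow> Ck_on k S L"
  by (cases k)
     (simp_all only: Ck_on.simps(1) linear_continuous_on
       Ck_on_SucI[OF _ bounded_linear_imp_has_derivative Ck_on_const])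

lemma Ck_on_linear_compose:
  assumes "bounded_linear L" "open S"
  shows "Ck_on k S f \<Longrightarrow> Ck_on k S (\<lambda>x. L (f x))"
proof (induction k arbitrary: f)
  case 0
  then show ?case using assms by (auto intro: linear_continuous_on_compose bounded_linear.continuous_on)
next
  case (Suc k)
  show ?case
    by (rule Ck_on_SucI[OF assms(2) bounded_linear.has_derivative[OF assms(1) Ck_on_SucD[OF Suc.prems]]])
       (use Suc in auto)
qed

lemma Ck_on_add:
  assumes "open S"
  shows "Ck_on k S f \<Longrightarrow> Ck_on k S g \<Longrightarrow> Ck_on k S (\<lambda>x. f x + g x)"
proof (induction k arbitrary: f g)
  case 0
  then show ?case by (auto intro: continuous_intros)
next
  case (Suc k)
  show ?case
    by (rule Ck_on_SucI[OF assms has_derivative_add[OF Ck_on_SucD[OF Suc.prems(1)] Ck_on_SucD[OF Suc.prems(2)]]])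
       (use Suc in auto)
qed

lemma Ck_on_bilinear:
  assumes "bounded_bilinear B" "open S"
  shows "Ck_on k S f \<Longrightarrow> Ck_on k S g \<Longrightarrow> Ck_on k S (\<lambda>x. B (f x) (g x))"
proof (induction k arbitrary: f g)
  case 0
  then show ?case using bounded_bilinear.continuous_on[OF assms(1)] by auto
next
  case (Suc k)
  show ?case
    by (rule Ck_on_SucI[OF assms(2) bounded_bilinear.FDERIV[OF assms(1) Ck_on_SucD[OF Suc.prems(1)] Ck_on_SucD[OF Suc.prems(2)]]])
       (use Suc Ck_on_Suc_imp[OF Suc.prems(1)]  Ck_on_Suc_imp[OF Suc.prems(2)] in \<open>auto intro!: Ck_on_add assms\<close>)
qed

lemma Ck_on_sum:
  assumes "open S" "finite I"
  shows "(\<And>i. i \<in> I \<Longrightarrow> Ck_on k S (f i)) \<Longrightarrow> Ck_on k S (\<lambda>x. \<Sum>i\<in>I. f i x)"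
  using assms(2) by (induction I rule: finite_induct) (auto intro!: Ck_on_add Ck_on_const assms(1))

text \<open>The inner derivative changes with the point, whereas \<^const>\<open>Ck_on\<close> only speaks about derivatives in fixed
directions.  Expanding the inner derivative in the standard basis turns the chain rule into a finite sum
of products of \<open>C\<^sup>k\<close> maps.\<close>

lemma Ck_on_compose:
  fixes g :: "'a::euclidean_space \<Rightarrow> 'b::euclidean_space" and f :: "'b \<Rightarrow> 'c::real_normed_vector"
  assumes "open S" "g ` S \<subseteq> T"
  shows "Ck_on k T f \<Longrightarrow> Ck_on k S g \<Longrightarrow> Ck_on k S (\<lambda>x. f (g x))"
proof (induction k arbitrary: f)
  case 0
  then show ?case using assms by (auto intro: continuous_on_compose2)
next
  case (Suc k)
  let ?f' = "\<lambda>y. frechet_derivative f (at y)" and ?g' = "\<lambda>x. frechet_derivative g (at x)"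
  have gD: "(g has_derivative ?g' x) (at x)" if "x \<in> S" for x
    using Ck_on_SucD[OF Suc.prems(2)] that .
  have fD: "(f has_derivative ?f' (g x)) (at (g x))" if "x \<in> S" for x
    using Ck_on_SucD[OF Suc.prems(1)] that assms(2) by auto
  have expand: "?f' (g x) (?g' x v) = (\<Sum>i\<in>Basis. (?g' x v \<bullet> i) *\<^sub>R ?f' (g x) i)" if "x \<in> S" for x v
  proof -
    interpret L: linear "?f' (g x)" using has_derivative_linear[OF fD[OF that]] .
    have "?f' (g x) (?g' x v) = ?f' (g x) (\<Sum>i\<in>Basis. (?g' x v \<bullet> i) *\<^sub>R i)"
      by (simp add: euclidean_representation)
    also have "\<dots> = (\<Sum>i\<in>Basis. (?g' x v \<bullet> i) *\<^sub>R ?f' (g x) i)"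
      by (simp add: L.sum L.scaleR)
    finally show ?thesis .
  qed
  have "Ck_on k S (\<lambda>x. \<Sum>i\<in>Basis. (?g' x v \<bullet> i) *\<^sub>R ?f' (g x) i)" for v
  proof (intro Ck_on_sum assms(1) finite_Basis Ck_on_bilinear[OF bounded_bilinear_scaleR])
    fix i :: 'b assume "i \<in> Basis"
    show "Ck_on k S (\<lambda>x. ?g' x v \<bullet> i)"
      using Suc.prems(2) by (intro Ck_on_linear_compose[OF bounded_linear_inner_left assms(1)]) simp
    show "Ck_on k S (\<lambda>x. ?f' (g x) i)"
      using Suc.prems(1) Ck_on_Suc_imp[OF Suc.prems(2)] by (auto intro: Suc.IH[of "\<lambda>y. ?f' y i"])
  qed
  then have "Ck_on k S (\<lambda>x. ?f' (g x) (?g' x v))" for v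
    by (rule Ck_on_cong[OF assms(1), rotated]) (simp add: expand)
  then show ?case
    by (intro Ck_on_SucI[OF assms(1), where f' = "\<lambda>x v. ?f' (g x) (?g' x v)"])
       (use has_derivative_compose[OF gD fD] in auto)
qed

text \<open>For reciprocals, norms and real powers the derivative is a product in which a function of the same kind
occurs again; this factor is \<open>C\<^sup>k\<close> by the induction hypothesis.\<close>

lemma Ck_on_inverse:
  fixes f :: "'a::euclidean_space \<Rightarrow> real"
  assumes "open S" "\<And>x. x \<in> S \<Longrightarrow> f x \<noteq> 0"
  shows "Ck_on k S f \<Longrightarrow> Ck_on k S (\<lambda>x. inverse (f x))"
proof (induction k)
  case 0
  then show ?case using assms by (auto intro: continuous_intros)
next
  case (Suc k)
  let ?f' = "\<lambda>y. frechet_derivative f (at y)"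
  have D: "((\<lambda>x. inverse (f x)) has_derivative (\<lambda>v. - (inverse (f x) * ?f' x v * inverse (f x)))) (at x)"
    if "x \<in> S" for x
    using has_derivative_compose[OF Ck_on_SucD[OF Suc.prems that] has_derivative_inverse'[OF assms(2)[OF that]]]
    by simp
  show ?case
    by (intro Ck_on_SucI[OF assms(1) D] Ck_on_linear_compose[OF bounded_linear_minus[OF bounded_linear_ident]]
         Ck_on_bilinear[OF bounded_bilinear_mult] assms(1) Suc.IH Ck_on_Suc_imp[OF Suc.prems])
       (use Suc.prems in auto)
qed

lemma Ck_on_norm:
  fixes f :: "'a::euclidean_space \<Rightarrow> 'b::euclidean_space"
  assumes "open S" "\<And>x. x \<in> S \<Longrightarrow> f x \<noteq> 0"
  shows "Ck_on k S f \<Longrightarrow> Ck_on k S (\<lambda>x. norm (f x))"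
proof (induction k)
  case 0
  then show ?case by (auto intro: continuous_intros)
next
  case (Suc k)
  let ?f' = "\<lambda>y. frechet_derivative f (at y)"
  have D: "((\<lambda>x. norm (f x)) has_derivative (\<lambda>v. (?f' x v \<bullet> f x) * inverse (norm (f x)))) (at x)"
    if "x \<in> S" for x
  proof -
    have "(norm has_derivative (\<lambda>h. h \<bullet> sgn (f x))) (at (f x))"
      using assms(2)[OF that] by (rule has_derivative_norm)
    from has_derivative_compose[OF Ck_on_SucD[OF Suc.prems that] this]
    show ?thesis by (simp add: sgn_div_norm divide_inverse mult.commute)
  qed
  have "Ck_on k S (\<lambda>x. inverse (norm (f x)))"
    using Suc.IH[OF Ck_on_Suc_imp[OF Suc.prems]] assms by (intro Ck_on_inverse) auto
  then show ?case
    using Suc.prems Ck_on_Suc_imp[OF Suc.prems]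
    by (intro Ck_on_SucI[OF assms(1) D] Ck_on_bilinear[OF bounded_bilinear_mult assms(1)]
         Ck_on_bilinear[OF bounded_bilinear_inner assms(1)]) simp_all
qed

lemma Ck_on_powr:
  fixes f :: "'a::euclidean_space \<Rightarrow> real"
  assumes "open S" "\<And>x. x \<in> S \<Longrightarrow> f x > 0"
  shows "Ck_on k S f \<Longrightarrow> Ck_on k S (\<lambda>x. f x powr a)"
proof (induction k arbitrary: a)
  case 0
  then show ?case
    using assms(2) by (intro Ck_on.simps(1)[THEN iffD2] continuous_on_powr) (fastforce simp: less_imp_neq)+
next
  case (Suc k)
  let ?f' = "\<lambda>y. frechet_derivative f (at y)"
  have D: "((\<lambda>x. f x powr a) has_derivative (\<lambda>v. ?f' x v * (a * f x powr (a - 1)))) (at x)"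
    if "x \<in> S" for x
    using has_derivative_compose[OF Ck_on_SucD[OF Suc.prems that]
        has_real_derivative_powr[OF assms(2)[OF that], THEN has_field_derivative_imp_has_derivative, of a]]
    by (simp add: mult.commute)
  show ?case
    using Suc.prems Ck_on_Suc_imp[OF Suc.prems]
    by (intro Ck_on_SucI[OF assms(1) D] Ck_on_bilinear[OF bounded_bilinear_mult assms(1)]
         Ck_on_const[OF assms(1)] Suc.IH) simp_all
qed


lemma smooth_onD: "smooth_on S f \<Longrightarrow> Ck_on k S f"
  by (simp add: smooth_on_def)

lemma smooth_on_cong: "open S \<Longrightarrow> (\<And>x. x \<in> S \<Longrightarrow> f x = g x) \<Longrightarrow> smooth_on S f \<Longrightarrow> smooth_on S g"
  using Ck_on_cong unfolding smooth_on_def by metis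

lemma smooth_on_subset: "smooth_on S f \<Longrightarrow> T \<subseteq> S \<Longrightarrow> smooth_on T f"
  using Ck_on_subset unfolding smooth_on_def by metis

lemma smooth_on_imp_continuous_on: "smooth_on S f \<Longrightarrow> continuous_on S f"
  using Ck_on_imp_continuous_on smooth_onD by metis

lemma smooth_on_locally:
  assumes "\<And>x. x \<in> S \<Longrightarrow> \<exists>U. open U \<and> x \<in> U \<and> smooth_on U f"
  shows "smooth_on S f"
  unfolding smooth_on_def using assms Ck_on_locally smooth_onD by metis

lemma smooth_on_has_derivative:
  "smooth_on S f \<Longrightarrow> x \<in> S \<Longrightarrow> (f has_derivative frechet_derivative f (at x)) (at x)"
  using Ck_on_SucD smooth_onD by metis

lemma smooth_on_frechet_derivative:
  "smooth_on S f \<Longrightarrow> smooth_on S (\<lambda>x. frechet_derivative f (at x) v)"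
  unfolding smooth_on_def by (metis Ck_on.simps(2))

lemma smooth_on_const: "open S \<Longrightarrow> smooth_on S (\<lambda>x. c)"
  by (simp add: smooth_on_def Ck_on_const)

lemma smooth_on_linear: "bounded_linear L \<Longrightarrow> open S \<Longrightarrow> smooth_on S L"
  by (simp add: smooth_on_def Ck_on_linear)

lemma smooth_on_linear_compose:
  "bounded_linear L \<Longrightarrow> open S \<Longrightarrow> smooth_on S f \<Longrightarrow> smooth_on S (\<lambda>x. L (f x))"
  by (simp add: smooth_on_def Ck_on_linear_compose)

lemma smooth_on_add:
  "open S \<Longrightarrow> smooth_on S f \<Longrightarrow> smooth_on S g \<Longrightarrow> smooth_on S (\<lambda>x. f x + g x)"
  by (simp add: smooth_on_def Ck_on_add)

lemma smooth_on_bilinear: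
  "bounded_bilinear B \<Longrightarrow> open S \<Longrightarrow> smooth_on S f \<Longrightarrow> smooth_on S g \<Longrightarrow> smooth_on S (\<lambda>x. B (f x) (g x))"
  by (simp add: smooth_on_def Ck_on_bilinear)

lemmas smooth_on_scaleR = smooth_on_bilinear[OF bounded_bilinear_scaleR]
lemmas smooth_on_mult = smooth_on_bilinear[OF bounded_bilinear_mult[where 'a = real]]
lemmas smooth_on_inner = smooth_on_bilinear[OF bounded_bilinear_inner]

lemma bounded_bilinear_cross3: "bounded_bilinear cross3"
  using bilinear_conv_bounded_bilinear bilinear_cross by blast

lemmas smooth_on_cross3 = smooth_on_bilinear[OF bounded_bilinear_cross3]

lemma smooth_on_minus: "open S \<Longrightarrow> smooth_on S f \<Longrightarrow> smooth_on S (\<lambda>x. - f x)"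
  using smooth_on_linear_compose[OF bounded_linear_minus[OF bounded_linear_ident]] .

lemma smooth_on_diff:
  "open S \<Longrightarrow> smooth_on S f \<Longrightarrow> smooth_on S g \<Longrightarrow> smooth_on S (\<lambda>x. f x - g x)"
  using smooth_on_add[OF _ _ smooth_on_minus] by fastforce

lemma smooth_on_compose:
  fixes g :: "'a::euclidean_space \<Rightarrow> 'b::euclidean_space" and f :: "'b \<Rightarrow> 'c::real_normed_vector"
  shows "smooth_on T f \<Longrightarrow> smooth_on S g \<Longrightarrow> open S \<Longrightarrow> g ` S \<subseteq> T \<Longrightarrow> smooth_on S (\<lambda>x. f (g x))"
  by (simp add: smooth_on_def Ck_on_compose)

lemma smooth_on_divide:
  fixes f g :: "'a::euclidean_space \<Rightarrow> real"
  assumes "open S" "smooth_on S f" "smooth_on S g" "\<And>x. x \<in> S \<Longrightarrow> g x \<noteq> 0"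
  shows "smooth_on S (\<lambda>x. f x / g x)"
  using smooth_on_mult[of S f "\<lambda>x. inverse (g x)"] assms
  by (simp add: smooth_on_def divide_inverse Ck_on_inverse)

lemma smooth_on_norm:
  fixes f :: "'a::euclidean_space \<Rightarrow> 'b::euclidean_space"
  shows "open S \<Longrightarrow> smooth_on S f \<Longrightarrow> (\<And>x. x \<in> S \<Longrightarrow> f x \<noteq> 0) \<Longrightarrow> smooth_on S (\<lambda>x. norm (f x))"
  by (simp add: smooth_on_def Ck_on_norm)

lemma smooth_on_powr:
  fixes f :: "'a::euclidean_space \<Rightarrow> real"
  shows "open S \<Longrightarrow> smooth_on S f \<Longrightarrow> (\<And>x. x \<in> S \<Longrightarrow> f x > 0) \<Longrightarrow> smooth_on S (\<lambda>x. f x powr a)"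
  by (simp add: smooth_on_def Ck_on_powr)

lemma smooth_on_sgn:
  fixes f :: "'a::euclidean_space \<Rightarrow> 'b::euclidean_space"
  assumes "open S" "smooth_on S f" "\<And>x. x \<in> S \<Longrightarrow> f x \<noteq> 0"
  shows "smooth_on S (\<lambda>x. sgn (f x))"
proof -
  have "smooth_on S (\<lambda>x. inverse (norm (f x)))"
    using smooth_on_divide[OF assms(1) smooth_on_const[of S 1] smooth_on_norm[OF assms]] assms
    by (simp add: divide_inverse)
  then show ?thesis
    using smooth_on_scaleR assms unfolding sgn_div_norm by blast
qed

text \<open>The mean value theorem, applied first in direction \<open>a\<close> and then in direction \<open>b\<close>.  The left-hand side is
symmetric in \<open>a\<close> and \<open>b\<close>; letting \<open>h\<close> tend to 0 shows that second derivatives commute.\<close>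

lemma second_difference_mean_value:
  fixes f :: "'a::euclidean_space \<Rightarrow> real"
  assumes "Ck_on (Suc (Suc 0)) (ball x \<epsilon>) f" "h > 0" "h * (norm a + norm b) < \<epsilon>"
  shows "\<exists>p\<in>ball x \<epsilon>. f (x + h *\<^sub>R a + h *\<^sub>R b) - f (x + h *\<^sub>R a) - f (x + h *\<^sub>R b) + f x
     = h * h * frechet_derivative (\<lambda>y. frechet_derivative f (at y) a) (at p) b"
proof -
  let ?fa = "\<lambda>y. frechet_derivative f (at y) a"
  have inb: "x + s *\<^sub>R a + t *\<^sub>R b \<in> ball x \<epsilon>" if "0 \<le> s" "s \<le> h" "0 \<le> t" "t \<le> h" for s t
  proof -
    have "dist x (x + s *\<^sub>R a + t *\<^sub>R b) = norm (s *\<^sub>R a + t *\<^sub>R b)"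
      by (metis add.assoc add_diff_cancel_left' dist_norm dist_commute)
    also have "\<dots> \<le> s * norm a + t * norm b"
      using norm_triangle_ineq[of "s *\<^sub>R a" "t *\<^sub>R b"] that by simp
    also have "\<dots> \<le> h * norm a + h * norm b"
      using that by (intro add_mono mult_right_mono) auto
    finally show ?thesis using assms(3) by (simp add: distrib_left)
  qed
  have line: "((\<lambda>s. g (q + s *\<^sub>R v)) has_real_derivative frechet_derivative g (at (q + s *\<^sub>R v)) v) (at s)"
    if "g differentiable at (q + s *\<^sub>R v)" for g :: "'a \<Rightarrow> real" and q v s
  proof -
    let ?D = "frechet_derivative g (at (q + s *\<^sub>R v))"
    have D: "(g has_derivative ?D) (at (q + s *\<^sub>R v))"
      using that by (simp add: frechet_derivative_works)
    have "((\<lambda>s. q + s *\<^sub>R v) has_derivative (\<lambda>r. r *\<^sub>R v)) (at s)"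
      by (auto intro!: derivative_eq_intros)
    from has_derivative_compose[OF this D]
    have "((\<lambda>s. g (q + s *\<^sub>R v)) has_derivative (\<lambda>r. r * ?D v)) (at s)"
      using linear_cmul[OF has_derivative_linear[OF D]] by simp
    then show ?thesis by (simp add: has_field_derivative_def mult.commute[of _ "?D v"])
  qed
  have diff: "f differentiable at (x + s *\<^sub>R a + t *\<^sub>R b)" "?fa differentiable at (x + s *\<^sub>R a + t *\<^sub>R b)"
    if "0 \<le> s" "s \<le> h" "0 \<le> t" "t \<le> h" for s t
    using assms(1) inb[OF that] by auto
  let ?\<phi> = "\<lambda>s. f (x + h *\<^sub>R b + s *\<^sub>R a) - f (x + s *\<^sub>R a)"
  have "DERIV ?\<phi> s :> ?fa (x + h *\<^sub>R b + s *\<^sub>R a) - ?fa (x + s *\<^sub>R a)" if "0 \<le> s" "s \<le> h" for s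
    using diff(1)[of s h] diff(1)[of s 0] that assms(2)
    by (intro DERIV_diff line) (simp_all add: add_ac)
  from MVT2[OF assms(2) this] obtain s where s: "0 < s" "s < h"
    and 1: "?\<phi> h - ?\<phi> 0 = h * (?fa (x + h *\<^sub>R b + s *\<^sub>R a) - ?fa (x + s *\<^sub>R a))" by auto
  have "DERIV (\<lambda>t. ?fa (x + s *\<^sub>R a + t *\<^sub>R b)) t :> frechet_derivative ?fa (at (x + s *\<^sub>R a + t *\<^sub>R b)) b"
    if "0 \<le> t" "t \<le> h" for t
    using diff(2)[of s t] that s by (intro line) simp_all
  from MVT2[OF assms(2) this] obtain t where t: "0 < t" "t < h"
    and 2: "?fa (x + s *\<^sub>R a + h *\<^sub>R b) - ?fa (x + s *\<^sub>R a + 0 *\<^sub>R b)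
       = h * frechet_derivative ?fa (at (x + s *\<^sub>R a + t *\<^sub>R b)) b" by auto
  show ?thesis
    using 1 2 inb[of s t] s t by (intro bexI[of _ "x + s *\<^sub>R a + t *\<^sub>R b"]) (simp_all add: add_ac)
qed

lemma symmetric_second_derivative_real:
  fixes f :: "'a::euclidean_space \<Rightarrow> real"
  assumes f: "Ck_on (Suc (Suc 0)) S f" and "open S" "x \<in> S"
  shows "frechet_derivative (\<lambda>y. frechet_derivative f (at y) a) (at x) b
       = frechet_derivative (\<lambda>y. frechet_derivative f (at y) b) (at x) a" (is "?ab x = ?ba x")
proof (rule ccontr)
  assume ne: "?ab x \<noteq> ?ba x"
  define d where "d = \<bar>?ab x - ?ba x\<bar> / 2"
  have d: "d > 0" using ne by (simp add: d_def)
  have "continuous_on S ?ab" "continuous_on S ?ba" using f by auto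
  then have "isCont ?ab x" "isCont ?ba x"
    using assms(2,3) by (auto simp: continuous_on_eq_continuous_at)
  then obtain e1 e2 where e: "e1 > 0" "\<And>y. dist y x < e1 \<Longrightarrow> dist (?ab y) (?ab x) < d"
    "e2 > 0" "\<And>y. dist y x < e2 \<Longrightarrow> dist (?ba y) (?ba x) < d"
    using d unfolding continuous_at_eps_delta dist_norm by metis
  obtain e0 where e0: "e0 > 0" "ball x e0 \<subseteq> S" using assms(2,3) openE by blast
  define \<epsilon> where "\<epsilon> = min e0 (min e1 e2)"
  have eps: "\<epsilon> > 0" using e e0 by (simp add: \<epsilon>_def)
  have C: "Ck_on (Suc (Suc 0)) (ball x \<epsilon>) f"
    by (rule Ck_on_subset[OF f]) (use e0 in \<open>auto simp: \<epsilon>_def\<close>)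
  define h where "h = \<epsilon> / (norm a + norm b + 1)"
  have n: "norm a + norm b + 1 > 0" by (simp add: add_nonneg_pos)
  have h: "h > 0" using eps n by (simp add: h_def)
  have hs: "h * (norm a + norm b) < \<epsilon>"
    using eps n by (simp add: h_def field_simps)
  obtain p where p: "p \<in> ball x \<epsilon>" "f (x + h *\<^sub>R a + h *\<^sub>R b) - f (x + h *\<^sub>R a) - f (x + h *\<^sub>R b) + f x = h * h * ?ab p"
    using second_difference_mean_value[OF C h hs] by auto
  obtain q where q: "q \<in> ball x \<epsilon>" "f (x + h *\<^sub>R b + h *\<^sub>R a) - f (x + h *\<^sub>R b) - f (x + h *\<^sub>R a) + f x = h * h * ?ba q"
    using second_difference_mean_value[OF C h, of b a] hs by (auto simp: add.commute)
  have swap: "x + h *\<^sub>R b + h *\<^sub>R a = x + h *\<^sub>R a + h *\<^sub>R b" by (simp add: add_ac)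
  have "h * h * ?ab p = h * h * ?ba q" using p(2) q(2)[unfolded swap] by linarith
  then have "?ab p = ?ba q" using h by simp
  moreover have "dist (?ab p) (?ab x) < d" "dist (?ba q) (?ba x) < d"
    using p(1) q(1) e by (auto simp: \<epsilon>_def dist_commute)
  ultimately show False by (simp add: d_def dist_real_def abs_if split: if_splits)
qed

lemma frechet_derivative_linear_compose:
  assumes "bounded_linear L" "f differentiable at x"
  shows "frechet_derivative (\<lambda>y. L (f y)) (at x) v = L (frechet_derivative f (at x) v)"
  using bounded_linear.has_derivative[OF assms(1) assms(2)[unfolded frechet_derivative_works]]
  by (metis frechet_derivative_at)

lemma symmetric_second_derivative:
  fixes f :: "'a::euclidean_space \<Rightarrow> 'b::euclidean_space"
  assumes f: "smooth_on S f" and "open S" "x \<in> S"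
  shows "frechet_derivative (\<lambda>y. frechet_derivative f (at y) a) (at x) b
       = frechet_derivative (\<lambda>y. frechet_derivative f (at y) b) (at x) a"
proof (rule euclidean_eqI)
  fix i :: 'b
  have I: "bounded_linear (\<lambda>v :: 'b. v \<bullet> i)" by (rule bounded_linear_inner_left)
  have D: "g differentiable at y" if "smooth_on S g" "y \<in> S" for g :: "'a \<Rightarrow> 'b" and y
    using smooth_on_has_derivative[OF that] by (auto simp: differentiable_def)
  have second: "frechet_derivative (\<lambda>y. frechet_derivative (\<lambda>z. f z \<bullet> i) (at y) v) (at x) w
      = frechet_derivative (\<lambda>y. frechet_derivative f (at y) v) (at x) w \<bullet> i" for v w
  proof -
    let ?Dv = "\<lambda>y. frechet_derivative f (at y) v"
    have "((\<lambda>y. ?Dv y \<bullet> i) has_derivative (\<lambda>w. frechet_derivative ?Dv (at x) w \<bullet> i)) (at x)"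
      by (intro bounded_linear.has_derivative[OF I] smooth_on_has_derivative[OF smooth_on_frechet_derivative[OF f] assms(3)])
    then have "((\<lambda>y. frechet_derivative (\<lambda>z. f z \<bullet> i) (at y) v) has_derivative
        (\<lambda>w. frechet_derivative ?Dv (at x) w \<bullet> i)) (at x)"
      by (rule has_derivative_transform_within_open[OF _ assms(2,3)])
         (simp add: frechet_derivative_linear_compose[OF I D[OF f]])
    then show ?thesis by (metis frechet_derivative_at)
  qed
  have "Ck_on (Suc (Suc 0)) S (\<lambda>z. f z \<bullet> i)"
    by (intro Ck_on_linear_compose[OF I assms(2)] smooth_onD[OF f])
  from symmetric_second_derivative_real[OF this assms(2,3), of a b]
  show "frechet_derivative (\<lambda>y. frechet_derivative f (at y) a) (at x) b \<bullet> i
       = frechet_derivative (\<lambda>y. frechet_derivative f (at y) b) (at x) a \<bullet> i"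
    by (simp only: second)
qed

lemma frechet_derivative_apply:
  "(f has_derivative f') (at x) \<Longrightarrow> frechet_derivative f (at x) v = f' v"
  by (drule frechet_derivative_at) simp

lemma vec2_expansion: "x = (x $ 1) *\<^sub>R axis 1 1 + (x $ 2) *\<^sub>R axis 2 (1 :: real)"
  for x :: "real^2"
  by (simp add: vec_eq_iff forall_2 axis_def)

lemma linear_vec2:
  fixes L :: "real^2 \<Rightarrow> 'a::real_vector"
  assumes "linear L"
  shows "L v = (v $ 1) *\<^sub>R L (axis 1 1) + (v $ 2) *\<^sub>R L (axis 2 1)"
  using linear_add[OF assms, of "v $ 1 *\<^sub>R axis 1 1" "v $ 2 *\<^sub>R axis 2 1"]
  by (simp only: vec2_expansion[symmetric] linear_cmul[OF assms])

section \<open>Smooth bump functions\<close>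

text \<open>The derivatives of \<open>exp (- 1 / t)\<close> are combinations of the functions in this family, so all members are shown
to be smooth by one induction.\<close>

definition exp_recip :: "nat \<Rightarrow> real \<Rightarrow> real" where
  "exp_recip n t = (if t > 0 then (1 / t) ^ n * exp (- (1 / t)) else 0)"

lemma exp_recip_tendsto_0: "(exp_recip n \<longlongrightarrow> 0) (at 0)"
proof -
  have "((\<lambda>t. (1 / t) ^ n / exp (1 / t)) \<longlongrightarrow> 0) (at_right (0 :: real))"
    using filterlim_compose[OF tendsto_power_div_exp_0[of n] filterlim_inverse_at_top_right]
    by (simp add: inverse_eq_divide)
  then have "(exp_recip n \<longlongrightarrow> 0) (at_right 0)"
    by (rule Lim_transform_eventually)
       (auto simp: exp_recip_def eventually_at_right_less exp_minus divide_inverse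
         intro!: eventually_mono[OF eventually_at_right_less[of 0]])
  moreover have "(exp_recip n \<longlongrightarrow> 0) (at_left 0)"
    by (rule Lim_transform_eventually[OF tendsto_const])
       (auto simp: exp_recip_def eventually_at_left_field intro!: exI[of _ "-1"])
  ultimately show ?thesis by (simp add: filterlim_split_at)
qed

lemma exp_recip_has_derivative:
  "(exp_recip n has_real_derivative exp_recip (n + 2) t - n * exp_recip (n + 1) t) (at t)"
proof -
  consider "t < 0" | "t = 0" | "t > 0" by linarith
  then show ?thesis
  proof cases
    case 1
    have "((\<lambda>_. 0) has_real_derivative 0) (at t)" by simp
    then have "(exp_recip n has_real_derivative 0) (at t)"
      by (rule has_field_derivative_transform_within_open[where S = "{..<0}"])
         (use 1 in \<open>auto simp: exp_recip_def\<close>)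
    then show ?thesis using 1 by (simp add: exp_recip_def)
  next
    case 2
    have "(\<lambda>s. (exp_recip n s - exp_recip n 0) / (s - 0)) = exp_recip (Suc n)"
      by (auto simp: exp_recip_def)
    then show ?thesis
      using exp_recip_tendsto_0[of "Suc n"] 2 unfolding has_field_derivative_iff
      by (simp add: exp_recip_def)
  next
    case 3
    have "((\<lambda>s. (1 / s) ^ n * exp (- (1 / s))) has_real_derivative
        (1 / t) ^ (n + 2) * exp (- (1 / t)) - n * ((1 / t) ^ (n + 1) * exp (- (1 / t)))) (at t)"
      using 3 power_eq_if[of t "n - 1"] by (cases n)
        (auto intro!: derivative_eq_intros simp: field_simps power2_eq_square)
    then have "(exp_recip n has_real_derivative
        (1 / t) ^ (n + 2) * exp (- (1 / t)) - n * ((1 / t) ^ (n + 1) * exp (- (1 / t)))) (at t)"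
      by (rule has_field_derivative_transform_within_open[where S = "{0<..}"])
         (use 3 in \<open>auto simp: exp_recip_def\<close>)
    then show ?thesis using 3 by (simp add: exp_recip_def)
  qed
qed

lemma smooth_on_exp_recip: "smooth_on UNIV (exp_recip n)"
proof -
  have "Ck_on k UNIV (exp_recip n)" for k n
  proof (induction k arbitrary: n)
    case 0
    then show ?case
      using DERIV_isCont[OF exp_recip_has_derivative]
      by (simp add: continuous_at_imp_continuous_on)
  next
    case (Suc k)
    have D: "(exp_recip n has_derivative (\<lambda>v. v * (exp_recip (n + 2) t + (- n) * exp_recip (n + 1) t))) (at t)" for t
      
      by (rule has_derivative_eq_rhs[OF has_field_derivative_imp_has_derivative[OF exp_recip_has_derivative]])
         (simp add: fun_eq_iff algebra_simps)
    show ?case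
      by (rule Ck_on_SucI[OF open_UNIV D])
         (intro Ck_on_bilinear[OF bounded_bilinear_mult] Ck_on_add Ck_on_const open_UNIV Suc.IH)
  qed
  then show ?thesis by (simp add: smooth_on_def)
qed

text \<open>This is \<open>exp (- 1 / (r\<^sup>2 - |x - x0|\<^sup>2))\<close> inside the ball of radius \<open>r\<close> around \<open>x0\<close> and 0 outside.\<close>

definition bump :: "'a::euclidean_space \<Rightarrow> real \<Rightarrow> 'a \<Rightarrow> real" where
  "bump x0 r x = exp_recip 0 (r\<^sup>2 - (x - x0) \<bullet> (x - x0))"

lemma smooth_on_bump: "smooth_on UNIV (bump x0 r)"
  unfolding bump_def
  by (intro smooth_on_compose[OF smooth_on_exp_recip] smooth_on_diff smooth_on_const smooth_on_inner
      smooth_on_linear[OF bounded_linear_ident] open_UNIV subset_UNIV)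

lemma bump_pos_iff:
  assumes "r > 0" shows "bump x0 r x > 0 \<longleftrightarrow> x \<in> ball x0 r"
proof -
  have "(x - x0) \<bullet> (x - x0) < r\<^sup>2 \<longleftrightarrow> dist x0 x < r"
    using assms power_mono_iff[of r "dist x0 x" 2]
    by (simp add: dist_norm norm_minus_commute dot_square_norm not_le[symmetric])
  then show ?thesis by (simp add: bump_def exp_recip_def)
qed

lemma bump_nonneg: "bump x0 r x \<ge> 0"
  by (simp add: bump_def exp_recip_def)

lemma bump_eq_0: "r > 0 \<Longrightarrow> x \<notin> ball x0 r \<Longrightarrow> bump x0 r x = 0"
  using bump_pos_iff[of r x0 x] bump_nonneg[of x0 r x] by linarith

section \<open>Derivatives along a direction\<close>

abbreviation differential :: "('a::real_normed_vector \<Rightarrow> 'b::real_normed_vector) \<Rightarrow> 'a \<Rightarrow> 'a \<Rightarrow> 'b" where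
  "differential f x \<equiv> frechet_derivative f (at x)"

lemma has_derivative_along:
  assumes "(f has_derivative f') (at p)"
  shows "((\<lambda>t. f (p + t *\<^sub>R v)) has_vector_derivative f' v) (at 0)"
proof -
  have line: "((\<lambda>t. p + t *\<^sub>R v) has_derivative (\<lambda>t. t *\<^sub>R v)) (at 0)"
    by (auto intro!: derivative_eq_intros)
  have "((\<lambda>t. f (p + t *\<^sub>R v)) has_derivative (\<lambda>t. f' (t *\<^sub>R v))) (at 0)"
    using has_derivative_compose[OF line, of f f'] assms by simp
  then show ?thesis
    using linear_cmul[OF has_derivative_linear[OF assms]] by (simp add: has_vector_derivative_def)
qed

lemma has_real_derivative_along:
  fixes f :: "'a::real_normed_vector \<Rightarrow> real"
  assumes "(f has_derivative f') (at p)"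
  shows "((\<lambda>t. f (p + t *\<^sub>R v)) has_real_derivative f' v) (at 0)"
  using has_derivative_along[OF assms] by (simp add: has_real_derivative_iff_has_vector_derivative)

lemma frechet_derivative_along:
  assumes "f differentiable (at p)" "((\<lambda>t. f (p + t *\<^sub>R v)) has_vector_derivative d) (at 0)"
  shows "differential f p v = d"
  using has_derivative_along[OF assms(1)[unfolded frechet_derivative_works], of v] assms(2)
    vector_derivative_unique_at by blast

section \<open>Orthonormal frames\<close>

lemma frame_expansion:
  fixes N T u :: "real^3"
  assumes "N \<bullet> N = 1" "T \<bullet> T = 1" "N \<bullet> T = 0"
  shows "u = (u \<bullet> N) *\<^sub>R N + (u \<bullet> T) *\<^sub>R T + (u \<bullet> cross3 N T) *\<^sub>R cross3 N T"
proof -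
  define M where "M = cross3 N T"
  define r where "r = u - (u \<bullet> N) *\<^sub>R N - (u \<bullet> T) *\<^sub>R T"
  have M: "M \<bullet> M = 1" "M \<bullet> N = 0" "M \<bullet> T = 0"
    using assms by (simp_all add: M_def dot_cross inner_commute dot_cross_self)
  have r: "r \<bullet> N = 0" "r \<bullet> T = 0" "r \<bullet> M = u \<bullet> M"
    using assms M by (simp_all add: r_def inner_diff_left inner_diff_right inner_commute)
  have "cross3 r M = 0" using r by (simp add: M_def Lagrange)
  then have "cross3 M r = 0" by (metis cross_skew neg_0_equal_iff_equal)
  then have "(norm M * norm r)\<^sup>2 = (M \<bullet> r)\<^sup>2"
    using norm_cross_dot[of M r] by simp
  then have "r \<bullet> r = (u \<bullet> M)\<^sup>2"
    using M(1) r(3) by (simp add: power_mult_distrib power2_norm_eq_inner inner_commute)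
  then have "(r - (u \<bullet> M) *\<^sub>R M) \<bullet> (r - (u \<bullet> M) *\<^sub>R M) = 0"
    using M(1) r(3) by (simp add: inner_diff_left inner_diff_right inner_commute power2_eq_square)
  then have "r = (u \<bullet> M) *\<^sub>R M" unfolding inner_eq_zero_iff by simp
  then show ?thesis unfolding r_def M_def by (simp add: diff_eq_eq add_ac)
qed

lemma frame_inner:
  fixes N T u w :: "real^3"
  assumes "N \<bullet> N = 1" "T \<bullet> T = 1" "N \<bullet> T = 0"
  shows "u \<bullet> w = (u \<bullet> N) * (w \<bullet> N) + (u \<bullet> T) * (w \<bullet> T) + (u \<bullet> cross3 N T) * (w \<bullet> cross3 N T)"
proof -
  have "u \<bullet> w = u \<bullet> ((w \<bullet> N) *\<^sub>R N + (w \<bullet> T) *\<^sub>R T + (w \<bullet> cross3 N T) *\<^sub>R cross3 N T)"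
    using frame_expansion[OF assms, of w] by simp
  then show ?thesis by (simp add: inner_add_right mult.commute)
qed

lemma frame_triple:
  fixes N T u :: "real^3"
  assumes "N \<bullet> N = 1" "N \<bullet> T = 0"
  shows "N \<bullet> cross3 u (cross3 N T) = u \<bullet> T" "N \<bullet> cross3 (cross3 N T) u = - (u \<bullet> T)"
proof -
  show 1: "N \<bullet> cross3 u (cross3 N T) = u \<bullet> T"
    using assms by (simp add: Lagrange inner_diff_right)
  then show "N \<bullet> cross3 (cross3 N T) u = - (u \<bullet> T)"
    by (subst cross_skew) simp
qed


section \<open>Direction fields that annihilate a map of rank one\<close>

text \<open>The commutator of the direction field \<open>a - m b\<close> with the constant field \<open>b\<close>: second derivatives of \<open>f\<close>
commute, so only the derivative of the coefficient \<open>m\<close> remains.\<close>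

lemma derivative_along_commutator:
  fixes f :: "'a::euclidean_space \<Rightarrow> 'b::euclidean_space" and m :: "'a \<Rightarrow> real"
  assumes "open S" "smooth_on S f" "smooth_on S m" "p \<in> S"
  shows "frechet_derivative (\<lambda>y. differential f y b) (at p) (a - m p *\<^sub>R b)
    = frechet_derivative (\<lambda>y. differential f y (a - m y *\<^sub>R b)) (at p) b
      + differential m p b *\<^sub>R differential f p b"
proof -
  let ?D = "\<lambda>v y. differential f y v"
  have D: "(?D v has_derivative differential (?D v) p) (at p)" for v
    by (rule smooth_on_has_derivative[OF smooth_on_frechet_derivative[OF assms(2)] assms(4)])
  have lin: "linear (differential f y)" if "y \<in> S" for y
    using has_derivative_linear[OF smooth_on_has_derivative[OF assms(2) that]] .
  have "((\<lambda>y. ?D a y - m y *\<^sub>R ?D b y) has_derivative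
     (\<lambda>v. differential (?D a) p v - (m p *\<^sub>R differential (?D b) p v
       + differential m p v *\<^sub>R ?D b p))) (at p)"
    by (intro has_derivative_diff has_derivative_scaleR D smooth_on_has_derivative[OF assms(3,4)])
  then have "((\<lambda>y. ?D (a - m y *\<^sub>R b) y) has_derivative
     (\<lambda>v. differential (?D a) p v - (m p *\<^sub>R differential (?D b) p v
       + differential m p v *\<^sub>R ?D b p))) (at p)"
    by (rule has_derivative_transform_within_open[OF _ assms(1,4)])
       (simp add: linear_diff[OF lin] linear_cmul[OF lin])
  then have "frechet_derivative (\<lambda>y. ?D (a - m y *\<^sub>R b) y) (at p)
    = (\<lambda>v. differential (?D a) p v - (m p *\<^sub>R differential (?D b) p v
       + differential m p v *\<^sub>R ?D b p))"
    by (rule frechet_derivative_at[symmetric])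
  then show ?thesis
    using symmetric_second_derivative[OF assms(2,1,4), of a b] has_derivative_linear[OF D[of b]]
    by (simp add: linear_diff linear_cmul)
qed

text \<open>A factor \<open>\<rho>\<close> whose logarithmic derivative along \<open>a - m b\<close> is \<open>m\<^sub>b\<close> absorbs the commutator: the operator
\<open>(1 / \<rho>) \<partial>\<^sub>b\<close> commutes with differentiation along \<open>a - m b\<close>.\<close>

lemma invariant_derivative_quotient:
  fixes f :: "'a::euclidean_space \<Rightarrow> 'b::euclidean_space" and m \<rho> :: "'a \<Rightarrow> real"
  assumes "open S" "smooth_on S f" "smooth_on S m" "smooth_on S \<rho>" "p \<in> S" "\<rho> p \<noteq> 0"
    and \<rho>: "differential \<rho> p (a - m p *\<^sub>R b) = differential m p b * \<rho> p"
  shows "((\<lambda>t. (1 / \<rho> (p + t *\<^sub>R (a - m p *\<^sub>R b))) *\<^sub>R frechet_derivative f (at (p + t *\<^sub>R (a - m p *\<^sub>R b))) b)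
     has_vector_derivative
       (1 / \<rho> p) *\<^sub>R frechet_derivative (\<lambda>y. differential f y (a - m y *\<^sub>R b)) (at p) b) (at 0)"
proof -
  let ?l = "a - m p *\<^sub>R b" and ?m' = "differential m p b"
  have 1: "((\<lambda>t. \<rho> (p + t *\<^sub>R ?l)) has_real_derivative ?m' * \<rho> p) (at 0)"
    using has_real_derivative_along[OF smooth_on_has_derivative[OF assms(4,5)], of ?l] \<rho> by simp
  have 2: "((\<lambda>t. 1 / \<rho> (p + t *\<^sub>R ?l)) has_real_derivative - (?m' / \<rho> p)) (at 0)"
    using assms(6) by (auto intro!: derivative_eq_intros 1)
  have 3: "((\<lambda>t. differential f (p + t *\<^sub>R ?l) b) has_vector_derivative
      frechet_derivative (\<lambda>y. differential f y (a - m y *\<^sub>R b)) (at p) b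
      + ?m' *\<^sub>R differential f p b) (at 0)"
    unfolding derivative_along_commutator[OF assms(1-3,5), symmetric]
    by (rule has_derivative_along[OF smooth_on_has_derivative[OF smooth_on_frechet_derivative[OF assms(2)] assms(5)]])
  show ?thesis
    using has_vector_derivative_scaleR[OF 2 3]
    by (rule has_vector_derivative_eq_rhs) (simp add: scaleR_right_distrib)
qed


text \<open>The differential of \<open>Z\<close> kills the direction field \<open>l = a - m b\<close> and does not kill \<open>b\<close>.  Locally the image
of \<open>Z\<close> is therefore a curve, \<open>(1 / \<rho>) \<partial>\<^sub>b\<close> is differentiation by its arc length, and \<open>T\<close> and \<open>K\<close> below are its unit
tangent and its curvature vector.\<close>

locale rank_one_direction =
  fixes S :: "(real^2) set" and Z :: "real^2 \<Rightarrow> real^3" and m :: "real^2 \<Rightarrow> real" and a b :: "real^2"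
  assumes open_S: "open S" and smooth_Z: "smooth_on S Z" and smooth_m: "smooth_on S m"
    and Z_l: "\<And>x. x \<in> S \<Longrightarrow> differential Z x (a - m x *\<^sub>R b) = 0"
    and Z_b: "\<And>x. x \<in> S \<Longrightarrow> differential Z x b \<noteq> 0"
begin

abbreviation l :: "real^2 \<Rightarrow> real^2" where "l x \<equiv> a - m x *\<^sub>R b"

definition \<rho> :: "real^2 \<Rightarrow> real" where "\<rho> x = norm (differential Z x b)"
definition T :: "real^2 \<Rightarrow> real^3" where "T x = (1 / \<rho> x) *\<^sub>R differential Z x b"
definition K :: "real^2 \<Rightarrow> real^3" where "K x = (1 / \<rho> x) *\<^sub>R differential T x b"

lemma \<rho>_pos: "x \<in> S \<Longrightarrow> \<rho> x > 0"
  using Z_b by (simp add: \<rho>_def)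

lemma smooth_\<rho>: "smooth_on S \<rho>"
  unfolding \<rho>_def[abs_def]
  by (intro smooth_on_norm smooth_on_frechet_derivative smooth_Z open_S Z_b)

lemma smooth_recip_\<rho>: "smooth_on S (\<lambda>x. 1 / \<rho> x)"
  using \<rho>_pos by (intro smooth_on_divide smooth_on_const smooth_\<rho> open_S) fastforce

lemma smooth_T: "smooth_on S T"
  unfolding T_def[abs_def]
  by (intro smooth_on_scaleR smooth_recip_\<rho> smooth_on_frechet_derivative smooth_Z open_S)

lemma smooth_K: "smooth_on S K"
  unfolding K_def[abs_def]
  by (intro smooth_on_scaleR smooth_recip_\<rho> smooth_on_frechet_derivative smooth_T open_S)

lemma along:
  assumes "smooth_on S f" "x \<in> S"
  shows "((\<lambda>t. f (x + t *\<^sub>R v)) has_vector_derivative differential f x v) (at 0)"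
  using has_derivative_along[OF smooth_on_has_derivative[OF assms]] .

lemma frechet_derivative_eq_0_on:
  assumes "\<And>y. y \<in> S \<Longrightarrow> f y = k" "x \<in> S"
  shows "differential f x v = 0"
proof -
  have "(f has_derivative (\<lambda>v. 0)) (at x)"
    by (rule has_derivative_transform_within_open[OF has_derivative_const open_S assms(2)]) (simp add: assms(1))
  then show ?thesis by (metis frechet_derivative_at)
qed

lemma Z_b_eq: "x \<in> S \<Longrightarrow> differential Z x b = \<rho> x *\<^sub>R T x"
  and T_b_eq: "x \<in> S \<Longrightarrow> differential T x b = \<rho> x *\<^sub>R K x"
  using \<rho>_pos[of x] by (simp_all add: T_def K_def)

lemma T_unit: "x \<in> S \<Longrightarrow> T x \<bullet> T x = 1"
  using \<rho>_pos[of x] unfolding T_def by (simp add: \<rho>_def dot_square_norm power2_eq_square)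

text \<open>Since \<open>Z\<close> is constant along \<open>l\<close>, the commutator formula gives \<open>\<partial>\<^sub>l Z\<^sub>b = m\<^sub>b Z\<^sub>b\<close>, and \<open>\<rho>\<close> is the length of \<open>Z\<^sub>b\<close>.\<close>

lemma \<rho>_l: assumes "x \<in> S" shows "differential \<rho> x (l x) = differential m x b * \<rho> x"
proof -
  let ?Zb = "\<lambda>y. differential Z y b"
  have "frechet_derivative (\<lambda>y. differential Z y (l y)) (at x) b = 0"
    using frechet_derivative_eq_0_on[OF Z_l assms] .
  then have 1: "differential ?Zb x (l x) = differential m x b *\<^sub>R ?Zb x"
    using derivative_along_commutator[OF open_S smooth_Z smooth_m assms, of b a] by simp
  have "(\<rho> has_derivative (\<lambda>v. differential ?Zb x v \<bullet> sgn (?Zb x))) (at x)"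
    unfolding \<rho>_def[abs_def]
    using has_derivative_compose[OF smooth_on_has_derivative[OF smooth_on_frechet_derivative[OF smooth_Z] assms]
        has_derivative_norm[OF Z_b[OF assms]]] .
  then have "differential \<rho> x (l x) = differential ?Zb x (l x) \<bullet> sgn (?Zb x)"
    by (metis frechet_derivative_at)
  also have "\<dots> = differential m x b * (?Zb x \<bullet> sgn (?Zb x))" by (simp add: 1)
  also have "?Zb x \<bullet> sgn (?Zb x) = \<rho> x"
    using Z_b[OF assms] by (simp add: \<rho>_def sgn_div_norm dot_square_norm power2_eq_square)
  finally show ?thesis .
qed

lemma quotient_along:
  fixes f :: "real^2 \<Rightarrow> real^3"
  assumes "smooth_on S f" "x \<in> S"
  shows "((\<lambda>t. (1 / \<rho> (x + t *\<^sub>R l x)) *\<^sub>R differential f (x + t *\<^sub>R l x) b)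
     has_vector_derivative (1 / \<rho> x) *\<^sub>R frechet_derivative (\<lambda>y. differential f y (l y)) (at x) b) (at 0)"
  using invariant_derivative_quotient[OF open_S assms(1) smooth_m smooth_\<rho> assms(2) _ \<rho>_l[OF assms(2)]]
    \<rho>_pos[OF assms(2)] by simp

text \<open>Differentiation by the arc length of \<open>Z\<close> preserves constancy along \<open>l\<close>; applied to \<open>Z\<close> and then to \<open>T\<close>, this
makes \<open>T\<close> and \<open>K\<close> constant along \<open>l\<close>.\<close>

lemma quotient_invariant:
  fixes f :: "real^2 \<Rightarrow> real^3"
  assumes "smooth_on S f" "x \<in> S" "\<And>y. y \<in> S \<Longrightarrow> differential f y (l y) = 0"
  shows "frechet_derivative (\<lambda>y. (1 / \<rho> y) *\<^sub>R differential f y b) (at x) (l x) = 0"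
proof (rule frechet_derivative_along)
  have "smooth_on S (\<lambda>y. (1 / \<rho> y) *\<^sub>R differential f y b)"
    by (intro smooth_on_scaleR smooth_recip_\<rho> smooth_on_frechet_derivative assms(1) open_S)
  from smooth_on_has_derivative[OF this assms(2)]
  show "(\<lambda>y. (1 / \<rho> y) *\<^sub>R differential f y b) differentiable at x"
    by (auto simp: differentiable_def)
  show "((\<lambda>t. (1 / \<rho> (x + t *\<^sub>R l x)) *\<^sub>R differential f (x + t *\<^sub>R l x) b)
     has_vector_derivative 0) (at 0)"
    using quotient_along[OF assms(1,2)] frechet_derivative_eq_0_on[OF assms(3,2)] by simp
qed

lemma T_l: "x \<in> S \<Longrightarrow> differential T x (l x) = 0"
  unfolding T_def[abs_def] using quotient_invariant[OF smooth_Z _ Z_l] .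

lemma K_l: "x \<in> S \<Longrightarrow> differential K x (l x) = 0"
  unfolding K_def[abs_def] using quotient_invariant[OF smooth_T _ T_l] .

end

section \<open>Non-umbilic points\<close>

text \<open>The Euler-Lagrange equation \<open>H |X|\<^sup>2 = \<alpha> (N \<bullet> X)\<close> times \<open>N \<bullet> (X\<^sub>v \<times> X\<^sub>w)\<close>: expanding \<open>N\<^sub>v\<close> and \<open>N\<^sub>w\<close> in
the basis \<open>X\<^sub>v\<close>, \<open>X\<^sub>w\<close> shows that the first factor is the trace of the shape operator times this area.  In this form
the equation can be evaluated on any pair of directions, without diagonalizing the shape operator.\<close>

abbreviation Euler_Lagrange_at ::
  "real \<Rightarrow> (real^2 \<Rightarrow> real^3) \<Rightarrow> (real^2 \<Rightarrow> real^3) \<Rightarrow> real^2 \<Rightarrow> real^2 \<Rightarrow> real^2 \<Rightarrow> bool" where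
  "Euler_Lagrange_at \<alpha> X N x v w \<equiv>
     (N x \<bullet> (cross3 (differential X x w) (differential N x v)
           + cross3 (differential N x w) (differential X x v))) * (X x \<bullet> X x)
      = \<alpha> * (N x \<bullet> X x) * (N x \<bullet> cross3 (differential X x v) (differential X x w))"

context rank_one_direction
begin

lemma inner_along:
  fixes f g :: "real \<Rightarrow> real^3"
  assumes "(f has_vector_derivative f') (at 0)" "(g has_vector_derivative g') (at 0)"
  shows "((\<lambda>t. f t \<bullet> g t) has_real_derivative f 0 \<bullet> g' + f' \<bullet> g 0) (at 0)"
  using bounded_bilinear.has_vector_derivative[OF bounded_bilinear_inner assms]
  by (simp add: has_real_derivative_iff_has_vector_derivative)

text \<open>The tool by which an identity valid at every point of \<open>S\<close> is differentiated in a direction \<open>v\<close>.\<close>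

lemma real_along_const:
  fixes g :: "real \<Rightarrow> real"
  assumes "x \<in> S" "(g has_real_derivative d) (at 0)" "\<And>t. x + t *\<^sub>R v \<in> S \<Longrightarrow> g t = k"
  shows "d = 0"
proof -
  have "open ((\<lambda>t. x + t *\<^sub>R v) -` S)"
    by (intro open_vimage[OF open_S] continuous_intros)
  then have "((\<lambda>t. k) has_real_derivative d) (at 0)"
    by (rule has_field_derivative_transform_within_open[OF assms(2)]) (use assms in auto)
  then show ?thesis using DERIV_const DERIV_unique by blast
qed

text \<open>Along \<open>l\<close> the orthonormal pair \<open>N\<close>, \<open>M = N \<times> T\<close> rotates in the plane orthogonal to the constant vector \<open>T\<close>,
with angular velocity \<open>\<theta> \<noteq> 0\<close>.  With respect to the rotation angle, \<open>p = N \<bullet> K\<close> and \<open>z = N \<bullet> Z\<close> are therefore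
solutions of \<open>f'' = - f\<close> with derivatives \<open>ps = M \<bullet> K\<close> and \<open>zs = M \<bullet> Z\<close>.  The Euler-Lagrange equation is
polynomial in \<open>p\<close> and \<open>z\<close>, with a constant term, terms of the first harmonic and one product \<open>p z\<close>.  Derivatives up
to order three separate them.  The constant term makes \<open>|Z|\<close> constant, and the curve \<open>Z\<close> then satisfies
\<open>Z \<bullet> T = 0\<close> and \<open>Z \<bullet> K = - 1\<close>, against the vanishing of the other terms.\<close>

lemma no_tube:
  fixes N X :: "real^2 \<Rightarrow> real^3" and \<alpha> c :: real
  assumes N: "smooth_on S N" and X: "smooth_on S X"
    and unit: "\<And>x. x \<in> S \<Longrightarrow> N x \<bullet> N x = 1"
    and normal: "\<And>x v. x \<in> S \<Longrightarrow> N x \<bullet> differential X x v = 0"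
    and Z: "\<And>x. x \<in> S \<Longrightarrow> Z x = N x + c *\<^sub>R X x" and c: "c \<noteq> 0"
    and immersed: "\<And>x. x \<in> S \<Longrightarrow> differential X x (l x) \<noteq> 0"
    and EL: "\<And>x v w. x \<in> S \<Longrightarrow> Euler_Lagrange_at \<alpha> X N x v w"
    and x0: "x0 \<in> S"
  shows False
proof -
  define M where "M x = cross3 (N x) (T x)" for x
  define \<theta> where "\<theta> x = differential N x (l x) \<bullet> M x" for x
  define p ps where "p x = N x \<bullet> K x" and "ps x = M x \<bullet> K x" for x
  define z zs where "z x = N x \<bullet> Z x" and "zs x = M x \<bullet> Z x" for x
  define Q where "Q x = Z x \<bullet> Z x" for x
  have DZ: "differential Z x v = differential N x v + c *\<^sub>R differential X x v"
    if "x \<in> S" for x v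
  proof -
    have "((\<lambda>x. N x + c *\<^sub>R X x) has_derivative
        (\<lambda>v. differential N x v + c *\<^sub>R differential X x v)) (at x)"
      by (intro has_derivative_add has_derivative_scaleR_right smooth_on_has_derivative[OF _ that] N X)
    then have "(Z has_derivative
        (\<lambda>v. differential N x v + c *\<^sub>R differential X x v)) (at x)"
      by (rule has_derivative_transform_within_open[OF _ open_S that]) (simp add: Z)
    then show ?thesis by (rule frechet_derivative_apply)
  qed
  \<comment> \<open>\<open>N\<^sub>l\<close> is orthogonal to \<open>N\<close> and, since \<open>T\<close> is tangent to the surface and constant along \<open>l\<close>, also to \<open>T\<close>\<close>
  have N_N: "N x \<bullet> differential N x v = 0" if "x \<in> S" for x v
    using real_along_const[where v = v, OF that inner_along[OF along[OF N that, of v] along[OF N that, of v]] unit]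
    by (simp add: inner_commute)
  have N_T: "N x \<bullet> T x = 0" if "x \<in> S" for x
    using DZ[OF that, of b] N_N[OF that] normal[OF that] by (simp add: T_def inner_add_right)
  have Nl_T: "differential N x (l x) \<bullet> T x = 0" if "x \<in> S" for x
    using real_along_const[where v = "l x", OF that inner_along[OF along[OF N that, of "l x"] along[OF smooth_T that, of "l x"]] N_T]
    by (simp add: T_l that)
  have Xl: "differential N x (l x) = - c *\<^sub>R differential X x (l x)" if "x \<in> S" for x
    using DZ[OF that, of "l x"] Z_l[OF that] by (simp add: eq_neg_iff_add_eq_0)
  note frame = unit T_unit N_T
  have Nl: "differential N x (l x) = \<theta> x *\<^sub>R M x" if "x \<in> S" for x
    using frame_expansion[OF frame[OF that], of "differential N x (l x)"]
      N_N[OF that] Nl_T[OF that] by (simp add: \<theta>_def M_def inner_commute)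
  have \<theta>: "\<theta> x \<noteq> 0" if "x \<in> S" for x
    using Nl[OF that] Xl[OF that] c immersed[OF that] by auto
  have M_T: "cross3 (M x) (T x) = - N x" if "x \<in> S" for x
    using Lagrange[of "T x" "N x" "T x"] T_unit[OF that] N_T[OF that] cross_skew[of "M x" "T x"]
    by (simp add: M_def inner_commute)
  have dN: "((\<lambda>t. N (x + t *\<^sub>R l x)) has_vector_derivative \<theta> x *\<^sub>R M x) (at 0)" if "x \<in> S" for x
    using along[OF N that, of "l x"] Nl[OF that] by simp
  have dT: "((\<lambda>t. T (x + t *\<^sub>R l x)) has_vector_derivative 0) (at 0)"
    and dK: "((\<lambda>t. K (x + t *\<^sub>R l x)) has_vector_derivative 0) (at 0)"
    and dZ: "((\<lambda>t. Z (x + t *\<^sub>R l x)) has_vector_derivative 0) (at 0)" if "x \<in> S" for x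
    using along[OF smooth_T that, of "l x"] along[OF smooth_K that, of "l x"] along[OF smooth_Z that, of "l x"]
      T_l[OF that] K_l[OF that] Z_l[OF that] by simp_all
  have dM: "((\<lambda>t. M (x + t *\<^sub>R l x)) has_vector_derivative - \<theta> x *\<^sub>R N x) (at 0)" if "x \<in> S" for x
    using bounded_bilinear.has_vector_derivative[OF bounded_bilinear_cross3 dN[OF that] dT[OF that]] M_T[OF that]
    by (simp add: M_def cross_mult_left)
  have dp: "((\<lambda>t. p (x + t *\<^sub>R l x)) has_real_derivative \<theta> x * ps x) (at 0)"
    and dps: "((\<lambda>t. ps (x + t *\<^sub>R l x)) has_real_derivative - \<theta> x * p x) (at 0)"
    and dz: "((\<lambda>t. z (x + t *\<^sub>R l x)) has_real_derivative \<theta> x * zs x) (at 0)"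
    and dzs: "((\<lambda>t. zs (x + t *\<^sub>R l x)) has_real_derivative - \<theta> x * z x) (at 0)"
    and dQ: "((\<lambda>t. Q (x + t *\<^sub>R l x)) has_real_derivative 0) (at 0)" if "x \<in> S" for x
    using inner_along[OF dN[OF that] dK[OF that]] inner_along[OF dM[OF that] dK[OF that]]
      inner_along[OF dN[OF that] dZ[OF that]] inner_along[OF dM[OF that] dZ[OF that]]
      inner_along[OF dZ[OF that] dZ[OF that]]
    by (simp_all add: p_def ps_def z_def zs_def Q_def)
  \<comment> \<open>The second principal curvature enters through the \<open>T\<close>-components of \<open>N\<^sub>b\<close> and \<open>X\<^sub>b\<close>, where \<open>N\<^sub>b + c X\<^sub>b = \<rho> T\<close>.\<close>
  have Nb_T: "differential N x b \<bullet> T x = - (\<rho> x * p x)" if "x \<in> S" for x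
    using real_along_const[where v = b, OF that inner_along[OF along[OF N that, of b] along[OF smooth_T that, of b]] N_T]
      T_b_eq[OF that] by (simp add: p_def)
  have Xb_T: "c * (differential X x b \<bullet> T x) = \<rho> x * (1 + p x)" if "x \<in> S" for x
  proof -
    have "(differential N x b + c *\<^sub>R differential X x b) \<bullet> T x = \<rho> x"
      unfolding DZ[OF that, symmetric] Z_b_eq[OF that] using T_unit[OF that] by simp
    then show ?thesis using Nb_T[OF that] by (simp add: inner_add_left algebra_simps)
  qed
  have P0: "(1 + 2 * p x) * (Q x + 1 - 2 * z x) = \<alpha> * (z x - 1) * (1 + p x)" if "x \<in> S" for x
  proof -
    define \<beta> \<nu> where "\<beta> = differential X x b \<bullet> T x" and "\<nu> = differential N x b \<bullet> T x"
    have Xl': "differential X x (l x) = (- \<theta> x / c) *\<^sub>R M x"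
    proof -
      have "c *\<^sub>R differential X x (l x) = c *\<^sub>R ((- \<theta> x / c) *\<^sub>R M x)"
        using Xl[OF that] Nl[OF that] c by (simp add: eq_neg_iff_add_eq_0 add.commute)
      then show ?thesis using c by (simp only: scaleR_cancel_left) simp
    qed
    have "(\<theta> x * \<beta> - \<theta> x / c * \<nu>) * (X x \<bullet> X x) = \<alpha> * (N x \<bullet> X x) * (\<theta> x / c * \<beta>)"
      using EL[OF that, of b "l x"] frame_triple[OF unit[OF that] N_T[OF that]]
      unfolding Nl[OF that] Xl' \<beta>_def \<nu>_def
      by (simp add: inner_add_right inner_diff_right cross_mult_left cross_mult_right M_def)
    then have "\<theta> x * ((c * \<beta> - \<nu>) * (X x \<bullet> X x)) = \<theta> x * (\<alpha> * (N x \<bullet> X x) * \<beta>)"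
      using c by (simp add: field_simps)
    then have "(c * \<beta> - \<nu>) * (X x \<bullet> X x) = \<alpha> * (N x \<bullet> X x) * \<beta>"
      using \<theta>[OF that] by simp
    \<comment> \<open>Multiplied by \<open>c\<^sup>2\<close>, everything is expressed by \<open>c X = Z - N\<close>, and \<open>c\<close> disappears.\<close>
    then have scaled: "(c * \<beta> - \<nu>) * (c * c * (X x \<bullet> X x)) = \<alpha> * (c * (N x \<bullet> X x)) * (c * \<beta>)"
      by algebra
    have e1: "c * \<beta> - \<nu> = \<rho> x * (1 + 2 * p x)" and e2: "c * \<beta> = \<rho> x * (1 + p x)"
      using Nb_T[OF that] Xb_T[OF that] by (simp_all add: \<beta>_def \<nu>_def algebra_simps)
    have cX: "c *\<^sub>R X x = Z x - N x" using Z[OF that] by simp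
    have e3: "c * (N x \<bullet> X x) = z x - 1"
      using unit[OF that] arg_cong[OF cX, of "\<lambda>u. N x \<bullet> u"] by (simp add: z_def inner_diff_right)
    have "c * c * (X x \<bullet> X x) = (c *\<^sub>R X x) \<bullet> (c *\<^sub>R X x)" by simp
    then have e4: "c * c * (X x \<bullet> X x) = Q x + 1 - 2 * z x"
      unfolding cX using unit[OF that] by (simp add: Q_def z_def inner_diff_left inner_diff_right inner_commute)
    have "\<rho> x * ((1 + 2 * p x) * (Q x + 1 - 2 * z x)) = \<rho> x * (\<alpha> * (z x - 1) * (1 + p x))"
      using scaled unfolding e1 e3 e4 unfolding e2 by (simp add: mult_ac)
    then show ?thesis using \<rho>_pos[OF that] by simp
  qed
  \<comment> \<open>Coefficients of \<open>p\<close>, \<open>z\<close> and \<open>p z\<close> in the expanded identity; all three are constant along \<open>l\<close>.\<close>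
  define A B D where "A x = 2 * Q x + 2 + \<alpha>" and "B = - (2 + \<alpha>)" and "D = - (4 + \<alpha>)" for x
  have dA: "((\<lambda>t. A (x + t *\<^sub>R l x)) has_real_derivative 0) (at 0)" if "x \<in> S" for x
    unfolding A_def by (auto intro!: derivative_eq_intros dQ that)
  have P0': "Q x + 1 + \<alpha> + A x * p x + B * z x + D * (p x * z x) = 0" if "x \<in> S" for x
    using P0[OF that] by (simp add: A_def B_def D_def algebra_simps)
  \<comment> \<open>Successive derivatives with respect to the rotation angle, the factor \<open>\<theta>\<close> being divided out each time.\<close>
  have P1: "A x * ps x + B * zs x + D * (ps x * z x + p x * zs x) = 0" if "x \<in> S" for x
  proof -
    have "((\<lambda>t. Q (x + t *\<^sub>R l x) + 1 + \<alpha> + A (x + t *\<^sub>R l x) * p (x + t *\<^sub>R l x) + B * z (x + t *\<^sub>R l x)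
        + D * (p (x + t *\<^sub>R l x) * z (x + t *\<^sub>R l x))) has_real_derivative
        \<theta> x * (A x * ps x + B * zs x + D * (ps x * z x + p x * zs x))) (at 0)"
      by (rule derivative_eq_intros refl dA[OF that] dp[OF that] dz[OF that] dQ[OF that])+ (simp add: algebra_simps)
    from real_along_const[where v = "l x", OF that this P0'] show ?thesis using \<theta>[OF that] by simp
  qed
  have P2: "- (A x * p x) - B * z x + D * (2 * (ps x * zs x) - 2 * (p x * z x)) = 0" if "x \<in> S" for x
  proof -
    have "((\<lambda>t. A (x + t *\<^sub>R l x) * ps (x + t *\<^sub>R l x) + B * zs (x + t *\<^sub>R l x)
        + D * (ps (x + t *\<^sub>R l x) * z (x + t *\<^sub>R l x) + p (x + t *\<^sub>R l x) * zs (x + t *\<^sub>R l x))) has_real_derivative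
        \<theta> x * (- (A x * p x) - B * z x + D * (2 * (ps x * zs x) - 2 * (p x * z x)))) (at 0)"
      by (rule derivative_eq_intros refl dA[OF that] dp[OF that] dz[OF that] dps[OF that] dzs[OF that])+ (simp add: algebra_simps)
    from real_along_const[where v = "l x", OF that this P1] show ?thesis using \<theta>[OF that] by simp
  qed
  have P3: "- (A x * ps x) - B * zs x - 4 * D * (ps x * z x + p x * zs x) = 0" if "x \<in> S" for x
  proof -
    have "((\<lambda>t. - (A (x + t *\<^sub>R l x) * p (x + t *\<^sub>R l x)) - B * z (x + t *\<^sub>R l x)
        + D * (2 * (ps (x + t *\<^sub>R l x) * zs (x + t *\<^sub>R l x)) - 2 * (p (x + t *\<^sub>R l x) * z (x + t *\<^sub>R l x))))
        has_real_derivative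
        \<theta> x * (- (A x * ps x) - B * zs x - 4 * D * (ps x * z x + p x * zs x))) (at 0)"
      by (rule derivative_eq_intros refl dA[OF that] dp[OF that] dz[OF that] dps[OF that] dzs[OF that])+ (simp add: algebra_simps)
    from real_along_const[where v = "l x", OF that this P2] show ?thesis using \<theta>[OF that] by simp
  qed
  \<comment> \<open>First harmonics cancel in the sum of the first and third derivative.\<close>
  have U: "D * (ps x * z x + p x * zs x) = 0" if "x \<in> S" for x
    using P1[OF that] P3[OF that] by linarith
  have V: "D * (ps x * zs x - p x * z x) = 0" if "x \<in> S" for x
  proof -
    have "((\<lambda>t. D * (ps (x + t *\<^sub>R l x) * z (x + t *\<^sub>R l x) + p (x + t *\<^sub>R l x) * zs (x + t *\<^sub>R l x)))
        has_real_derivative \<theta> x * (2 * (D * (ps x * zs x - p x * z x)))) (at 0)"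
      by (rule derivative_eq_intros refl dp[OF that] dz[OF that] dps[OF that] dzs[OF that])+ (simp add: algebra_simps)
    from real_along_const[where v = "l x", OF that this U] show ?thesis using \<theta>[OF that] by simp
  qed
  \<comment> \<open>\<open>U\<close> and \<open>V\<close> say that the product of the complex numbers \<open>p + i ps\<close> and \<open>z + i zs\<close> is 0.\<close>
  have W: "p x * z x = 0 \<and> ps x * zs x = 0" if "x \<in> S" "D \<noteq> 0" for x
  proof -
    have "ps x * zs x = p x * z x" "ps x * z x = - (p x * zs x)"
      using U[OF that(1)] V[OF that(1)] that(2) by auto
    then have "((p x)\<^sup>2 + (ps x)\<^sup>2) * ((z x)\<^sup>2 + (zs x)\<^sup>2) = 0" by algebra
    then show ?thesis by (auto simp: sum_power2_eq_zero_iff)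
  qed
  \<comment> \<open>What is left of the identity is its constant term.\<close>
  have Qconst: "Q x = - 1 - \<alpha>" if "x \<in> S" for x
    using W[OF that] P0'[OF that] P2[OF that] by (cases "D = 0") auto
  have Z_T: "Z x \<bullet> T x = 0" if "x \<in> S" for x
  proof -
    have "((\<lambda>t. Q (x + t *\<^sub>R b)) has_real_derivative 2 * \<rho> x * (Z x \<bullet> T x)) (at 0)"
      unfolding Q_def using inner_along[OF along[OF smooth_Z that, of b] along[OF smooth_Z that, of b]]
      by (simp add: Z_b_eq[OF that] inner_commute mult.assoc)
    from real_along_const[where v = b, OF that this Qconst] show ?thesis using \<rho>_pos[OF that] by simp
  qed
  have Z_K: "Z x \<bullet> K x = - 1" if "x \<in> S" for x
  proof -
    have "((\<lambda>t. Z (x + t *\<^sub>R b) \<bullet> T (x + t *\<^sub>R b)) has_real_derivative \<rho> x * (Z x \<bullet> K x + 1)) (at 0)"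
      using inner_along[OF along[OF smooth_Z that, of b] along[OF smooth_T that, of b]]
      by (simp add: Z_b_eq[OF that] T_b_eq[OF that] T_unit[OF that] algebra_simps)
    from real_along_const[where v = b, OF that this Z_T] show ?thesis using \<rho>_pos[OF that] by simp
  qed
  \<comment> \<open>If \<open>D \<noteq> 0\<close>, both products on the left vanish.  If \<open>D = 0\<close>, that is \<open>\<alpha> = - 4\<close>, then \<open>z = - 2 p\<close> and \<open>|Z|\<^sup>2 = 3\<close> give \<open>- 3 / 2\<close> instead.\<close>
  have "z x0 * p x0 + zs x0 * ps x0 = - 1"
    using frame_inner[OF frame[OF x0], of "Z x0" "K x0"] Z_T[OF x0] Z_K[OF x0]
    by (simp add: z_def zs_def p_def ps_def M_def inner_commute)
  moreover have "z x0 * z x0 + zs x0 * zs x0 = Q x0"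
    using frame_inner[OF frame[OF x0], of "Z x0" "Z x0"] Z_T[OF x0]
    by (simp add: z_def zs_def Q_def M_def inner_commute)
  moreover have "z x0 = - 2 * p x0" "zs x0 = - 2 * ps x0" "Q x0 = 3" if "D = 0"
    using that P2[OF x0] P1[OF x0] Qconst[OF x0] by (simp_all add: A_def B_def D_def)
  ultimately show False
    using W[OF x0] by (cases "D = 0") (auto simp: algebra_simps)
qed

text \<open>Here \<open>Z\<close> itself is the unit normal.  It is constant along \<open>l\<close>, and so is \<open>M = Z \<times> T\<close>; because the second
fundamental form is symmetric, \<open>X\<^sub>l\<close> is a multiple of \<open>M\<close>, so the integral curves of \<open>l\<close> are straight
lines.  With respect to arc length on such a line \<open>|X|\<^sup>2\<close> has second derivative 2.  On the other hand the
only principal curvature besides 0 is \<open>- 1 / w\<close>, where \<open>w\<close> is affine on the line because \<open>w\<^sub>l\<close> is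
computed from the arc-length derivative \<open>R\<close> of the invariant vector \<open>M\<close>; the Euler-Lagrange equation
\<open>|X|\<^sup>2 + \<alpha> h w = 0\<close> with \<open>h = Z \<bullet> X\<close> constant makes \<open>|X|\<^sup>2\<close> affine as well.\<close>

lemma no_developable:
  fixes X :: "real^2 \<Rightarrow> real^3" and \<alpha> :: real
  assumes X: "smooth_on S X"
    and unit: "\<And>x. x \<in> S \<Longrightarrow> Z x \<bullet> Z x = 1"
    and normal: "\<And>x v. x \<in> S \<Longrightarrow> Z x \<bullet> differential X x v = 0"
    and immersed: "\<And>x. x \<in> S \<Longrightarrow> differential X x (l x) \<noteq> 0"
    and EL: "\<And>x v w. x \<in> S \<Longrightarrow> Euler_Lagrange_at \<alpha> X Z x v w"
    and x0: "x0 \<in> S"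
  shows False
proof -
  let ?X' = "\<lambda>x. differential X x"
  define M where "M x = cross3 (Z x) (T x)" for x
  define \<tau> where "\<tau> x = ?X' x (l x) \<bullet> M x" for x
  define P where "P x = (1 / \<rho> x) *\<^sub>R ?X' x b" for x
  define R where "R x = (1 / \<rho> x) *\<^sub>R differential M x b" for x
  have N_N: "Z x \<bullet> differential Z x v = 0" if "x \<in> S" for x v
    using real_along_const[where v = v, OF that inner_along[OF along[OF smooth_Z that, of v] along[OF smooth_Z that, of v]] unit]
    by (simp add: inner_commute)
  have N_T: "Z x \<bullet> T x = 0" if "x \<in> S" for x
    using N_N[OF that] by (simp add: T_def)
  note frame = unit T_unit N_T
  have second_form: "differential (\<lambda>y. ?X' y v) x w \<bullet> Z x = - (?X' x v \<bullet> differential Z x w)"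
    if "x \<in> S" for x v w
    using real_along_const[where v = w, OF that inner_along[OF along[OF smooth_Z that, of w]
          along[OF smooth_on_frechet_derivative[OF X] that, of w v]] normal]
    by (simp add: inner_commute)
  have sym: "?X' x v \<bullet> differential Z x w = ?X' x w \<bullet> differential Z x v" if "x \<in> S" for x v w
    using second_form[OF that, of v w] second_form[OF that, of w v]
      symmetric_second_derivative[OF X open_S that, of v w] by simp
  have Xl_T: "?X' x (l x) \<bullet> T x = 0" if "x \<in> S" for x
    using sym[OF that, of "l x" b] Z_l[OF that] by (simp add: T_def)
  have Xl: "?X' x (l x) = \<tau> x *\<^sub>R M x" if "x \<in> S" for x
    using frame_expansion[OF frame[OF that], of "?X' x (l x)"] normal[OF that] Xl_T[OF that]
    by (simp add: \<tau>_def M_def inner_commute)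
  have \<tau>: "\<tau> x \<noteq> 0" if "x \<in> S" for x using Xl[OF that] immersed[OF that] by auto
  have smooth_M: "smooth_on S M"
    unfolding M_def[abs_def] by (intro smooth_on_cross3 smooth_Z smooth_T open_S)
  have lin: "linear (?X' x)" if "x \<in> S" for x
    using has_derivative_linear[OF smooth_on_has_derivative[OF X that]] .
  have smooth_Xl: "smooth_on S (\<lambda>x. ?X' x (l x))"
  proof (rule smooth_on_cong[OF open_S])
    show "smooth_on S (\<lambda>x. ?X' x a - m x *\<^sub>R ?X' x b)"
      by (intro smooth_on_diff smooth_on_scaleR smooth_m smooth_on_frechet_derivative X open_S)
  qed (simp add: linear_diff[OF lin] linear_cmul[OF lin])
  have smooth_\<tau>: "smooth_on S \<tau>"
    unfolding \<tau>_def[abs_def] by (intro smooth_on_inner smooth_Xl smooth_M open_S)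
  have dX: "((\<lambda>t. X (x + t *\<^sub>R l x)) has_vector_derivative \<tau> x *\<^sub>R M x) (at 0)"
    and dZ: "((\<lambda>t. Z (x + t *\<^sub>R l x)) has_vector_derivative 0) (at 0)"
    and dT: "((\<lambda>t. T (x + t *\<^sub>R l x)) has_vector_derivative 0) (at 0)" if "x \<in> S" for x
    using along[OF X that, of "l x"] along[OF smooth_Z that, of "l x"] along[OF smooth_T that, of "l x"]
      Xl[OF that] Z_l[OF that] T_l[OF that] by simp_all
  have dM: "((\<lambda>t. M (x + t *\<^sub>R l x)) has_vector_derivative 0) (at 0)" if "x \<in> S" for x
    using bounded_bilinear.has_vector_derivative[OF bounded_bilinear_cross3 dZ[OF that] dT[OF that]]
    by (simp add: M_def)
  have M_l: "differential M x (l x) = 0" if "x \<in> S" for x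
    using dM[OF that] along[OF smooth_M that, of "l x"] vector_derivative_unique_at by blast
  have dR: "((\<lambda>t. R (x + t *\<^sub>R l x)) has_vector_derivative 0) (at 0)" if "x \<in> S" for x
    using quotient_along[OF smooth_M that] frechet_derivative_eq_0_on[OF M_l that, where v = b]
    by (simp add: R_def)
  have M_T: "M x \<bullet> T x = 0" for x by (simp add: M_def dot_cross_self)
  \<comment> \<open>The arc-length derivative commutes with \<open>\<partial>\<^sub>l\<close>, so \<open>P\<^sub>l\<close> is the arc-length derivative of \<open>X\<^sub>l = \<tau> M\<close>.\<close>
  have dP: "((\<lambda>t. P (x + t *\<^sub>R l x)) has_vector_derivative
      (1 / \<rho> x) *\<^sub>R (\<tau> x *\<^sub>R differential M x b + differential \<tau> x b *\<^sub>R M x)) (at 0)"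
    if "x \<in> S" for x
  proof -
    have "((\<lambda>y. \<tau> y *\<^sub>R M y) has_derivative
       (\<lambda>v. \<tau> x *\<^sub>R differential M x v + differential \<tau> x v *\<^sub>R M x)) (at x)"
      by (intro has_derivative_scaleR smooth_on_has_derivative[OF _ that] smooth_\<tau> smooth_M)
    then have "((\<lambda>y. ?X' y (l y)) has_derivative
       (\<lambda>v. \<tau> x *\<^sub>R differential M x v + differential \<tau> x v *\<^sub>R M x)) (at x)"
      by (rule has_derivative_transform_within_open[OF _ open_S that]) (simp add: Xl)
    then have "frechet_derivative (\<lambda>y. ?X' y (l y)) (at x)
       = (\<lambda>v. \<tau> x *\<^sub>R differential M x v + differential \<tau> x v *\<^sub>R M x)"
      by (rule frechet_derivative_at[symmetric])
    then show ?thesis using quotient_along[OF X that] by (simp add: P_def)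
  qed
  define w h \<mu> where "w x = P x \<bullet> T x" and "h x = Z x \<bullet> X x" and "\<mu> x = R x \<bullet> T x" for x
  have dw: "((\<lambda>t. w (x + t *\<^sub>R l x)) has_real_derivative \<tau> x * \<mu> x) (at 0)" if "x \<in> S" for x
    using inner_along[OF dP[OF that] dT[OF that]] M_T
    by (simp add: w_def \<mu>_def R_def inner_add_left scaleR_right_distrib)
  have dh: "((\<lambda>t. h (x + t *\<^sub>R l x)) has_real_derivative 0) (at 0)" if "x \<in> S" for x
    using inner_along[OF dZ[OF that] dX[OF that]] by (simp add: h_def M_def dot_cross_self)
  have d\<mu>: "((\<lambda>t. \<mu> (x + t *\<^sub>R l x)) has_real_derivative 0) (at 0)" if "x \<in> S" for x
    using inner_along[OF dR[OF that] dT[OF that]] by (simp add: \<mu>_def)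
  have E0: "X x \<bullet> X x + \<alpha> * h x * w x = 0" if "x \<in> S" for x
  proof -
    have "\<tau> x * (\<rho> x * (X x \<bullet> X x)) = - \<alpha> * (Z x \<bullet> X x) * (\<tau> x * (?X' x b \<bullet> T x))"
      using EL[OF that, of b "l x"] frame_triple[OF unit[OF that] N_T[OF that]] T_unit[OF that]
      unfolding Xl[OF that] Z_l[OF that] Z_b_eq[OF that]
      by (simp add: cross_mult_left cross_mult_right M_def)
    then have "\<tau> x * (\<rho> x * (X x \<bullet> X x + \<alpha> * h x * w x)) = 0"
      using \<rho>_pos[OF that] by (simp add: h_def w_def P_def distrib_left mult_ac)
    then show ?thesis using \<tau>[OF that] \<rho>_pos[OF that] by simp
  qed
  have E1: "2 * (X x \<bullet> M x) + \<alpha> * h x * \<mu> x = 0" if "x \<in> S" for x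
  proof -
    have "((\<lambda>t. X (x + t *\<^sub>R l x) \<bullet> X (x + t *\<^sub>R l x) + \<alpha> * h (x + t *\<^sub>R l x) * w (x + t *\<^sub>R l x))
        has_real_derivative \<tau> x * (2 * (X x \<bullet> M x) + \<alpha> * h x * \<mu> x)) (at 0)"
      by (rule derivative_eq_intros refl inner_along[OF dX[OF that] dX[OF that]] dh[OF that] dw[OF that])+ (simp add: algebra_simps inner_commute)
    from real_along_const[where v = "l x", OF that this E0] show ?thesis using \<tau>[OF that] by simp
  qed
  have "((\<lambda>t. 2 * (X (x0 + t *\<^sub>R l x0) \<bullet> M (x0 + t *\<^sub>R l x0)) + \<alpha> * h (x0 + t *\<^sub>R l x0) * \<mu> (x0 + t *\<^sub>R l x0))
      has_real_derivative \<tau> x0 * (2 * (M x0 \<bullet> M x0))) (at 0)"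
    by (rule derivative_eq_intros refl inner_along[OF dX[OF x0] dM[OF x0]] dh[OF x0] d\<mu>[OF x0])+ (simp add: algebra_simps)
  from real_along_const[where v = "l x0", OF x0 this E1] have "M x0 \<bullet> M x0 = 0" using \<tau>[OF x0] by simp
  then show False
    using frame_inner[OF frame[OF x0], of "M x0" "M x0"] Xl[OF x0] immersed[OF x0] by simp
qed

end

text \<open>Where \<open>Z = N + c X\<close> satisfies \<open>Z\<^sub>b \<noteq> 0\<close>, the kernel of \<open>dZ\<close> forces \<open>Z\<^sub>a = m Z\<^sub>b\<close> with a smooth function \<open>m\<close>.  So
\<^locale>\<open>rank_one_direction\<close> applies on a neighbourhood, and the surface would be a tube or a developable surface.
The pair \<open>a\<close>, \<open>b\<close> will be the standard basis in either order.\<close>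

lemma umbilic_if_spanning_directions:
  fixes X N :: "real^2 \<Rightarrow> real^3" and \<alpha> c :: real and a b :: "real^2"
  assumes S: "open S" and X: "smooth_on S X" and N: "smooth_on S N"
    and unit: "\<And>x. x \<in> S \<Longrightarrow> N x \<bullet> N x = 1"
    and normal: "\<And>x v. x \<in> S \<Longrightarrow> N x \<bullet> differential X x v = 0"
    and immersed: "\<And>x. x \<in> S \<Longrightarrow> inj (differential X x)"
    and EL: "\<And>x v w. x \<in> S \<Longrightarrow> Euler_Lagrange_at \<alpha> X N x v w"
    and curvature: "\<And>x. x \<in> S \<Longrightarrow>
      \<exists>\<xi>. \<xi> \<noteq> 0 \<and> differential N x \<xi> + c *\<^sub>R differential X x \<xi> = 0"
    and span: "\<And>\<xi>. \<exists>s t. \<xi> = s *\<^sub>R a + t *\<^sub>R b" and indep: "\<And>t. a \<noteq> t *\<^sub>R b"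
    and x0: "x0 \<in> S"
  shows "differential N x0 b + c *\<^sub>R differential X x0 b = 0"
proof (rule ccontr)
  assume ne: "\<not> ?thesis"
  define Z where "Z x = N x + c *\<^sub>R X x" for x
  have Z: "smooth_on S Z"
    unfolding Z_def[abs_def] by (intro smooth_on_add smooth_on_scaleR smooth_on_const X N S)
  have DZ: "differential Z x v = differential N x v + c *\<^sub>R differential X x v"
    if "x \<in> S" for x v
    unfolding Z_def[abs_def]
    by (rule frechet_derivative_apply)
       (intro has_derivative_add has_derivative_scaleR_right smooth_on_has_derivative[OF _ that] N X)
  let ?Za = "\<lambda>x. differential Z x a" and ?Zb = "\<lambda>x. differential Z x b"
  define U where "U = {x \<in> S. ?Zb x \<noteq> 0}"
  have "U = S \<inter> ?Zb -` (- {0})" by (auto simp: U_def)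
  moreover have "continuous_on S ?Zb"
    by (intro smooth_on_imp_continuous_on smooth_on_frechet_derivative Z)
  ultimately have U: "open U" using S continuous_open_preimage by blast
  have US: "U \<subseteq> S" by (auto simp: U_def)
  have lin: "linear (differential f x)" if "smooth_on S f" "x \<in> U" for f :: "real^2 \<Rightarrow> real^3" and x
    using has_derivative_linear[OF smooth_on_has_derivative[OF that(1)]] that(2) US by blast
  define m where "m x = (?Za x \<bullet> ?Zb x) / (?Zb x \<bullet> ?Zb x)" for x
  have "smooth_on U m"
    unfolding m_def[abs_def] using US Z U_def
    by (intro smooth_on_divide smooth_on_inner smooth_on_frechet_derivative U smooth_on_subset[OF Z US]) auto
  moreover have "differential Z x (a - m x *\<^sub>R b) = 0" if x: "x \<in> U" for x
  proof -
    interpret DZ: linear "differential Z x" using lin[OF Z x] .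
    have xS: "x \<in> S" using x US by blast
    obtain \<xi> where \<xi>: "\<xi> \<noteq> 0" "differential Z x \<xi> = 0"
      using curvature[OF xS] unfolding DZ[OF xS, symmetric] by blast
    obtain s t where st: "\<xi> = s *\<^sub>R a + t *\<^sub>R b" using span by blast
    have eq: "s *\<^sub>R ?Za x + t *\<^sub>R ?Zb x = 0" using \<xi>(2) by (simp add: st DZ.add DZ.scaleR)
    have s: "s \<noteq> 0" using eq \<xi>(1) x by (auto simp: st U_def)
    have "?Za x = (1 / s) *\<^sub>R (s *\<^sub>R ?Za x)" using s by simp
    also have "s *\<^sub>R ?Za x = - t *\<^sub>R ?Zb x" using eq by (simp add: eq_neg_iff_add_eq_0)
    finally have Za: "?Za x = (- t / s) *\<^sub>R ?Zb x" by simp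
    then have "m x = - t / s" using x unfolding m_def by (simp add: U_def)
    then show ?thesis using Za by (simp add: DZ.add DZ.diff DZ.scaleR)
  qed
  ultimately interpret rank_one_direction U Z m a b
    using U smooth_on_subset[OF Z US] by unfold_locales (auto simp: U_def)
  have immersed': "differential X x (a - m x *\<^sub>R b) \<noteq> 0" if "x \<in> U" for x
  proof -
    have "a - m x *\<^sub>R b \<noteq> 0" using indep by simp
    then show ?thesis
      using immersed[of x] linear_0[OF lin[OF X that]] that US by (metis injD subsetD)
  qed
  have x0U: "x0 \<in> U" using ne x0 DZ by (simp add: U_def)
  show False
  proof (cases "c = 0")
    case True
    then have "Z = N" by (simp add: Z_def fun_eq_iff)
    note no_developable' = no_developable[OF smooth_on_subset[OF X US] _ _ immersed' _ x0U, unfolded this]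
    show False
      by (rule no_developable'; (rule unit normal EL)?; use US in blast)
  next
    case False
    show False
      by (rule no_tube[OF smooth_on_subset[OF N US] smooth_on_subset[OF X US] _ _ Z_def False immersed' _ x0U];
          (rule unit normal EL)?; use US in blast)
  qed
qed

lemma umbilic_if_principal_curvature_constant:
  fixes X N :: "real^2 \<Rightarrow> real^3" and \<alpha> c :: real
  assumes S: "open S" and X: "smooth_on S X" and N: "smooth_on S N"
    and unit: "\<And>x. x \<in> S \<Longrightarrow> N x \<bullet> N x = 1"
    and normal: "\<And>x v. x \<in> S \<Longrightarrow> N x \<bullet> differential X x v = 0"
    and immersed: "\<And>x. x \<in> S \<Longrightarrow> inj (differential X x)"
    and EL: "\<And>x v w. x \<in> S \<Longrightarrow> Euler_Lagrange_at \<alpha> X N x v w"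
    and curvature: "\<And>x. x \<in> S \<Longrightarrow>
      \<exists>\<xi>. \<xi> \<noteq> 0 \<and> differential N x \<xi> + c *\<^sub>R differential X x \<xi> = 0"
    and x: "x \<in> S"
  shows "differential N x v + c *\<^sub>R differential X x v = 0"
proof -
  let ?e1 = "axis 1 1 :: real^2" and ?e2 = "axis 2 1 :: real^2"
  have indep: "?e1 \<noteq> t *\<^sub>R ?e2" "?e2 \<noteq> t *\<^sub>R ?e1" for t
    by (simp_all add: vec_eq_iff forall_2 axis_def)
  have span: "\<exists>s t. \<xi> = s *\<^sub>R ?e1 + t *\<^sub>R ?e2" "\<exists>s t. \<xi> = s *\<^sub>R ?e2 + t *\<^sub>R ?e1" for \<xi> :: "real^2"
    using vec2_expansion[of \<xi>] by (metis add.commute)+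
  note umbilic = umbilic_if_spanning_directions[OF S X N unit normal immersed EL curvature _ _ x]
  have e: "differential N x ?e2 + c *\<^sub>R differential X x ?e2 = 0"
    "differential N x ?e1 + c *\<^sub>R differential X x ?e1 = 0"
    by (rule umbilic; (assumption | rule span indep))+
  let ?f = "\<lambda>v. differential N x v + c *\<^sub>R differential X x v"
  have "linear (differential N x)" "linear (differential X x)"
    using has_derivative_linear[OF smooth_on_has_derivative[OF N x]]
      has_derivative_linear[OF smooth_on_has_derivative[OF X x]] .
  then have "linear ?f"
    by (intro linear_compose_add linear_compose_scale_right)
  then have "?f v = v $ 1 *\<^sub>R ?f ?e1 + v $ 2 *\<^sub>R ?f ?e2" by (rule linear_vec2)
  then show ?thesis by (simp add: e)
qed

section \<open>Change of variables for nonnegative functions\<close>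

lemma nn_integral_eq_integral_on:
  fixes g :: "'a::euclidean_space \<Rightarrow> real"
  assumes "(\<lambda>x. indicator S x * g x) \<in> borel_measurable borel" "\<And>x. x \<in> S \<Longrightarrow> g x \<ge> 0" "g integrable_on S"
  shows "(\<integral>\<^sup>+x\<in>S. ennreal (g x) \<partial>lborel) = ennreal (integral S g)"
proof -
  have "((\<lambda>x. if x \<in> S then g x else 0) has_integral integral S g) UNIV"
    using assms(3) by (simp add: has_integral_restrict_UNIV integrable_integral)
  then have "((\<lambda>x. indicator S x * g x) has_integral integral S g) UNIV"
    by (rule has_integral_eq[rotated]) auto
  then have "(\<integral>\<^sup>+x. ennreal (indicator S x * g x) \<partial>lborel) = ennreal (integral S g)"
    using assms(1,2) by (intro nn_integral_has_integral_lborel) (auto simp: indicator_def)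
  then show ?thesis
    by (subst (asm) nn_integral_cong[of lborel _ "\<lambda>x. ennreal (g x) * indicator S x"]) (auto simp: indicator_def)
qed

text \<open>Exhaust \<open>U\<close> by compact sets.  On \<open>S\<close> intersected with one of them the integrand is bounded, and the
formula for absolutely integrable functions applies; monotone convergence then allows infinite integrals.\<close>

lemma nn_integral_change_of_variables:
  fixes \<phi> :: "real^'n::{finite,wellorder} \<Rightarrow> real^'n::_" and f :: "real^'n::_ \<Rightarrow> real"
  assumes U: "open U" and V: "open (\<phi> ` U)" and inj: "inj_on \<phi> U"
    and \<phi>: "\<And>x. x \<in> U \<Longrightarrow> (\<phi> has_derivative \<phi>' x) (at x)"
    and f: "continuous_on (\<phi> ` U) f" "\<And>y. y \<in> \<phi> ` U \<Longrightarrow> f y \<ge> 0"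
    and g: "continuous_on U g" "\<And>x. x \<in> U \<Longrightarrow> g x = \<bar>det (matrix (\<phi>' x))\<bar> * f (\<phi> x)"
    and S: "S \<in> sets borel" "\<phi> ` S \<in> sets borel" "S \<subseteq> U"
  shows "(\<integral>\<^sup>+x\<in>S. ennreal (g x) \<partial>lborel) = (\<integral>\<^sup>+y\<in>\<phi> ` S. ennreal (f y) \<partial>lborel)"
proof -
  obtain C where C: "\<And>n :: nat. compact (C n)" "\<And>n. C n \<subseteq> U" "\<And>n. C n \<subseteq> interior (C (Suc n))" "\<Union> (range C) = U"
    using open_Union_compact_subsets[OF U] by metis
  have mono: "C n \<subseteq> C (Suc n)" for n using C(3)[of n] interior_subset by blast
  have cont\<phi>: "continuous_on U \<phi>"
    using \<phi> by (intro continuous_at_imp_continuous_on ballI has_derivative_continuous) blast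
  have C\<phi>: "compact (\<phi> ` C n)" for n
    by (rule compact_continuous_image[OF continuous_on_subset[OF cont\<phi> C(2)] C(1)])
  define Sn where "Sn n = S \<inter> C n" for n
  have Sn: "Sn n \<in> sets borel" "Sn n \<subseteq> U" for n
    using S borel_compact[OF C(1)[of n]] by (auto simp: Sn_def)
  have "\<phi> ` Sn n = \<phi> ` S \<inter> \<phi> ` C n" for n
    using inj_on_image_Int[OF inj S(3) C(2)] by (simp add: Sn_def)
  then have \<phi>Sn: "\<phi> ` Sn n \<in> sets borel" for n
    using S(2) borel_compact[OF C\<phi>[of n]] by auto
  have step: "(\<integral>\<^sup>+x\<in>Sn n. ennreal (g x) \<partial>lborel) = (\<integral>\<^sup>+y\<in>\<phi> ` Sn n. ennreal (f y) \<partial>lborel)" for n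
  proof -
    have "set_integrable lborel (C n) g"
      unfolding set_integrable_def
      by (rule borel_integrable_compact[OF C(1) continuous_on_subset[OF g(1) C(2)]])
    then have "set_integrable lborel (Sn n) g"
      by (rule set_integrable_subset) (use Sn(1) in \<open>auto simp: Sn_def\<close>)
    then have gint: "g absolutely_integrable_on (Sn n)"
      unfolding set_integrable_def
      using integrable_completion[of "\<lambda>x. indicator (Sn n) x *\<^sub>R g x" lborel] borel_measurable_integrable by blast
    have "g x = \<bar>det (matrix (\<phi>' x))\<bar> * f (\<phi> x)" if "x \<in> Sn n" for x
      using g(2) Sn(2) that by blast
    then have "(\<lambda>x. \<bar>det (matrix (\<phi>' x))\<bar> * f (\<phi> x)) absolutely_integrable_on (Sn n)"
      by (rule set_integrable_cong[THEN iffD1, OF refl refl _ gint])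
    moreover have "(\<lambda>x. \<bar>det (matrix (\<phi>' x))\<bar> * f (\<phi> x)) absolutely_integrable_on (Sn n) \<and>
        integral (Sn n) (\<lambda>x. \<bar>det (matrix (\<phi>' x))\<bar> * f (\<phi> x)) = r
      \<longleftrightarrow> f absolutely_integrable_on (\<phi> ` Sn n) \<and> integral (\<phi> ` Sn n) f = r" for r
    proof -
      have "Sn n \<in> sets lebesgue" using Sn(1) by simp
      moreover have "(\<phi> has_derivative \<phi>' x) (at x within Sn n)" if "x \<in> Sn n" for x
        using \<phi>[of x] Sn(2) that has_derivative_at_withinI by blast
      moreover have "inj_on \<phi> (Sn n)" using inj Sn(2) inj_on_subset by blast
      ultimately show ?thesis
        using has_absolute_integral_change_of_variables[of "Sn n" \<phi> \<phi>' "\<lambda>y. vec (f y) :: real^1" "vec r"]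
        by (simp add: absolutely_integrable_on_1_iff integral_on_1_eq vec_eq_iff)
    qed
    ultimately have fint: "f absolutely_integrable_on (\<phi> ` Sn n)"
      and eq: "integral (Sn n) (\<lambda>x. \<bar>det (matrix (\<phi>' x))\<bar> * f (\<phi> x)) = integral (\<phi> ` Sn n) f"
      by metis+
    have "integral (Sn n) g = integral (Sn n) (\<lambda>x. \<bar>det (matrix (\<phi>' x))\<bar> * f (\<phi> x))"
      by (rule integral_cong) (use g(2) Sn(2) in blast)
    then have "ennreal (integral (Sn n) g) = ennreal (integral (\<phi> ` Sn n) f)" by (simp only: eq)
    moreover have "(\<integral>\<^sup>+x\<in>Sn n. ennreal (g x) \<partial>lborel) = ennreal (integral (Sn n) g)"
    proof (rule nn_integral_eq_integral_on)
      show "(\<lambda>x. indicator (Sn n) x * g x) \<in> borel_measurable borel"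
        using borel_measurable_continuous_on_indicator[OF Sn(1) continuous_on_subset[OF g(1) Sn(2)]] by simp
      show "g integrable_on Sn n"
        using gint set_lebesgue_integral_eq_integral(1) by blast
      show "g x \<ge> 0" if "x \<in> Sn n" for x
      proof -
        have "x \<in> U" using Sn(2) that by blast
        then show ?thesis using f(2)[of "\<phi> x"] by (simp add: g(2))
      qed
    qed
    moreover have "(\<integral>\<^sup>+x\<in>\<phi> ` Sn n. ennreal (f x) \<partial>lborel) = ennreal (integral (\<phi> ` Sn n) f)"
    proof (rule nn_integral_eq_integral_on)
      show "(\<lambda>x. indicator (\<phi> ` Sn n) x * f x) \<in> borel_measurable borel"
        using borel_measurable_continuous_on_indicator[OF \<phi>Sn continuous_on_subset[OF f(1) image_mono[OF Sn(2)]]] by simp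
      show "f integrable_on \<phi> ` Sn n"
        using fint set_lebesgue_integral_eq_integral(1) by blast
    qed (use f(2) Sn(2) in blast)
    ultimately show ?thesis by simp
  qed
  have exhaust: "(\<integral>\<^sup>+x\<in>(\<Union>n. B n). ennreal (h x) \<partial>lborel) = (SUP n. \<integral>\<^sup>+x\<in>B n. ennreal (h x) \<partial>lborel)"
    if W: "open W" and h: "continuous_on W h" and B: "\<And>n. B n \<in> sets borel" "\<And>n :: nat. B n \<subseteq> B (Suc n)" "\<And>n. B n \<subseteq> W"
    for W and h :: "real^'n::_ \<Rightarrow> real" and B
  proof -
    let ?D = "density lborel (\<lambda>x. ennreal (indicator W x *\<^sub>R h x))"
    have meas: "(\<lambda>x. ennreal (indicator W x *\<^sub>R h x)) \<in> borel_measurable lborel"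
      using borel_measurable_continuous_on_indicator[OF _ h] W by measurable
    have em: "emeasure ?D T = (\<integral>\<^sup>+x\<in>T. ennreal (h x) \<partial>lborel)" if "T \<in> sets borel" "T \<subseteq> W" for T
      using that by (subst emeasure_density[OF meas]) (auto intro!: nn_integral_cong simp: indicator_def)
    have "incseq B" using B(2) by (rule incseq_SucI)
    then have "(SUP n. emeasure ?D (B n)) = emeasure ?D (\<Union>n. B n)"
      by (intro SUP_emeasure_incseq) (use B in auto)
    moreover have "(\<Union>n. B n) \<in> sets borel" "(\<Union>n. B n) \<subseteq> W" using B(1,3) by (simp, blast)
    ultimately show ?thesis using B by (simp only: em)
  qed
  have USn: "(\<Union>n. Sn n) = S" using S(3) C(4) by (auto simp: Sn_def)
  have "Sn n \<subseteq> Sn (Suc n)" for n using mono[of n] by (auto simp: Sn_def)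
  from exhaust[OF U g(1), of Sn, OF Sn(1) this Sn(2)] have "(\<integral>\<^sup>+x\<in>S. ennreal (g x) \<partial>lborel) = (SUP n. \<integral>\<^sup>+x\<in>Sn n. ennreal (g x) \<partial>lborel)"
    unfolding USn .
  also have "\<dots> = (SUP n. \<integral>\<^sup>+y\<in>\<phi> ` Sn n. ennreal (f y) \<partial>lborel)" by (simp add: step)
  also have "\<dots> = (\<integral>\<^sup>+y\<in>(\<Union>n. \<phi> ` Sn n). ennreal (f y) \<partial>lborel)"
  proof (rule exhaust[OF V f(1), symmetric])
    show "\<phi> ` Sn n \<subseteq> \<phi> ` Sn (Suc n)" for n using mono[of n] by (auto simp: Sn_def)
  qed (use \<phi>Sn Sn(2) in auto)
  also have "(\<Union>n. \<phi> ` Sn n) = \<phi> ` S" using USn by blast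
  finally show ?thesis .
qed

section \<open>Charts and transition maps\<close>

text \<open>This identity is behind both facts about overlapping charts: area densities differ by the absolute value of
the Jacobian determinant, and unit normals agree when that determinant is positive.\<close>

lemma coord_normal_reparametrization:
  fixes L :: "real^2 \<Rightarrow> real^3" and P :: "real^2 \<Rightarrow> real^2"
  assumes "linear L" "linear P"
  shows "cross3 (L (P (axis 1 1))) (L (P (axis 2 1))) = det (matrix P) *\<^sub>R cross3 (L (axis 1 1)) (L (axis 2 1))"
proof -
  note L = linear_vec2[OF assms(1)]
  show ?thesis
    unfolding L[of "P (axis 1 1)"] L[of "P (axis 2 1)"]
    by (simp add: det_2 matrix_def cross_add_left cross_add_right cross_mult_left cross_mult_right
        cross_skew[of "L (axis 2 1)" "L (axis 1 1)"] algebra_simps)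
qed

locale surface_atlas =
  fixes A :: "'s::{t2_space,second_countable_topology} chart set"
  assumes atlas: "oriented_smooth_atlas A"
begin

lemma chart:
  assumes "c \<in> A"
  shows open_dom: "open (chart_dom c)" and open_img: "open (chart_img c)"
    and homeo: "homeomorphism (chart_dom c) (chart_img c) (chart_map c) (chart_inv c)"
  using atlas assms by (auto simp: oriented_smooth_atlas_def is_chart_def)

lemma chart_inv_map: "c \<in> A \<Longrightarrow> p \<in> chart_dom c \<Longrightarrow> chart_inv c (chart_map c p) = p"
  and chart_map_inv: "c \<in> A \<Longrightarrow> x \<in> chart_img c \<Longrightarrow> chart_map c (chart_inv c x) = x"
  and chart_inv_dom: "c \<in> A \<Longrightarrow> x \<in> chart_img c \<Longrightarrow> chart_inv c x \<in> chart_dom c"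
  and chart_map_img: "c \<in> A \<Longrightarrow> p \<in> chart_dom c \<Longrightarrow> chart_map c p \<in> chart_img c"
  using homeo[of c] by (auto simp: homeomorphism_def)

lemma cont_map: "c \<in> A \<Longrightarrow> continuous_on (chart_dom c) (chart_map c)"
  and cont_inv: "c \<in> A \<Longrightarrow> continuous_on (chart_img c) (chart_inv c)"
  using homeo[of c] by (auto simp: homeomorphism_def)

lemma map_image_eq:
  assumes "c \<in> A" "B \<subseteq> chart_dom c"
  shows "chart_map c ` B = {x \<in> chart_img c. chart_inv c x \<in> B}"
proof (intro equalityI subsetI)
  fix x assume "x \<in> {x \<in> chart_img c. chart_inv c x \<in> B}"
  then show "x \<in> chart_map c ` B" using chart_map_inv[OF assms(1), of x] by (metis (lifting) imageI mem_Collect_eq)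
next
  fix x assume "x \<in> chart_map c ` B"
  then obtain p where "p \<in> B" "x = chart_map c p" by blast
  then show "x \<in> {x \<in> chart_img c. chart_inv c x \<in> B}"
    using assms(2) chart_inv_map[OF assms(1)] chart_map_img[OF assms(1)] by auto
qed

lemma open_map_image:
  assumes "c \<in> A" "open B" "B \<subseteq> chart_dom c"
  shows "open (chart_map c ` B)"
proof -
  have "chart_map c ` B = chart_img c \<inter> chart_inv c -` B"
    using map_image_eq[OF assms(1,3)] by auto
  then show ?thesis
    using continuous_open_preimage[OF cont_inv[OF assms(1)] open_img[OF assms(1)] assms(2)] by simp
qed

lemma compact_inv_image: "c \<in> A \<Longrightarrow> compact K \<Longrightarrow> K \<subseteq> chart_img c \<Longrightarrow> compact (chart_inv c ` K)"
  using compact_continuous_image continuous_on_subset cont_inv by blast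

lemma inv_image_mem_iff:
  assumes c: "c \<in> A" and K: "K \<subseteq> chart_img c" and x: "x \<in> chart_img c"
  shows "chart_inv c x \<in> chart_inv c ` K \<longleftrightarrow> x \<in> K"
proof
  assume "chart_inv c x \<in> chart_inv c ` K"
  then obtain y where y: "y \<in> K" "chart_inv c x = chart_inv c y" by blast
  have "x = chart_map c (chart_inv c x)" by (rule chart_map_inv[OF c x, symmetric])
  also have "\<dots> = chart_map c (chart_inv c y)" by (rule arg_cong[OF y(2)])
  also have "\<dots> = y" by (rule chart_map_inv[OF c subsetD[OF K y(1)]])
  finally show "x \<in> K" using y(1) by (rule ssubst)
qed (rule imageI)

abbreviation overlap :: "'s chart \<Rightarrow> 's chart \<Rightarrow> (real^2) set" where
  "overlap c d \<equiv> chart_map c ` (chart_dom c \<inter> chart_dom d)"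

abbreviation transition :: "'s chart \<Rightarrow> 's chart \<Rightarrow> real^2 \<Rightarrow> real^2" where
  "transition c d \<equiv> chart_map d \<circ> chart_inv c"

lemma open_overlap: "c \<in> A \<Longrightarrow> d \<in> A \<Longrightarrow> open (overlap c d)"
  using open_map_image open_dom by (simp add: open_Int)

lemma overlap_eq: "c \<in> A \<Longrightarrow> overlap c d = {x \<in> chart_img c. chart_inv c x \<in> chart_dom d}"
  using map_image_eq[of c "chart_dom c \<inter> chart_dom d"] chart_inv_dom[of c] by auto

lemma smooth_transition: "c \<in> A \<Longrightarrow> d \<in> A \<Longrightarrow> smooth_on (overlap c d) (transition c d)"
  and det_transition: "c \<in> A \<Longrightarrow> d \<in> A \<Longrightarrow> x \<in> overlap c d \<Longrightarrow>
     det (matrix (differential (transition c d) x)) > 0"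
  using atlas by (auto simp: oriented_smooth_atlas_def)

lemma transition_image:
  assumes "c \<in> A" "d \<in> A" "B \<subseteq> chart_dom c \<inter> chart_dom d"
  shows "transition c d ` (chart_map c ` B) = chart_map d ` B"
  using assms(3) chart_inv_map[OF assms(1)] by (force simp: image_comp)

lemma inj_transition: "c \<in> A \<Longrightarrow> d \<in> A \<Longrightarrow> inj_on (transition c d) (overlap c d)"
  using chart_inv_map[of c] chart_inv_map[of d] by (intro inj_onI) (auto, metis)

lemma atlas_cover: "\<exists>c\<in>A. p \<in> chart_dom c"
  using atlas by (auto simp: oriented_smooth_atlas_def)

lemma local_rep_transition:
  assumes "c \<in> A" "d \<in> A" "x \<in> overlap c d"
  shows "local_rep c f x = local_rep d f (transition c d x)"
  using assms(3) chart_inv_map[OF assms(1)] chart_inv_map[OF assms(2)] by (auto simp: local_rep_def)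

lemma transition_in_img: "c \<in> A \<Longrightarrow> d \<in> A \<Longrightarrow> x \<in> overlap c d \<Longrightarrow> transition c d x \<in> chart_img d"
  using chart_map_img[of d] chart_inv_map[of c] by auto

lemma frechet_derivative_transition:
  assumes "c \<in> A" "d \<in> A" "x \<in> overlap c d" "local_rep d f differentiable (at (transition c d x))"
  shows "(local_rep c f has_derivative
      (\<lambda>v. differential (local_rep d f) (transition c d x) (differential (transition c d) x v))) (at x)"
proof -
  have "((\<lambda>x. local_rep d f (transition c d x)) has_derivative
      (\<lambda>v. differential (local_rep d f) (transition c d x) (differential (transition c d) x v))) (at x)"
    by (rule has_derivative_compose[OF smooth_on_has_derivative[OF smooth_transition[OF assms(1,2)] assms(3)]])
       (use assms(4) in \<open>simp add: frechet_derivative_works\<close>)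
  then show ?thesis
    by (rule has_derivative_transform_within_open[OF _ open_overlap[OF assms(1,2)] assms(3)])
       (simp add: local_rep_transition[OF assms(1,2)])
qed

lemma coord_normal_transition:
  assumes "c \<in> A" "d \<in> A" "x \<in> overlap c d" "local_rep d f differentiable (at (transition c d x))"
  shows "coord_normal (local_rep c f) x = det (matrix (differential (transition c d) x))
       *\<^sub>R coord_normal (local_rep d f) (transition c d x)"
proof -
  have "linear (differential (transition c d) x)"
    using has_derivative_linear[OF smooth_on_has_derivative[OF smooth_transition[OF assms(1,2)] assms(3)]] .
  moreover have "linear (differential (local_rep d f) (transition c d x))"
    using assms(4) has_derivative_linear unfolding frechet_derivative_works by blast
  ultimately show ?thesis
    unfolding coord_normal_def frechet_derivative_at[OF frechet_derivative_transition[OF assms], symmetric]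
    by (rule coord_normal_reparametrization[rotated])
qed

lemma immersion_smooth: "smooth_immersion A f \<Longrightarrow> c \<in> A \<Longrightarrow> smooth_on (chart_img c) (local_rep c f)"
  by (simp add: smooth_immersion_def)

lemma immersion_differentiable:
  "smooth_immersion A f \<Longrightarrow> c \<in> A \<Longrightarrow> x \<in> chart_img c \<Longrightarrow> local_rep c f differentiable (at x)"
  unfolding differentiable_def using smooth_on_has_derivative[OF immersion_smooth] by blast

lemma smooth_on_coord_normal:
  assumes "open S" "smooth_on S X"
  shows "smooth_on S (coord_normal X)"
  unfolding coord_normal_def[abs_def]
  by (intro smooth_on_cross3 smooth_on_frechet_derivative assms)

lemma continuous_area_density:
  assumes "smooth_immersion A f" "c \<in> A"
  shows "continuous_on (chart_img c) (area_density (local_rep c f))"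
  unfolding area_density_def[abs_def]
  using smooth_on_imp_continuous_on[OF smooth_on_coord_normal[OF open_img[OF assms(2)] immersion_smooth[OF assms]]]
  by (intro continuous_on_norm)


section \<open>The area measure\<close>

text \<open>The default value outside the image makes the inverse of a chart a Borel function on the whole plane, along
which a measure can be pushed forward.\<close>

definition total_inv :: "'s chart \<Rightarrow> real^2 \<Rightarrow> 's" where
  "total_inv c x = (if x \<in> chart_img c then chart_inv c x else undefined)"

definition chart_measure :: "('s \<Rightarrow> real^3) \<Rightarrow> 's chart \<Rightarrow> 's measure" where
  "chart_measure f c =
     distr (density lborel (\<lambda>x. ennreal (indicator (chart_img c) x * area_density (local_rep c f) x))) borel (total_inv c)"

lemma measurable_total_inv: "c \<in> A \<Longrightarrow> total_inv c \<in> borel_measurable borel"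
  unfolding total_inv_def[abs_def]
  by (intro borel_measurable_continuous_on_if cont_inv continuous_on_const) (simp add: open_img)

lemma borel_map_image:
  assumes "c \<in> A" "B \<in> sets borel" "B \<subseteq> chart_dom c"
  shows "chart_map c ` B \<in> sets borel"
proof -
  have "chart_map c ` B = chart_img c \<inter> total_inv c -` B"
    unfolding map_image_eq[OF assms(1,3)] by (auto simp: total_inv_def)
  moreover have "total_inv c -` B \<in> sets borel"
    using measurable_sets[OF measurable_total_inv[OF assms(1)] assms(2)] by simp
  ultimately show ?thesis using open_img[OF assms(1)] by auto
qed

lemma measurable_indicator_area_density:
  assumes "smooth_immersion A f" "c \<in> A"
  shows "(\<lambda>x. indicator (chart_img c) x * area_density (local_rep c f) x) \<in> borel_measurable borel"
  using borel_measurable_continuous_on_indicator[OF _ continuous_area_density[OF assms]] open_img[OF assms(2)]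
  by simp

lemma emeasure_chart_measure:
  assumes f: "smooth_immersion A f" and c: "c \<in> A" and B: "B \<in> sets borel" "B \<subseteq> chart_dom c"
  shows "emeasure (chart_measure f c) B
    = (\<integral>\<^sup>+x\<in>chart_map c ` B. ennreal (area_density (local_rep c f) x) \<partial>lborel)"
proof -
  let ?D = "density lborel (\<lambda>x. ennreal (indicator (chart_img c) x * area_density (local_rep c f) x))"
  have meas: "(\<lambda>x. ennreal (indicator (chart_img c) x * area_density (local_rep c f) x)) \<in> borel_measurable lborel"
    using measurable_indicator_area_density[OF f c] by simp
  have inv: "total_inv c \<in> measurable ?D borel" using measurable_total_inv[OF c] by simp
  have "emeasure (chart_measure f c) B = emeasure ?D (total_inv c -` B)"
    unfolding chart_measure_def using emeasure_distr[OF inv B(1)] by simp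
  also have "\<dots> = (\<integral>\<^sup>+x. ennreal (indicator (chart_img c) x * area_density (local_rep c f) x)
      * indicator (total_inv c -` B) x \<partial>lborel)"
    using measurable_sets[OF inv B(1)] by (intro emeasure_density[OF meas]) simp
  also have "\<dots> = (\<integral>\<^sup>+x\<in>chart_map c ` B. ennreal (area_density (local_rep c f) x) \<partial>lborel)"
    unfolding map_image_eq[OF c B(2)]
    by (intro nn_integral_cong) (auto simp: indicator_def total_inv_def)
  finally show ?thesis .
qed

lemma area_independent_of_chart:
  assumes f: "smooth_immersion A f" and c: "c \<in> A" and d: "d \<in> A"
    and B: "B \<in> sets borel" "B \<subseteq> chart_dom c \<inter> chart_dom d"
  shows "(\<integral>\<^sup>+x\<in>chart_map c ` B. ennreal (area_density (local_rep c f) x) \<partial>lborel)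
    = (\<integral>\<^sup>+x\<in>chart_map d ` B. ennreal (area_density (local_rep d f) x) \<partial>lborel)"
proof -
  let ?U = "overlap c d" and ?\<phi> = "transition c d"
  have img: "?\<phi> ` ?U = overlap d c"
    using transition_image[OF c d, of "chart_dom c \<inter> chart_dom d"] by (simp add: Int_commute)
  have sub: "overlap c d \<subseteq> chart_img c" "overlap d c \<subseteq> chart_img d"
    by (auto simp: overlap_eq c d)
  have "(\<integral>\<^sup>+x\<in>chart_map c ` B. ennreal (area_density (local_rep c f) x) \<partial>lborel)
    = (\<integral>\<^sup>+x\<in>?\<phi> ` chart_map c ` B. ennreal (area_density (local_rep d f) x) \<partial>lborel)"
  proof (rule nn_integral_change_of_variables[OF open_overlap[OF c d] _ inj_transition[OF c d]
        smooth_on_has_derivative[OF smooth_transition[OF c d]]])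
    show "open (?\<phi> ` ?U)" unfolding img by (rule open_overlap[OF d c])
    show "continuous_on (?\<phi> ` ?U) (area_density (local_rep d f))"
      unfolding img by (rule continuous_on_subset[OF continuous_area_density[OF f d] sub(2)])
    show "continuous_on ?U (area_density (local_rep c f))"
      by (rule continuous_on_subset[OF continuous_area_density[OF f c] sub(1)])
    show "area_density (local_rep c f) x = \<bar>det (matrix (differential ?\<phi> x))\<bar> * area_density (local_rep d f) (?\<phi> x)"
      if "x \<in> ?U" for x
      using coord_normal_transition[OF c d that immersion_differentiable[OF f d transition_in_img[OF c d that]]]
      by (simp add: area_density_def)
    show "chart_map c ` B \<in> sets borel" "?\<phi> ` chart_map c ` B \<in> sets borel"
      unfolding transition_image[OF c d B(2)] using borel_map_image B c d by auto
    show "chart_map c ` B \<subseteq> ?U" using B(2) by (rule image_mono)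
  qed (simp_all add: area_density_def)
  then show ?thesis unfolding transition_image[OF c d B(2)] .
qed

text \<open>Second countability gives countably many charts that cover the surface; cutting their domains down to
disjoint Borel pieces allows a measure to be glued from, and determined by, single charts.\<close>

lemma borel_partition:
  obtains C :: "nat \<Rightarrow> 's chart" and D where "\<And>n. C n \<in> A" "\<And>n. D n \<subseteq> chart_dom (C n)"
    "disjoint_family D" "(\<Union>n. D n) = UNIV" "\<And>n. D n \<in> sets borel"
proof -
  obtain F where F: "F \<subseteq> chart_dom ` A" "countable F" "\<Union>F = \<Union>(chart_dom ` A)"
    using Lindelof[of "chart_dom ` A"] open_dom by blast
  then obtain A0 where A0: "A0 \<subseteq> A" "countable A0" "F = chart_dom ` A0"
    by (meson countable_subset_image)
  have cover: "(\<Union>c\<in>A0. chart_dom c) = UNIV" using F(3) A0(3) atlas_cover by auto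
  then have "A0 \<noteq> {}" by auto
  then have range: "range (from_nat_into A0) = A0" using A0(2) by (rule range_from_nat_into)
  define C where "C = from_nat_into A0"
  define D where "D = disjointed (\<lambda>n. chart_dom (C n))"
  have C: "C n \<in> A" for n using range A0(1) by (auto simp: C_def)
  moreover have "D n \<subseteq> chart_dom (C n)" for n unfolding D_def by (rule disjointed_subset)
  moreover have "disjoint_family D" unfolding D_def by (rule disjoint_family_disjointed)
  moreover have "(\<Union>n. D n) = UNIV"
    unfolding D_def UN_disjointed_eq using cover range by (metis C_def image_image)
  moreover have "D n \<in> sets borel" for n
    unfolding D_def by (rule sets.range_disjointed_sets[THEN subsetD, OF _ rangeI])
      (use open_dom[OF C] in auto)
  ultimately show ?thesis using that by blast
qed

text \<open>The condition in the definite description that defines \<^const>\<open>area_measure\<close>.\<close>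

definition is_area_measure :: "('s \<Rightarrow> real^3) \<Rightarrow> 's measure \<Rightarrow> bool" where
  "is_area_measure f \<mu> \<longleftrightarrow> sets \<mu> = sets borel \<and>
        (\<forall>c\<in>A. \<forall>B\<in>sets borel. B \<subseteq> chart_dom c \<longrightarrow>
           emeasure \<mu> B =
             (\<integral>\<^sup>+x\<in>chart_map c ` B. ennreal (area_density (local_rep c f) x) \<partial>lborel))"

text \<open>On each piece of the partition use the measure of the chart to which the piece belongs.  Any other chart
gives the same values on that piece, since the area is independent of the chart.\<close>

lemma is_area_measure_exists:
  assumes f: "smooth_immersion A f"
  shows "\<exists>\<mu>. is_area_measure f \<mu>"
proof -
  obtain C D where C: "\<And>n :: nat. C n \<in> A" and D_sub: "\<And>n. D n \<subseteq> chart_dom (C n)"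
    and D_disj: "disjoint_family D" and D_cover: "(\<Union>n. D n) = UNIV" and D_borel: "\<And>n. D n \<in> sets borel"
    using borel_partition by blast
  let ?\<nu> = "\<lambda>n. chart_measure f (C n)"
  have sets_\<nu>: "sets (?\<nu> n) = sets borel" for n by (simp add: chart_measure_def)
  define m where "m B = (\<Sum>n. emeasure (?\<nu> n) (B \<inter> D n))" for B
  define \<mu> where "\<mu> = measure_of UNIV (sets borel) m"
  have em: "emeasure \<mu> B = m B" if "B \<in> sets borel" for B
  proof (rule emeasure_measure_of[OF \<mu>_def])
    have sets_\<mu>: "sets \<mu> = sets borel"
      unfolding \<mu>_def using sets.sets_measure_of_eq[of borel] by (simp add: sets_measure_of_conv)
    show "positive (sets \<mu>) m" by (simp add: positive_def m_def)
    show "countably_additive (sets \<mu>) m"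
      unfolding sets_\<mu>
    proof (rule countably_additiveI)
      fix B :: "nat \<Rightarrow> 's set"
      assume B: "range B \<subseteq> sets borel" "disjoint_family B"
      have "(\<Sum>i. m (B i)) = (\<Sum>i. \<integral>\<^sup>+n. emeasure (?\<nu> n) (B i \<inter> D n) \<partial>count_space UNIV)"
        by (simp add: m_def nn_integral_count_space_nat)
      also have "\<dots> = (\<integral>\<^sup>+n. (\<Sum>i. emeasure (?\<nu> n) (B i \<inter> D n)) \<partial>count_space UNIV)"
        by (rule nn_integral_suminf[symmetric]) simp
      also have "\<dots> = (\<integral>\<^sup>+n. emeasure (?\<nu> n) ((\<Union>i. B i) \<inter> D n) \<partial>count_space UNIV)"
      proof (intro nn_integral_cong)
        fix n
        have "(\<Sum>i. emeasure (?\<nu> n) (B i \<inter> D n)) = emeasure (?\<nu> n) (\<Union>i. B i \<inter> D n)"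
          using B D_borel by (intro suminf_emeasure) (auto simp: sets_\<nu> disjoint_family_on_def)
        then show "(\<Sum>i. emeasure (?\<nu> n) (B i \<inter> D n)) = emeasure (?\<nu> n) ((\<Union>i. B i) \<inter> D n)"
          by simp
      qed
      also have "\<dots> = m (\<Union>i. B i)" by (simp add: m_def nn_integral_count_space_nat)
      finally show "(\<Sum>i. m (B i)) = m (\<Union>i. B i)" .
    qed
    show "B \<in> sets \<mu>" using that by (simp add: sets_\<mu>)
  qed simp
  have "emeasure \<mu> B = (\<integral>\<^sup>+x\<in>chart_map c ` B. ennreal (area_density (local_rep c f) x) \<partial>lborel)"
    if c: "c \<in> A" and B: "B \<in> sets borel" "B \<subseteq> chart_dom c" for c B
  proof -
    have "emeasure (?\<nu> n) (B \<inter> D n) = emeasure (chart_measure f c) (B \<inter> D n)" for n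
    proof -
      have BD: "B \<inter> D n \<in> sets borel" using B(1) D_borel by auto
      have sub: "B \<inter> D n \<subseteq> chart_dom (C n)" "B \<inter> D n \<subseteq> chart_dom c" "B \<inter> D n \<subseteq> chart_dom (C n) \<inter> chart_dom c"
        using D_sub B(2) by auto
      show ?thesis
        unfolding emeasure_chart_measure[OF f C BD sub(1)] emeasure_chart_measure[OF f c BD sub(2)]
        by (rule area_independent_of_chart[OF f C c BD sub(3)])
    qed
    then have "m B = (\<Sum>n. emeasure (chart_measure f c) (B \<inter> D n))" by (simp add: m_def)
    also have "\<dots> = emeasure (chart_measure f c) (\<Union>n. B \<inter> D n)"
    proof (rule suminf_emeasure)
      show "disjoint_family (\<lambda>n. B \<inter> D n)" using D_disj unfolding disjoint_family_on_def by blast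
    qed (use B D_borel in \<open>auto simp: chart_measure_def\<close>)
    also have "(\<Union>n. B \<inter> D n) = B" using D_cover by auto
    finally show ?thesis using em[OF B(1)] emeasure_chart_measure[OF f c B] by simp
  qed
  moreover have "sets \<mu> = sets borel"
    unfolding \<mu>_def using sets.sets_measure_of_eq[of borel] by (simp add: sets_measure_of_conv)
  ultimately show ?thesis by (auto simp: is_area_measure_def)
qed

lemma is_area_measure_unique:
  assumes "is_area_measure f \<mu>" "is_area_measure f \<nu>"
  shows "\<mu> = \<nu>"
proof (rule measure_eqI)
  show "sets \<mu> = sets \<nu>" using assms by (simp add: is_area_measure_def)
  obtain C D where C: "\<And>n :: nat. C n \<in> A" and D_sub: "\<And>n. D n \<subseteq> chart_dom (C n)"
    and D_disj: "disjoint_family D" and D_cover: "(\<Union>n. D n) = UNIV" and D_borel: "\<And>n. D n \<in> sets borel"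
    using borel_partition by blast
  fix B assume "B \<in> sets \<mu>"
  then have B: "B \<in> sets borel" using assms by (simp add: is_area_measure_def)
  have split: "emeasure \<mu>' B = (\<Sum>n. \<integral>\<^sup>+x\<in>chart_map (C n) ` (B \<inter> D n). ennreal (area_density (local_rep (C n) f) x) \<partial>lborel)"
    if "is_area_measure f \<mu>'" for \<mu>'
  proof -
    have "emeasure \<mu>' B = emeasure \<mu>' (\<Union>n. B \<inter> D n)" using D_cover by (simp flip: Int_UN_distrib)
    also have "\<dots> = (\<Sum>n. emeasure \<mu>' (B \<inter> D n))"
    proof (rule suminf_emeasure[symmetric])
      show "disjoint_family (\<lambda>n. B \<inter> D n)" using D_disj unfolding disjoint_family_on_def by blast
    qed (use that B D_borel in \<open>auto simp: is_area_measure_def\<close>)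
    also have "\<dots> = (\<Sum>n. \<integral>\<^sup>+x\<in>chart_map (C n) ` (B \<inter> D n). ennreal (area_density (local_rep (C n) f) x) \<partial>lborel)"
    proof (rule suminf_cong)
      fix n
      have "B \<inter> D n \<in> sets borel" "B \<inter> D n \<subseteq> chart_dom (C n)" using B D_borel D_sub by auto
      then show "emeasure \<mu>' (B \<inter> D n)
          = (\<integral>\<^sup>+x\<in>chart_map (C n) ` (B \<inter> D n). ennreal (area_density (local_rep (C n) f) x) \<partial>lborel)"
        using that C by (simp add: is_area_measure_def)
    qed
    finally show ?thesis .
  qed
  show "emeasure \<mu> B = emeasure \<nu> B" using split assms by simp
qed

lemma is_area_measure_area_measure:
  assumes "smooth_immersion A f"
  shows "is_area_measure f (area_measure A f)"
  unfolding area_measure_def is_area_measure_def[symmetric]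
  using is_area_measure_exists[OF assms] is_area_measure_unique by (metis theI)

text \<open>Restricted to the compact set, the area measure and the measure of the single chart agree; the integral
against the latter is an integral over the parameter plane.\<close>

lemma integral_area_measure:
  fixes h :: "'s \<Rightarrow> real"
  assumes f: "smooth_immersion A f" and c: "c \<in> A" and K: "compact K" "K \<subseteq> chart_img c"
    and h: "continuous_on (chart_inv c ` K) h"
  shows "(LINT p:chart_inv c ` K|area_measure A f. h p)
    = integral K (\<lambda>x. h (chart_inv c x) * area_density (local_rep c f) x)"
proof -
  let ?\<mu> = "area_measure A f" and ?K = "chart_inv c ` K" and ?a = "area_density (local_rep c f)"
  have \<mu>: "sets ?\<mu> = sets borel"
    "\<And>B. B \<in> sets borel \<Longrightarrow> B \<subseteq> chart_dom c \<Longrightarrow>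
       emeasure ?\<mu> B = (\<integral>\<^sup>+x\<in>chart_map c ` B. ennreal (?a x) \<partial>lborel)"
    using is_area_measure_area_measure[OF f] c by (auto simp: is_area_measure_def)
  have K_dom: "?K \<subseteq> chart_dom c" using K(2) chart_inv_dom[OF c] by auto
  have K_borel: "?K \<in> sets borel" by (rule borel_compact[OF compact_inv_image[OF c K]])
  define g where "g p = indicator ?K p * h p" for p
  have g: "g \<in> borel_measurable borel"
    unfolding g_def[abs_def] using borel_measurable_continuous_on_indicator[OF K_borel h] by simp
  have meas_eq: "borel_measurable ?\<mu> = (borel_measurable borel :: ('s \<Rightarrow> real) set)"
    by (rule measurable_cong_sets[OF \<mu>(1) refl])
  have dens_eq: "density ?\<mu> (\<lambda>p. ennreal (indicator ?K p)) = density (chart_measure f c) (\<lambda>p. ennreal (indicator ?K p))"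
  proof (rule measure_eqI)
    show "sets (density ?\<mu> (\<lambda>p. ennreal (indicator ?K p))) = sets (density (chart_measure f c) (\<lambda>p. ennreal (indicator ?K p)))"
      using \<mu>(1) by (simp add: chart_measure_def)
    fix B assume "B \<in> sets (density ?\<mu> (\<lambda>p. ennreal (indicator ?K p)))"
    then have B: "B \<in> sets borel" using \<mu>(1) by simp
    have BK: "?K \<inter> B \<in> sets borel" "?K \<inter> B \<subseteq> chart_dom c" using B K_borel K_dom by auto
    have dens: "emeasure (density M (\<lambda>p. ennreal (indicator ?K p))) B = emeasure M (?K \<inter> B)"
      if "sets M = sets borel" for M
    proof -
      have "emeasure (density M (\<lambda>p. ennreal (indicator ?K p))) B = (\<integral>\<^sup>+p. ennreal (indicator ?K p) * indicator B p \<partial>M)"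
        using that B K_borel by (intro emeasure_density) auto
      also have "\<dots> = (\<integral>\<^sup>+p. indicator (?K \<inter> B) p \<partial>M)"
        by (intro nn_integral_cong) (auto simp: indicator_def)
      finally show ?thesis using that BK by simp
    qed
    show "emeasure (density ?\<mu> (\<lambda>p. ennreal (indicator ?K p))) B
       = emeasure (density (chart_measure f c) (\<lambda>p. ennreal (indicator ?K p))) B"
      using \<mu> BK emeasure_chart_measure[OF f c BK] by (simp add: dens chart_measure_def)
  qed
  have drop: "integral\<^sup>L (density M (\<lambda>p. ennreal (indicator ?K p))) g = integral\<^sup>L M g"
    if "sets M = sets borel" for M
  proof -
    have "integral\<^sup>L (density M (\<lambda>p. ennreal (indicator ?K p))) g = integral\<^sup>L M (\<lambda>p. indicator ?K p *\<^sub>R g p)"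
      using that g K_borel measurable_cong_sets[OF that refl, of "borel :: real measure"]
      by (intro integral_density) auto
    also have "(\<lambda>p. indicator ?K p *\<^sub>R g p) = g" by (auto simp: g_def indicator_def fun_eq_iff)
    finally show ?thesis .
  qed
  have "sets (chart_measure f c) = sets borel" by (simp add: chart_measure_def)
  from drop[OF \<mu>(1)] drop[OF this] have "integral\<^sup>L ?\<mu> g = integral\<^sup>L (chart_measure f c) g"
    by (simp only: dens_eq)
  moreover have "integral\<^sup>L (chart_measure f c) g
      = (LINT x|density lborel (\<lambda>x. ennreal (indicator (chart_img c) x * ?a x)). g (total_inv c x))"
    unfolding chart_measure_def using measurable_total_inv[OF c] g by (intro integral_distr) simp_all
  moreover have "(LINT x|density lborel (\<lambda>x. ennreal (indicator (chart_img c) x * ?a x)). g (total_inv c x))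
      = (LINT x|lborel. (indicator (chart_img c) x * ?a x) *\<^sub>R g (total_inv c x))"
  proof (rule integral_density)
    show "(\<lambda>x. g (total_inv c x)) \<in> borel_measurable lborel"
      using measurable_compose[OF measurable_total_inv[OF c] g] by simp
    show "(\<lambda>x. indicator (chart_img c) x * ?a x) \<in> borel_measurable lborel"
      using measurable_indicator_area_density[OF f c] by simp
    show "AE x in lborel. 0 \<le> indicator (chart_img c) x * ?a x"
      by (intro AE_I2 mult_nonneg_nonneg) (simp_all add: area_density_def)
  qed
  moreover have "(\<lambda>x. (indicator (chart_img c) x * ?a x) *\<^sub>R g (total_inv c x))
      = (\<lambda>x. indicator K x *\<^sub>R (h (chart_inv c x) * ?a x))"
  proof
    fix x
    show "(indicator (chart_img c) x * ?a x) *\<^sub>R g (total_inv c x) = indicator K x *\<^sub>R (h (chart_inv c x) * ?a x)"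
    proof (cases "x \<in> chart_img c")
      case True
      have "indicator ?K (chart_inv c x) = (indicator K x :: real)"
        using inv_image_mem_iff[OF c K(2) True] by (simp add: indicator_def)
      then show ?thesis using True by (simp add: g_def total_inv_def)
    next
      case False
      then have "x \<notin> K" using K(2) by blast
      then show ?thesis using False by simp
    qed
  qed
  moreover have "set_lebesgue_integral lborel K (\<lambda>x. h (chart_inv c x) * ?a x)
      = integral K (\<lambda>x. h (chart_inv c x) * ?a x)"
  proof (rule set_borel_integral_eq_integral(2))
    have "continuous_on K (\<lambda>x. h (chart_inv c x))"
      using continuous_on_compose2[OF h continuous_on_subset[OF cont_inv[OF c] K(2)]] by blast
    moreover have "continuous_on K ?a" by (rule continuous_on_subset[OF continuous_area_density[OF f c] K(2)])
    ultimately show "set_integrable lborel K (\<lambda>x. h (chart_inv c x) * ?a x)"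
      unfolding set_integrable_def by (intro borel_integrable_compact[OF K(1)] continuous_on_mult)
  qed
  moreover have "(LINT p:?K|?\<mu>. h p) = integral\<^sup>L ?\<mu> g" by (simp add: set_lebesgue_integral_def g_def[abs_def])
  ultimately show ?thesis by (simp only: set_lebesgue_integral_def)
qed

end

section \<open>Integration by parts against bump functions\<close>

text \<open>By translation invariance the integral of \<open>x \<mapsto> f (x + t v)\<close> does not depend on \<open>t\<close>; differentiate it at \<open>t = 0\<close>
under the integral sign.\<close>

lemma integral_directional_derivative_compact_support:
  fixes f :: "'a::euclidean_space \<Rightarrow> real"
  assumes f: "Ck_on (Suc 0) UNIV f" and supp: "\<And>x. x \<notin> cbox a b \<Longrightarrow> f x = 0"
  shows "integral (cbox a b) (\<lambda>x. differential f x v) = 0"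
proof -
  let ?Df = "\<lambda>x. differential f x v"
  have cont: "continuous_on UNIV f" "continuous_on UNIV ?Df"
    using Ck_on_imp_continuous_on[OF f] f by auto
  obtain R where R: "\<And>x. x \<in> cbox a b \<Longrightarrow> norm x \<le> R"
    using bounded_cbox[of a b] unfolding bounded_iff by blast
  \<comment> \<open>A box that contains the supports of all translates with \<open>|t| \<le> 1\<close>.\<close>
  obtain e where e: "cball 0 (R + norm v) \<subseteq> cbox (- e) (e :: 'a)"
    using bounded_subset_cbox_symmetric[OF bounded_cball] by metis
  have shifted: "((\<lambda>x. f (x + t *\<^sub>R v)) has_integral integral (cbox a b) f) (cbox (- e) e)"
    if t: "t \<in> {-1..1}" for t :: real
  proof (rule has_integral_on_superset)
    show "((\<lambda>x. f (x + t *\<^sub>R v)) has_integral integral (cbox a b) f) (cbox (a - t *\<^sub>R v) (b - t *\<^sub>R v))"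
      by (intro has_integral_shift_cbox integrable_integral integrable_continuous
          continuous_on_subset[OF cont(1)]) simp
    have shift_mem: "x \<in> cbox (a - t *\<^sub>R v) (b - t *\<^sub>R v) \<longleftrightarrow> x + t *\<^sub>R v \<in> cbox a b" for x
      by (auto simp: mem_box inner_diff_left inner_add_left algebra_simps)
    then show "f (x + t *\<^sub>R v) = 0" if "x \<notin> cbox (a - t *\<^sub>R v) (b - t *\<^sub>R v)" for x
      using supp that by blast
    show "cbox (a - t *\<^sub>R v) (b - t *\<^sub>R v) \<subseteq> cbox (- e) e"
    proof
      fix x assume "x \<in> cbox (a - t *\<^sub>R v) (b - t *\<^sub>R v)"
      then have "norm (x + t *\<^sub>R v) \<le> R" using R shift_mem by blast
      moreover have "norm x \<le> norm (x + t *\<^sub>R v) + norm (t *\<^sub>R v)"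
        using norm_triangle_ineq4[of "x + t *\<^sub>R v" "t *\<^sub>R v"] by simp
      moreover have "norm (t *\<^sub>R v) \<le> norm v"
        using t mult_right_mono[of "\<bar>t\<bar>" 1 "norm v"] by (simp add: abs_le_iff)
      ultimately have "x \<in> cball 0 (R + norm v)" by simp
      then show "x \<in> cbox (- e) e" using e by blast
    qed
  qed
  let ?J = "\<lambda>t. integral (cbox (- e) e) (\<lambda>x. f (x + t *\<^sub>R v))"
  have "(?J has_real_derivative integral (cbox (- e) e) (\<lambda>x. ?Df (x + 0 *\<^sub>R v))) (at 0 within {-1..1})"
  proof (rule leibniz_rule_field_derivative)
    fix t :: real and x assume "t \<in> {-1..1}"
    have "f differentiable (at (x + t *\<^sub>R v))" using f by simp
    then have D: "(f has_derivative differential f (x + t *\<^sub>R v)) (at (x + t *\<^sub>R v))"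
      by (simp add: frechet_derivative_works)
    have "((\<lambda>t. x + t *\<^sub>R v) has_derivative (\<lambda>s. s *\<^sub>R v)) (at t)"
      by (auto intro!: derivative_eq_intros)
    from has_derivative_compose[OF this D]
    have "((\<lambda>t. f (x + t *\<^sub>R v)) has_derivative (\<lambda>s. ?Df (x + t *\<^sub>R v) * s)) (at t)"
      using linear_cmul[OF has_derivative_linear[OF D]] by (simp add: mult.commute)
    then show "((\<lambda>t. f (x + t *\<^sub>R v)) has_real_derivative ?Df (x + t *\<^sub>R v)) (at t within {-1..1})"
      by (simp add: has_field_derivative_def has_derivative_at_withinI)
    show "(\<lambda>x. f (x + t *\<^sub>R v)) integrable_on cbox (- e) e"
      using shifted \<open>t \<in> {-1..1}\<close> by (meson has_integral_integrable)
  next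
    have "continuous_on UNIV (\<lambda>p. ?Df (snd p + fst p *\<^sub>R v))"
      by (rule continuous_on_compose2[OF cont(2)]) (auto intro!: continuous_intros)
    then show "continuous_on ({-1..1} \<times> cbox (- e) e) (\<lambda>(t, x). ?Df (x + t *\<^sub>R v))"
      unfolding split_beta by (rule continuous_on_subset) simp
  qed auto
  then have 1: "(?J has_real_derivative integral (cbox (- e) e) ?Df) (at 0)"
    by (subst (asm) at_within_interior) (auto simp: interior_atLeastAtMost_real)
  have "((\<lambda>_. integral (cbox a b) f) has_real_derivative integral (cbox (- e) e) ?Df) (at 0)"
    by (rule has_field_derivative_transform_within_open[OF 1, of "{-1<..<1}"])
       (use shifted in \<open>auto intro!: integral_unique\<close>)
  then have 0: "integral (cbox (- e) e) ?Df = 0"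
    using DERIV_const DERIV_unique by blast
  have out: "?Df x = 0" if "x \<notin> cbox a b" for x
  proof (rule frechet_derivative_apply)
    show "(f has_derivative (\<lambda>v. 0)) (at x)"
      by (rule has_derivative_transform_within_open[OF has_derivative_const, of "- cbox a b"])
         (use that supp in \<open>auto simp: open_Compl closed_cbox\<close>)
  qed
  have "(?Df has_integral integral (cbox a b) ?Df) (cbox a b)"
    by (intro integrable_integral integrable_continuous continuous_on_subset[OF cont(2)]) simp
  then have "(?Df has_integral integral (cbox a b) ?Df) (cbox (- e) e)"
  proof (rule has_integral_on_superset[OF _ out])
    show "cbox a b \<subseteq> cbox (- e) e"
    proof
      fix x assume "x \<in> cbox a b"
      then have "x \<in> cball 0 (R + norm v)" using R[of x] by (simp add: add_increasing2)
      then show "x \<in> cbox (- e) e" using e by blast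
    qed
  qed
  then show ?thesis using 0 by (simp add: integral_unique)
qed

text \<open>The product of bump and \<open>g\<close>, extended by zero, is \<open>C\<^sup>1\<close> on the whole space, so the integral of its derivative
vanishes.\<close>

lemma integral_by_parts_bump:
  fixes g :: "'a::euclidean_space \<Rightarrow> real"
  assumes V: "open V" and g: "smooth_on V g" and box: "cbox a b \<subseteq> V" and r: "r > 0" "cball x0 r \<subseteq> cbox a b"
  shows "integral (cbox a b) (\<lambda>x. differential (bump x0 r) x v * g x)
    = - integral (cbox a b) (\<lambda>x. bump x0 r x * differential g x v)"
proof -
  let ?\<eta> = "bump x0 r"
  define G where "G x = ?\<eta> x * (if x \<in> V then g x else 0)" for x
  have \<eta>V: "smooth_on V ?\<eta>" by (rule smooth_on_subset[OF smooth_on_bump]) simp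
  have G: "Ck_on (Suc 0) UNIV G"
  proof (rule Ck_on_locally)
    fix x :: 'a
    show "\<exists>U. open U \<and> x \<in> U \<and> Ck_on (Suc 0) U G"
    proof (cases "x \<in> V")
      case True
      have "smooth_on V G"
        by (rule smooth_on_cong[OF V _ smooth_on_mult[OF V \<eta>V g]]) (simp add: G_def)
      then show ?thesis using True V smooth_onD by blast
    next
      case False
      have "Ck_on (Suc 0) (- cball x0 r) G"
        by (rule Ck_on_cong[OF _ _ Ck_on_const[where c = 0]])
           (use r(1) in \<open>auto simp: G_def bump_eq_0 open_Compl\<close>)
      moreover have "x \<in> - cball x0 r" using False box r(2) by blast
      ultimately show ?thesis by (meson closed_cball open_Compl)
    qed
  qed
  have DG: "differential G x v = ?\<eta> x * differential g x v + differential ?\<eta> x v * g x"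
    if "x \<in> V" for x
  proof (rule frechet_derivative_apply)
    show "(G has_derivative (\<lambda>v. ?\<eta> x * differential g x v + differential ?\<eta> x v * g x)) (at x)"
      by (rule has_derivative_transform_within_open[OF _ V that, where f = "\<lambda>x. ?\<eta> x * g x"])
         (auto simp: G_def intro!: has_derivative_mult smooth_on_has_derivative[OF g that] smooth_on_has_derivative[OF \<eta>V that])
  qed
  have "integral (cbox a b) (\<lambda>x. differential G x v) = 0"
  proof (rule integral_directional_derivative_compact_support[OF G])
    fix x assume "x \<notin> cbox a b"
    then have "x \<notin> ball x0 r" using r(2) by (meson ball_subset_cball subsetD)
    then show "G x = 0" using r(1) by (simp add: G_def bump_eq_0)
  qed
  moreover have "integral (cbox a b) (\<lambda>x. differential G x v)
    = integral (cbox a b) (\<lambda>x. ?\<eta> x * differential g x v + differential ?\<eta> x v * g x)"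
    by (rule integral_cong) (use DG box in blast)
  moreover have "\<dots> = integral (cbox a b) (\<lambda>x. ?\<eta> x * differential g x v)
      + integral (cbox a b) (\<lambda>x. differential ?\<eta> x v * g x)"
    by (intro integral_add integrable_continuous continuous_on_mult smooth_on_imp_continuous_on
        smooth_on_frechet_derivative smooth_on_subset[OF _ box] g \<eta>V)
  ultimately show ?thesis by simp
qed

text \<open>If \<open>h x0 \<noteq> 0\<close>, then \<open>h\<close> has a fixed sign near \<open>x0\<close>, and a bump supported there has a nonzero integral
against \<open>h\<close>.\<close>

lemma fundamental_lemma_bump:
  fixes h :: "'a::euclidean_space \<Rightarrow> real"
  assumes V: "open V" and h: "continuous_on V h" and x0: "x0 \<in> V"
    and zero: "\<And>a b r. cbox a b \<subseteq> V \<Longrightarrow> r > 0 \<Longrightarrow> cball x0 r \<subseteq> cbox a b \<Longrightarrow>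
       integral (cbox a b) (\<lambda>x. bump x0 r x * h x) = 0"
  shows "h x0 = 0"
proof (rule ccontr)
  assume ne: "h x0 \<noteq> 0"
  define s where "s = sgn (h x0)"
  have s: "s * h x0 > 0" "s \<noteq> 0" using ne by (auto simp: s_def sgn_if)
  have "open {x \<in> V. s * h x > 0}"
    using continuous_open_preimage[OF continuous_on_mult[OF continuous_on_const h, of s] V, of "{0<..}"]
    by (simp add: vimage_def Int_def)
  moreover have "x0 \<in> {x \<in> V. s * h x > 0}" using x0 s by simp
  ultimately obtain a b where ab: "x0 \<in> box a b" "cbox a b \<subseteq> {x \<in> V. s * h x > 0}"
    using open_contains_cbox[of "{x \<in> V. s * h x > 0}" x0] by metis
  obtain r where r: "r > 0" "cball x0 r \<subseteq> box a b"
    using open_contains_cball[of "box a b"] ab(1) by auto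
  have rc: "cball x0 r \<subseteq> cbox a b" using r(2) box_subset_cbox by blast
  have abV: "cbox a b \<subseteq> V" using ab(2) by blast
  let ?f = "\<lambda>x. s * (bump x0 r x * h x)"
  have "continuous_on (cbox a b) (bump x0 r)"
    by (rule continuous_on_subset[OF smooth_on_imp_continuous_on[OF smooth_on_bump]]) simp
  then have cont: "continuous_on (cbox a b) ?f"
    by (intro continuous_on_mult continuous_on_const continuous_on_subset[OF h abV])
  have "integral (cbox a b) ?f = 0"
    using zero[OF abV r(1) rc] by simp
  then have "(?f has_integral 0) (cbox a b)"
    using integrable_continuous[OF cont] by (metis integrable_integral)
  moreover have "0 \<le> ?f x" if "x \<in> box a b" for x
  proof -
    have "s * h x \<ge> 0" using ab(2) that box_subset_cbox by fastforce
    then have "bump x0 r x * (s * h x) \<ge> 0" using bump_nonneg[of x0 r x] by (rule mult_nonneg_nonneg[rotated])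
    then show ?thesis by (simp add: mult_ac)
  qed
  ultimately have "?f x0 = 0"
    using has_integral_0_cbox_imp_0[OF cont, of x0] ab(1) box_subset_cbox by blast
  moreover have "bump x0 r x0 > 0" using bump_pos_iff[OF r(1), of x0 x0] r(1) by simp
  ultimately show False using ne s(2) by simp
qed


section \<open>Differentiating the energy of a linear variation\<close>

text \<open>Gives the range of \<open>t\<close> in which the varied surface stays immersed and avoids the origin.\<close>

lemma nonzero_perturbation:
  fixes A B :: "'a::topological_space \<Rightarrow> 'b::real_normed_vector"
  assumes "compact K" "continuous_on K A" "continuous_on K B" "\<And>x. x \<in> K \<Longrightarrow> A x \<noteq> 0"
  shows "\<exists>\<epsilon>>0. \<forall>x\<in>K. \<forall>t. \<bar>t\<bar> \<le> \<epsilon> \<longrightarrow> A x + t *\<^sub>R B x \<noteq> 0"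
proof (cases "K = {}")
  case False
  obtain u where u: "u \<in> K" "\<And>x. x \<in> K \<Longrightarrow> norm (A u) \<le> norm (A x)"
    using continuous_attains_inf[OF assms(1) False continuous_on_norm[OF assms(2)]] by blast
  obtain w where w: "\<And>x. x \<in> K \<Longrightarrow> norm (B x) \<le> norm (B w)"
    using continuous_attains_sup[OF assms(1) False continuous_on_norm[OF assms(3)]] by blast
  define \<epsilon> where "\<epsilon> = norm (A u) / (norm (B w) + 1)"
  have n: "norm (B w) + 1 > 0" by (simp add: add_nonneg_pos)
  have "\<epsilon> > 0" using assms(4)[OF u(1)] n by (simp add: \<epsilon>_def)
  moreover have "A x + t *\<^sub>R B x \<noteq> 0" if x: "x \<in> K" and t: "\<bar>t\<bar> \<le> \<epsilon>" for x t
  proof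
    assume "A x + t *\<^sub>R B x = 0"
    then have "norm (A x) = \<bar>t\<bar> * norm (B x)"
      by (metis add_eq_0_iff norm_minus_cancel norm_scaleR)
    also have "\<dots> \<le> \<epsilon> * norm (B w)"
      using t w[OF x] \<open>\<epsilon> > 0\<close> by (intro mult_mono) auto
    also have "\<dots> < \<epsilon> * (norm (B w) + 1)" using \<open>\<epsilon> > 0\<close> by simp
    also have "\<dots> = norm (A u)" using n by (simp add: \<epsilon>_def)
    finally show False using u(2)[OF x] by simp
  qed
  ultimately show ?thesis by blast
qed (auto intro: exI[of _ 1])

text \<open>When a surface is moved by \<open>t \<eta> e\<close> with a constant vector \<open>e\<close>, its position and its coordinate normal are both
affine in \<open>t\<close>; in a chart the energy is then an integral of this form.\<close>

lemma weighted_energy_derivative: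
  fixes A B :: "'a::euclidean_space \<Rightarrow> real^3" and C D :: "'a \<Rightarrow> real^3"
  assumes A: "continuous_on (cbox a b) A" "\<And>x. x \<in> cbox a b \<Longrightarrow> A x \<noteq> 0" and B: "continuous_on (cbox a b) B"
    and C: "continuous_on (cbox a b) C" "\<And>x. x \<in> cbox a b \<Longrightarrow> C x \<noteq> 0" and D: "continuous_on (cbox a b) D"
  shows "((\<lambda>t. integral (cbox a b) (\<lambda>x. norm (A x + t *\<^sub>R B x) powr \<alpha> * norm (C x + t *\<^sub>R D x)))
     has_real_derivative integral (cbox a b) (\<lambda>x. \<alpha> * norm (A x) powr (\<alpha> - 1) * (sgn (A x) \<bullet> B x) * norm (C x)
        + norm (A x) powr \<alpha> * (sgn (C x) \<bullet> D x))) (at 0)"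
proof -
  obtain e1 e2 where "e1 > 0" "e2 > 0" and
    e: "\<forall>x\<in>cbox a b. \<forall>t. \<bar>t\<bar> \<le> e1 \<longrightarrow> A x + t *\<^sub>R B x \<noteq> 0" "\<forall>x\<in>cbox a b. \<forall>t. \<bar>t\<bar> \<le> e2 \<longrightarrow> C x + t *\<^sub>R D x \<noteq> 0"
    using nonzero_perturbation[OF compact_cbox A(1) B A(2)] nonzero_perturbation[OF compact_cbox C(1) D C(2)] by blast
  define \<epsilon> where "\<epsilon> = min e1 e2"
  have \<epsilon>: "\<epsilon> > 0" using \<open>e1 > 0\<close> \<open>e2 > 0\<close> by (simp add: \<epsilon>_def)
  define P where "P t x = A x + t *\<^sub>R B x" for t x
  define R where "R t x = C x + t *\<^sub>R D x" for t x
  have nz: "P t x \<noteq> 0" "R t x \<noteq> 0" if "t \<in> {-\<epsilon>..\<epsilon>}" "x \<in> cbox a b" for t x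
    using e that by (auto simp: \<epsilon>_def P_def R_def abs_le_iff)
  let ?U = "{-\<epsilon>..\<epsilon>} \<times> cbox a b"
  have "continuous_on ?U (\<lambda>p. A (snd p))" "continuous_on ?U (\<lambda>p. B (snd p))"
    "continuous_on ?U (\<lambda>p. C (snd p))" "continuous_on ?U (\<lambda>p. D (snd p))"
    by (auto intro!: continuous_on_compose2[OF A(1)] continuous_on_compose2[OF B]
        continuous_on_compose2[OF C(1)] continuous_on_compose2[OF D] continuous_intros)
  note cont = this
  have contP: "continuous_on ?U (\<lambda>p. P (fst p) (snd p))" and contR: "continuous_on ?U (\<lambda>p. R (fst p) (snd p))"
    unfolding P_def R_def by (intro continuous_intros cont)+
  have "((\<lambda>t. integral (cbox a b) (\<lambda>x. norm (P t x) powr \<alpha> * norm (R t x)))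
     has_real_derivative integral (cbox a b) (\<lambda>x. \<alpha> * norm (P 0 x) powr (\<alpha> - 1) * (sgn (P 0 x) \<bullet> B x) * norm (R 0 x)
        + norm (P 0 x) powr \<alpha> * (sgn (R 0 x) \<bullet> D x))) (at 0 within {-\<epsilon>..\<epsilon>})"
  proof (rule leibniz_rule_field_derivative)
    fix t x assume t: "t \<in> {-\<epsilon>..\<epsilon>}" and x: "x \<in> cbox a b"
    have line: "((\<lambda>t. norm (p + t *\<^sub>R q)) has_real_derivative sgn (p + t *\<^sub>R q) \<bullet> q) (at t)"
      if "p + t *\<^sub>R q \<noteq> 0" for p q :: "real^3"
    proof -
      have "((\<lambda>t. p + t *\<^sub>R q) has_derivative (\<lambda>s. s *\<^sub>R q)) (at t)"
        by (auto intro!: derivative_eq_intros)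
      from has_derivative_compose[OF this has_derivative_norm[OF that]]
      show ?thesis unfolding has_field_derivative_def
        by (rule has_derivative_eq_rhs) (simp add: fun_eq_iff inner_commute mult.commute)
    qed
    have 1: "((\<lambda>t. norm (P t x)) has_real_derivative sgn (P t x) \<bullet> B x) (at t)"
      and 2: "((\<lambda>t. norm (R t x)) has_real_derivative sgn (R t x) \<bullet> D x) (at t)"
      using line nz[OF t x] by (auto simp: P_def R_def)
    have 3: "((\<lambda>t. norm (P t x) powr \<alpha>) has_real_derivative \<alpha> * norm (P t x) powr (\<alpha> - 1) * (sgn (P t x) \<bullet> B x)) (at t)"
      using DERIV_chain2[OF has_real_derivative_powr[of "norm (P t x)" \<alpha>] 1] nz(1)[OF t x] by simp
    show "((\<lambda>t. norm (P t x) powr \<alpha> * norm (R t x)) has_real_derivative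
        \<alpha> * norm (P t x) powr (\<alpha> - 1) * (sgn (P t x) \<bullet> B x) * norm (R t x)
        + norm (P t x) powr \<alpha> * (sgn (R t x) \<bullet> D x)) (at t within {-\<epsilon>..\<epsilon>})"
      using DERIV_mult[OF 3 2] by (simp add: has_field_derivative_at_within algebra_simps)
  next
    fix t assume t: "t \<in> {-\<epsilon>..\<epsilon>}"
    have "continuous_on (cbox a b) (P t)" "continuous_on (cbox a b) (R t)"
      unfolding P_def R_def by (intro continuous_intros A B C D)+
    then show "(\<lambda>x. norm (P t x) powr \<alpha> * norm (R t x)) integrable_on cbox a b"
      using nz[OF t] by (intro integrable_continuous continuous_on_mult continuous_on_powr continuous_on_norm
          continuous_on_const) auto
  next
    show "continuous_on ?U (\<lambda>(t, x). \<alpha> * norm (P t x) powr (\<alpha> - 1) * (sgn (P t x) \<bullet> B x) * norm (R t x)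
        + norm (P t x) powr \<alpha> * (sgn (R t x) \<bullet> D x))"
      unfolding split_beta sgn_div_norm
      using nz by (intro continuous_intros contP contR cont) auto
  qed (use \<epsilon> in auto)
  then show ?thesis
    using \<epsilon> by (subst (asm) at_within_interior) (auto simp: interior_atLeastAtMost_real P_def R_def)
qed

section \<open>The Euler-Lagrange equation\<close>

lemma inj_iff_cross3_nonzero:
  fixes L :: "real^2 \<Rightarrow> real^3"
  assumes "linear L"
  shows "inj L \<longleftrightarrow> cross3 (L (axis 1 1)) (L (axis 2 1)) \<noteq> 0"
proof -
  interpret L: linear L by fact
  note L = linear_vec2[OF assms]
  show ?thesis
  proof
    assume inj: "inj L"
    have ker: "v = 0" if "L v = 0" for v using inj that L.zero by (metis injD)
    show "cross3 (L (axis 1 1)) (L (axis 2 1)) \<noteq> 0"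
    proof
      assume "cross3 (L (axis 1 1)) (L (axis 2 1)) = 0"
      then consider "L (axis 1 1) = 0" | "L (axis 2 1) = 0" | t where "L (axis 2 1) = t *\<^sub>R L (axis 1 1)"
        unfolding cross_eq_0 collinear_lemma by blast
      then show False
      proof cases
        case 3
        then have "L (axis 2 1 - t *\<^sub>R axis 1 1) = 0" by (simp add: L.diff L.scaleR)
        from ker[OF this] show False by (simp add: vec_eq_iff forall_2 axis_def)
      qed (use ker[of "axis 1 1"] ker[of "axis 2 1"] in \<open>auto simp: axis_eq_0_iff\<close>)
    qed
  next
    assume ne: "cross3 (L (axis 1 1)) (L (axis 2 1)) \<noteq> 0"
    have "v = 0" if "L v = 0" for v
    proof -
      have eq: "(v $ 1) *\<^sub>R L (axis 1 1) + (v $ 2) *\<^sub>R L (axis 2 1) = 0" using that L by metis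
      have "(v $ 1) *\<^sub>R cross3 (L (axis 1 1)) (L (axis 2 1)) = 0"
        using arg_cong[OF eq, of "\<lambda>u. cross3 u (L (axis 2 1))"] by (simp add: cross_add_left cross_mult_left)
      moreover have "(v $ 2) *\<^sub>R cross3 (L (axis 1 1)) (L (axis 2 1)) = 0"
        using arg_cong[OF eq, of "\<lambda>u. cross3 (L (axis 1 1)) u"] by (simp add: cross_add_right cross_mult_right)
      ultimately have "v $ 1 = 0" "v $ 2 = 0" using ne by auto
      then show "v = 0" by (simp add: vec_eq_iff forall_2)
    qed
    then show "inj L" using linear_injective_0[OF assms] by blast
  qed
qed

text \<open>Integration by parts turns the weak form into \<open>g0 = \<partial>\<^sub>1 g1 + \<partial>\<^sub>2 g2\<close>, where \<open>g1\<close>, \<open>g2\<close> are the coefficients of the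
derivatives of the bump.  The vector \<open>e\<close> is constant, but it may be chosen after the point \<open>p\<close>: for
\<open>e = N p\<close> the derivatives of \<open>|X|\<^sup>\<alpha>\<close> and the second derivatives of \<open>X\<close> drop out at \<open>p\<close>, since they are
multiplied by triple products that contain \<open>N p\<close> twice.\<close>

lemma Euler_Lagrange_from_weak_form:
  fixes X :: "real^2 \<Rightarrow> real^3" and \<alpha> :: real
  assumes V: "open V" and X: "smooth_on V X" and X0: "\<And>x. x \<in> V \<Longrightarrow> X x \<noteq> 0"
    and C0: "\<And>x. x \<in> V \<Longrightarrow> coord_normal X x \<noteq> 0"
    and weak: "\<And>a b x0 r e. cbox a b \<subseteq> V \<Longrightarrow> r > 0 \<Longrightarrow> cball x0 r \<subseteq> cbox a b \<Longrightarrow>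
      integral (cbox a b) (\<lambda>x. \<alpha> * norm (X x) powr (\<alpha> - 1) * (sgn (X x) \<bullet> (bump x0 r x *\<^sub>R e)) * norm (coord_normal X x)
        + norm (X x) powr \<alpha> * (unit_normal X x \<bullet>
           (cross3 (differential (bump x0 r) x (axis 1 1) *\<^sub>R e) (differential X x (axis 2 1))
          + cross3 (differential X x (axis 1 1)) (differential (bump x0 r) x (axis 2 1) *\<^sub>R e)))) = 0"
    and p: "p \<in> V"
  shows "Euler_Lagrange_at \<alpha> X (unit_normal X) p v w"
proof -
  let ?e1 = "axis 1 1 :: real^2" and ?e2 = "axis 2 1 :: real^2"
  define N where "N = unit_normal X"
  define X1 X2 where "X1 x = differential X x ?e1" and "X2 x = differential X x ?e2" for x
  define e where "e = N p"
  define R where "R x = norm (X x) powr \<alpha>" for x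
  define g0 where "g0 x = \<alpha> * norm (X x) powr (\<alpha> - 1) * (sgn (X x) \<bullet> e) * norm (coord_normal X x)" for x
  define g1 where "g1 x = R x * (N x \<bullet> cross3 e (X2 x))" for x
  define g2 where "g2 x = R x * (N x \<bullet> cross3 (X1 x) e)" for x
  have smooth_C: "smooth_on V (coord_normal X)"
    unfolding coord_normal_def[abs_def] by (intro smooth_on_cross3 smooth_on_frechet_derivative V X)
  have smooth_N: "smooth_on V N"
    unfolding N_def unit_normal_def[abs_def] by (intro smooth_on_sgn V smooth_C C0)
  have smooth_X12: "smooth_on V X1" "smooth_on V X2"
    unfolding X1_def[abs_def] X2_def[abs_def] by (intro smooth_on_frechet_derivative X)+
  have smooth_R: "smooth_on V (\<lambda>x. norm (X x) powr s)" for s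
    by (intro smooth_on_powr smooth_on_norm V X) (simp_all add: X0)
  have smooth_g0: "smooth_on V g0"
    unfolding g0_def[abs_def]
    by (intro smooth_on_mult smooth_on_inner smooth_on_const smooth_R smooth_on_sgn smooth_on_norm smooth_C V X C0 X0)
  have smooth_g1: "smooth_on V g1" and smooth_g2: "smooth_on V g2"
    unfolding g1_def[abs_def] g2_def[abs_def] R_def
    by (intro smooth_on_mult smooth_on_inner smooth_on_cross3 smooth_on_const smooth_R smooth_N smooth_X12 V)+
  let ?h = "\<lambda>x. g0 x - differential g1 x ?e1 - differential g2 x ?e2"
  have "?h p = 0"
  proof (rule fundamental_lemma_bump[OF V _ p])
    show "continuous_on V ?h"
      by (intro smooth_on_imp_continuous_on smooth_on_diff smooth_on_frechet_derivative smooth_g0 smooth_g1 smooth_g2 V)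
    fix a b r assume box: "cbox a b \<subseteq> V" and r: "r > 0" "cball p r \<subseteq> cbox a b"
    let ?\<eta> = "bump p r" and ?I = "\<lambda>f. integral (cbox a b) f"
    have \<eta>: "smooth_on V ?\<eta>" by (rule smooth_on_subset[OF smooth_on_bump]) simp
    have int: "f integrable_on cbox a b" if "smooth_on V f" for f :: "real^2 \<Rightarrow> real"
      by (intro integrable_continuous continuous_on_subset[OF smooth_on_imp_continuous_on[OF that] box])
    have i: "(\<lambda>x. ?\<eta> x * g0 x) integrable_on cbox a b"
      "(\<lambda>x. ?\<eta> x * differential g1 x ?e1) integrable_on cbox a b"
      "(\<lambda>x. ?\<eta> x * differential g2 x ?e2) integrable_on cbox a b"
      "(\<lambda>x. differential ?\<eta> x ?e1 * g1 x) integrable_on cbox a b"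
      "(\<lambda>x. differential ?\<eta> x ?e2 * g2 x) integrable_on cbox a b"
      by (intro int smooth_on_mult smooth_on_frechet_derivative smooth_g0 smooth_g1 smooth_g2 \<eta> V)+
    have "?I (\<lambda>x. ?\<eta> x * ?h x) = ?I (\<lambda>x. ?\<eta> x * g0 x)
        - ?I (\<lambda>x. ?\<eta> x * differential g1 x ?e1) - ?I (\<lambda>x. ?\<eta> x * differential g2 x ?e2)"
      using i by (simp add: right_diff_distrib integral_diff integrable_diff)
    also have "\<dots> = ?I (\<lambda>x. ?\<eta> x * g0 x) + ?I (\<lambda>x. differential ?\<eta> x ?e1 * g1 x)
        + ?I (\<lambda>x. differential ?\<eta> x ?e2 * g2 x)"
      using integral_by_parts_bump[OF V smooth_g1 box r, of ?e1] integral_by_parts_bump[OF V smooth_g2 box r, of ?e2]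
      by simp
    also have "\<dots> = ?I (\<lambda>x. ?\<eta> x * g0 x + differential ?\<eta> x ?e1 * g1 x + differential ?\<eta> x ?e2 * g2 x)"
      using i by (simp add: integral_add integrable_add)
    also have "\<dots> = 0"
    proof -
      have "(\<lambda>x. ?\<eta> x * g0 x + differential ?\<eta> x ?e1 * g1 x + differential ?\<eta> x ?e2 * g2 x)
        = (\<lambda>x. \<alpha> * norm (X x) powr (\<alpha> - 1) * (sgn (X x) \<bullet> (?\<eta> x *\<^sub>R e)) * norm (coord_normal X x)
        + norm (X x) powr \<alpha> * (unit_normal X x \<bullet>
           (cross3 (differential ?\<eta> x ?e1 *\<^sub>R e) (differential X x ?e2)
          + cross3 (differential X x ?e1) (differential ?\<eta> x ?e2 *\<^sub>R e))))"
        by (simp add: fun_eq_iff g0_def g1_def g2_def R_def N_def X1_def X2_def cross_mult_left cross_mult_right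
            inner_add_right distrib_left mult_ac)
      then show ?thesis using weak[OF box r, of e] by simp
    qed
    finally show "?I (\<lambda>x. ?\<eta> x * ?h x) = 0" .
  qed
  define N1 N2 where "N1 = differential N p ?e1" and "N2 = differential N p ?e2"
  have NN: "N p \<bullet> cross3 e u = 0" "N p \<bullet> cross3 u e = 0" for u by (simp_all add: e_def dot_cross_self)
  have dX: "(X has_derivative differential X p) (at p)"
    and dN: "(N has_derivative differential N p) (at p)"
    and dX1: "(X1 has_derivative differential X1 p) (at p)"
    and dX2: "(X2 has_derivative differential X2 p) (at p)"
    and dR: "(R has_derivative differential R p) (at p)"
    using smooth_on_has_derivative[OF _ p] X smooth_N smooth_X12 smooth_R[of \<alpha>] unfolding R_def[abs_def] by blast+
  have D1: "differential g1 p ?e1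
      = R p * (N p \<bullet> cross3 e (differential X2 p ?e1) + N1 \<bullet> cross3 e (X2 p))
        + differential R p ?e1 * (N p \<bullet> cross3 e (X2 p))"
    unfolding g1_def[abs_def] N1_def
    by (rule frechet_derivative_apply has_derivative_mult dR has_derivative_inner dN
        bounded_linear.has_derivative[OF bounded_bilinear.bounded_linear_right[OF bounded_bilinear_cross3]] dX2)+
  have D2: "differential g2 p ?e2
      = R p * (N p \<bullet> cross3 (differential X1 p ?e2) e + N2 \<bullet> cross3 (X1 p) e)
        + differential R p ?e2 * (N p \<bullet> cross3 (X1 p) e)"
    unfolding g2_def[abs_def] N2_def
    by (rule frechet_derivative_apply has_derivative_mult dR has_derivative_inner dN
        bounded_linear.has_derivative[OF bounded_bilinear.bounded_linear_left[OF bounded_bilinear_cross3]] dX1)+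
  have "g0 p = R p * (N1 \<bullet> cross3 e (X2 p) + N2 \<bullet> cross3 (X1 p) e)"
    using \<open>?h p = 0\<close> unfolding D1 D2 NN by (simp add: distrib_left)
  moreover have pos: "norm (X p) > 0" using X0[OF p] by simp
  have "R p = norm (X p) powr (\<alpha> - 1) * norm (X p)"
    using powr_add[of "norm (X p)" "\<alpha> - 1" 1] pos by (simp add: R_def)
  ultimately have "norm (X p) powr (\<alpha> - 1) * (\<alpha> * (sgn (X p) \<bullet> e) * norm (coord_normal X p))
      = norm (X p) powr (\<alpha> - 1) * (norm (X p) * (N1 \<bullet> cross3 e (X2 p) + N2 \<bullet> cross3 (X1 p) e))"
    by (simp add: g0_def mult_ac)
  then have 1: "\<alpha> * (sgn (X p) \<bullet> e) * norm (coord_normal X p)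
      = norm (X p) * (N1 \<bullet> cross3 e (X2 p) + N2 \<bullet> cross3 (X1 p) e)"
    using pos by simp
  have sX: "norm (X p) * (sgn (X p) \<bullet> e) = N p \<bullet> X p"
    using pos by (simp add: sgn_div_norm e_def inner_commute)
  have XX: "norm (X p) * norm (X p) = X p \<bullet> X p" by (simp add: dot_square_norm power2_eq_square)
  have W: "norm (coord_normal X p) = N p \<bullet> cross3 (X1 p) (X2 p)"
    using C0[OF p] by (simp add: N_def unit_normal_def sgn_div_norm coord_normal_def X1_def X2_def
        dot_square_norm power2_eq_square)
  have "\<alpha> * (N p \<bullet> X p) * (N p \<bullet> cross3 (X1 p) (X2 p))
      = norm (X p) * (\<alpha> * (sgn (X p) \<bullet> e) * norm (coord_normal X p))"
    unfolding sX[symmetric] W by (simp add: mult_ac)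
  also have "\<dots> = (N1 \<bullet> cross3 e (X2 p) + N2 \<bullet> cross3 (X1 p) e) * (X p \<bullet> X p)"
    unfolding 1 XX[symmetric] by (simp add: mult_ac)
  also have "N1 \<bullet> cross3 e (X2 p) = N p \<bullet> cross3 (X2 p) N1"
    unfolding e_def by (metis cross_triple inner_commute)
  also have "N2 \<bullet> cross3 (X1 p) e = N p \<bullet> cross3 N2 (X1 p)"
    unfolding e_def by (metis cross_triple inner_commute)
  finally have basis: "(N p \<bullet> cross3 (X2 p) N1 + N p \<bullet> cross3 N2 (X1 p)) * (X p \<bullet> X p)
     = \<alpha> * (N p \<bullet> X p) * (N p \<bullet> cross3 (X1 p) (X2 p))" by simp
  have Xv: "differential X p v = (v $ 1) *\<^sub>R X1 p + (v $ 2) *\<^sub>R X2 p"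
    and Nv: "differential N p v = (v $ 1) *\<^sub>R N1 + (v $ 2) *\<^sub>R N2" for v
    unfolding X1_def X2_def N1_def N2_def
    by (rule linear_vec2[OF has_derivative_linear[OF dX]] linear_vec2[OF has_derivative_linear[OF dN]])+
  \<comment> \<open>Both sides are alternating bilinear in \<open>v\<close>, \<open>w\<close>, so the standard basis suffices.\<close>
  define J where "J = v $ 1 * w $ 2 - v $ 2 * w $ 1"
  have lhs: "N p \<bullet> (cross3 (differential X p w) (differential N p v)
           + cross3 (differential N p w) (differential X p v))
      = J * (N p \<bullet> cross3 (X2 p) N1 + N p \<bullet> cross3 N2 (X1 p))"
    unfolding Xv Nv J_def
    by (simp add: cross_add_left cross_add_right cross_mult_left cross_mult_right inner_add_right
        cross_skew[of N1] cross_skew[of N2] algebra_simps)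
  have rhs: "N p \<bullet> cross3 (differential X p v) (differential X p w)
      = J * (N p \<bullet> cross3 (X1 p) (X2 p))"
    unfolding Xv J_def
    by (simp add: cross_add_left cross_add_right cross_mult_left cross_mult_right inner_add_right
        cross_skew[of "X2 p" "X1 p"] algebra_simps)
  have "(J * (N p \<bullet> cross3 (X2 p) N1 + N p \<bullet> cross3 N2 (X1 p))) * (X p \<bullet> X p)
      = \<alpha> * (N p \<bullet> X p) * (J * (N p \<bullet> cross3 (X1 p) (X2 p)))"
    using arg_cong[OF basis, of "\<lambda>u. J * u"] by (simp only: mult_ac)
  then show ?thesis unfolding lhs[symmetric] rhs[symmetric] unfolding N_def .
qed

section \<open>Bump variations of a stationary surface\<close>

lemma smooth_on_slice:
  fixes G :: "real \<times> 'a::euclidean_space \<Rightarrow> 'b::euclidean_space"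
  assumes "smooth_on (I \<times> U) G" "open U" "t \<in> I"
  shows "smooth_on U (\<lambda>x. G (t, x))"
proof (rule smooth_on_compose[OF assms(1) _ assms(2)])
  have "bounded_linear (\<lambda>x :: 'a. (0 :: real, x))"
    by (intro bounded_linear_Pair bounded_linear_zero bounded_linear_ident)
  then have "smooth_on U (\<lambda>x. (t, 0) + (0 :: real, x))"
    by (intro smooth_on_add smooth_on_const smooth_on_linear assms(2))
  then show "smooth_on U (\<lambda>x. (t, x))" by simp
qed (use assms in auto)

lemma unit_normal_tangent:
  assumes "(X has_derivative differential X x) (at x)"
  shows "unit_normal X x \<bullet> differential X x v = 0"
proof -
  have lin: "linear (differential X x)" by (rule has_derivative_linear[OF assms])
  show ?thesis
    by (subst linear_vec2[OF lin])
       (simp add: unit_normal_def coord_normal_def sgn_div_norm inner_add_right dot_cross_self)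
qed

context surface_atlas
begin

text \<open>The direction \<open>e\<close> is a fixed vector and not the normal field, which keeps derivatives of the normal
out of the varied surface.\<close>

definition bump_variation ::
  "('s \<Rightarrow> real^3) \<Rightarrow> 's chart \<Rightarrow> real^2 \<Rightarrow> real \<Rightarrow> real^3 \<Rightarrow> real \<Rightarrow> 's \<Rightarrow> real^3" where
  "bump_variation \<Phi> c x0 r e t p
     = (if p \<in> chart_dom c then \<Phi> p + (t * bump x0 r (chart_map c p)) *\<^sub>R e else \<Phi> p)"

text \<open>The coefficient of \<open>t\<close> in the coordinate normal of \<open>X + t \<eta> e\<close>; there is no quadratic term because
\<open>e \<times> e = 0\<close>.\<close>

definition coord_normal_variation :: "(real^2 \<Rightarrow> real^3) \<Rightarrow> (real^2 \<Rightarrow> real) \<Rightarrow> real^3 \<Rightarrow> real^2 \<Rightarrow> real^3" where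
  "coord_normal_variation X \<eta> e x =
     cross3 (differential \<eta> x (axis 1 1) *\<^sub>R e) (differential X x (axis 2 1))
   + cross3 (differential X x (axis 1 1)) (differential \<eta> x (axis 2 1) *\<^sub>R e)"

lemma bump_variation_local:
  assumes "c \<in> A" "x \<in> chart_img c"
  shows "local_rep c (bump_variation \<Phi> c x0 r e t) x = local_rep c \<Phi> x + (t * bump x0 r x) *\<^sub>R e"
  using chart_inv_dom[OF assms] chart_map_inv[OF assms] by (simp add: local_rep_def bump_variation_def)

lemma bump_variation_outside:
  assumes "c \<in> A" "r > 0" "cball x0 r \<subseteq> K" "p \<notin> chart_inv c ` K"
  shows "bump_variation \<Phi> c x0 r e t p = \<Phi> p"
proof (cases "p \<in> chart_dom c")
  case True
  have "chart_map c p \<notin> ball x0 r"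
  proof
    assume "chart_map c p \<in> ball x0 r"
    then have "chart_map c p \<in> K" using assms(3) by auto
    then have "chart_inv c (chart_map c p) \<in> chart_inv c ` K" by (rule imageI)
    then show False using assms(4) chart_inv_map[OF assms(1) True] by simp
  qed
  then show ?thesis using assms(2) by (simp add: bump_variation_def bump_eq_0)
qed (simp add: bump_variation_def)

lemma coord_normal_bump_variation:
  assumes \<Phi>: "smooth_immersion A \<Phi>" and c: "c \<in> A" and x: "x \<in> chart_img c"
  shows "local_rep c (bump_variation \<Phi> c x0 r e t) differentiable (at x)" (is ?diff)
    and "coord_normal (local_rep c (bump_variation \<Phi> c x0 r e t)) x
      = coord_normal (local_rep c \<Phi>) x + t *\<^sub>R coord_normal_variation (local_rep c \<Phi>) (bump x0 r) e x" (is ?eq)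
proof -
  let ?X = "local_rep c \<Phi>" and ?\<eta> = "bump x0 r" and ?F = "local_rep c (bump_variation \<Phi> c x0 r e t)"
  have X: "(?X has_derivative differential ?X x) (at x)"
    using smooth_on_has_derivative[OF immersion_smooth[OF \<Phi> c] x] .
  have \<eta>: "(?\<eta> has_derivative differential ?\<eta> x) (at x)"
    using smooth_on_has_derivative[OF smooth_on_bump UNIV_I] .
  have "((\<lambda>x. ?X x + (t * ?\<eta> x) *\<^sub>R e) has_derivative
     (\<lambda>v. differential ?X x v + (t * differential ?\<eta> x v) *\<^sub>R e)) (at x)"
    by (intro has_derivative_add X has_derivative_scaleR_left has_derivative_mult_right \<eta>)
  then have D: "(?F has_derivative
     (\<lambda>v. differential ?X x v + (t * differential ?\<eta> x v) *\<^sub>R e)) (at x)"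
    by (rule has_derivative_transform_within_open[OF _ open_img[OF c] x])
       (simp add: bump_variation_local[OF c])
  then show ?diff by (auto simp: differentiable_def)
  show ?eq
    unfolding coord_normal_def coord_normal_variation_def frechet_derivative_apply[OF D]
    by (simp add: cross_add_left cross_add_right cross_mult_left cross_mult_right scaleR_add_right)
qed

text \<open>In a chart \<open>d\<close>, points over the domain of \<open>c\<close> are handled by the smooth transition map, and the other points have a
neighbourhood that misses the compact support, on which the surface is not moved.\<close>

lemma smooth_bump_variation:
  assumes \<Phi>: "smooth_immersion A \<Phi>" and c: "c \<in> A" and d: "d \<in> A"
    and K: "compact K" "K \<subseteq> chart_img c" and r: "r > 0" "cball x0 r \<subseteq> K" and I: "open I"
  shows "smooth_on (I \<times> chart_img d) (\<lambda>(t, x). bump_variation \<Phi> c x0 r e t (chart_inv d x))"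
proof (rule smooth_on_locally)
  fix q assume q: "q \<in> I \<times> chart_img d"
  let ?K = "chart_inv c ` K" and ?f = "\<lambda>(t, x). bump_variation \<Phi> c x0 r e t (chart_inv d x)"
  have Kc: "open (- ?K)" using compact_inv_image[OF c K] by (simp add: compact_imp_closed open_Compl)
  have snd_smooth: "smooth_on U snd" if "open U" for U :: "(real \<times> (real^2)) set"
    using smooth_on_linear[OF bounded_linear_snd that] .
  have fst_smooth: "smooth_on U fst" if "open U" for U :: "(real \<times> (real^2)) set"
    using smooth_on_linear[OF bounded_linear_fst that] .
  have lift: "smooth_on (I \<times> U) (\<lambda>q. g (snd q))" if "open U" "smooth_on U g" for U and g :: "real^2 \<Rightarrow> 'b::euclidean_space"
    by (rule smooth_on_compose[OF that(2) snd_smooth]) (use that I in \<open>auto simp: open_Times\<close>)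
  show "\<exists>U. open U \<and> q \<in> U \<and> smooth_on U ?f"
  proof (cases "chart_inv d (snd q) \<in> chart_dom c")
    case True
    let ?U = "I \<times> overlap d c"
    have qU: "q \<in> ?U" using q True by (auto simp: overlap_eq[OF d])
    have U: "open ?U" using I open_overlap[OF d c] by (rule open_Times)
    have sub: "overlap d c \<subseteq> chart_img d" by (auto simp: overlap_eq[OF d])
    have "smooth_on ?U (\<lambda>q. local_rep d \<Phi> (snd q) + (fst q * bump x0 r (transition d c (snd q))) *\<^sub>R e)"
    proof (intro smooth_on_add smooth_on_scaleR smooth_on_mult smooth_on_const fst_smooth U)
      show "smooth_on ?U (\<lambda>q. local_rep d \<Phi> (snd q))"
        by (rule lift[OF open_overlap[OF d c] smooth_on_subset[OF immersion_smooth[OF \<Phi> d] sub]])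
      show "smooth_on ?U (\<lambda>q. bump x0 r (transition d c (snd q)))"
        by (rule smooth_on_compose[OF smooth_on_bump lift[OF open_overlap[OF d c] smooth_transition[OF d c]] U]) simp
    qed
    then have "smooth_on ?U ?f"
      by (rule smooth_on_cong[OF U, rotated])
         (auto simp: overlap_eq[OF d] bump_variation_def local_rep_def)
    then show ?thesis using U qU by blast
  next
    case False
    let ?W = "{x \<in> chart_img d. chart_inv d x \<in> - ?K}"
    have "?K \<subseteq> chart_dom c" using chart_inv_dom[OF c] K(2) by auto
    then have qW: "q \<in> I \<times> ?W" using q False by auto
    have "?W = chart_img d \<inter> chart_inv d -` (- ?K)" by auto
    then have W: "open ?W"
      using continuous_open_preimage[OF cont_inv[OF d] open_img[OF d] Kc] by simp
    have "smooth_on (I \<times> ?W) (\<lambda>q. local_rep d \<Phi> (snd q))"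
      by (rule lift[OF W smooth_on_subset[OF immersion_smooth[OF \<Phi> d]]]) auto
    then have "smooth_on (I \<times> ?W) ?f"
      by (rule smooth_on_cong[OF open_Times[OF I W], rotated])
         (auto simp: bump_variation_outside[OF c r] local_rep_def)
    then show ?thesis using open_Times[OF I W] qW by blast
  qed
qed

lemma immersion_iff_coord_normal:
  assumes "f differentiable (at x)"
  shows "inj (differential f x) \<longleftrightarrow> coord_normal f x \<noteq> 0"
  unfolding coord_normal_def
  by (rule inj_iff_cross3_nonzero) (use assms in \<open>auto simp: frechet_derivative_works intro: has_derivative_linear\<close>)

lemma coord_normal_nonzero:
  assumes "smooth_immersion A \<Phi>" "c \<in> A" "x \<in> chart_img c"
  shows "coord_normal (local_rep c \<Phi>) x \<noteq> 0"
  using immersion_iff_coord_normal[OF immersion_differentiable[OF assms]] assms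
  by (simp add: smooth_immersion_def)

lemma smooth_unit_normal:
  assumes "smooth_immersion A \<Phi>" "c \<in> A"
  shows "smooth_on (chart_img c) (unit_normal (local_rep c \<Phi>))"
  unfolding unit_normal_def[abs_def]
  by (intro smooth_on_sgn open_img smooth_on_coord_normal immersion_smooth coord_normal_nonzero assms)

text \<open>The hypothesis is the immersion condition in the chart \<open>c\<close> on a compact set that contains the support of the bump.  It carries over
to the other charts because transition maps have nonzero Jacobian determinant.\<close>

lemma smooth_immersion_bump_variation:
  assumes \<Phi>: "smooth_immersion A \<Phi>" and c: "c \<in> A"
    and K: "compact K" "K \<subseteq> chart_img c" and r: "r > 0" "cball x0 r \<subseteq> K"
    and nz: "\<And>x. x \<in> K \<Longrightarrow>
      coord_normal (local_rep c \<Phi>) x + t *\<^sub>R coord_normal_variation (local_rep c \<Phi>) (bump x0 r) e x \<noteq> 0"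
  shows "smooth_immersion A (bump_variation \<Phi> c x0 r e t)"
  unfolding smooth_immersion_def
proof (intro ballI conjI)
  let ?F = "bump_variation \<Phi> c x0 r e t" and ?K = "chart_inv c ` K"
  fix d assume d: "d \<in> A"
  have smooth: "smooth_on (chart_img d) (local_rep d (bump_variation \<Phi> c x0 r e t))" if "d \<in> A" for d
    using smooth_on_slice[OF smooth_bump_variation[OF \<Phi> c that K r open_UNIV] open_img[OF that] UNIV_I]
    by (simp add: local_rep_def comp_def)
  show "smooth_on (chart_img d) (local_rep d ?F)" by (rule smooth[OF d])
  have diff: "local_rep d ?F differentiable (at x)" if "d \<in> A" "x \<in> chart_img d" for d x
    using smooth_on_has_derivative[OF smooth[OF that(1)] that(2)] unfolding differentiable_def by blast
  have Kc: "open (- ?K)" using compact_inv_image[OF c K] by (simp add: compact_imp_closed open_Compl)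
  have unchanged: "coord_normal (local_rep d ?F) x \<noteq> 0" if d: "d \<in> A" and x: "x \<in> chart_img d" "chart_inv d x \<notin> ?K" for d x
  proof -
    let ?W = "chart_img d \<inter> chart_inv d -` (- ?K)"
    have W: "open ?W" by (rule continuous_open_preimage[OF cont_inv[OF d] open_img[OF d] Kc])
    have "(local_rep d ?F has_derivative differential (local_rep d \<Phi>) x) (at x)"
      by (rule has_derivative_transform_within_open[OF smooth_on_has_derivative[OF immersion_smooth[OF \<Phi> d] x(1)] W])
         (use x in \<open>auto simp: local_rep_def bump_variation_outside[OF c r]\<close>)
    from frechet_derivative_apply[OF this]
    have "coord_normal (local_rep d ?F) x = coord_normal (local_rep d \<Phi>) x" by (simp add: coord_normal_def)
    then show ?thesis using coord_normal_nonzero[OF \<Phi> d x(1)] by simp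
  qed
  fix x assume x: "x \<in> chart_img d"
  have "coord_normal (local_rep d ?F) x \<noteq> 0"
  proof (cases "chart_inv d x \<in> chart_dom c")
    case True
    have ov: "x \<in> overlap d c" using True x by (auto simp: overlap_eq[OF d])
    define y where "y = transition d c x"
    have y: "y \<in> chart_img c" unfolding y_def by (rule transition_in_img[OF d c ov])
    have "coord_normal (local_rep c ?F) y \<noteq> 0"
    proof (cases "y \<in> K")
      case True
      then show ?thesis using nz coord_normal_bump_variation(2)[OF \<Phi> c y] by simp
    next
      case False
      then have "chart_inv c y \<notin> ?K" using inv_image_mem_iff[OF c K(2) y] by simp
      then show ?thesis by (rule unchanged[OF c y])
    qed
    then show ?thesis
      using coord_normal_transition[OF d c ov diff[OF c y[unfolded y_def]]] det_transition[OF d c ov]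
      by (simp add: y_def)
  next
    case False
    moreover have "?K \<subseteq> chart_dom c" using chart_inv_dom[OF c] K(2) by auto
    ultimately have "chart_inv d x \<notin> ?K" by blast
    then show ?thesis by (rule unchanged[OF d x])
  qed
  then show "inj (differential (local_rep d ?F) x)"
    using immersion_iff_coord_normal[OF diff[OF d x]] by simp
qed

text \<open>For small \<open>t\<close> the bump variation is an admissible variation, and the energy that it carries is an integral over
the box; stationarity says that the derivative of this integral is 0.\<close>

lemma first_variation_vanishes:
  assumes \<Phi>: "smooth_immersion A \<Phi>" and \<Phi>0: "0 \<notin> range \<Phi>" and stationary: "stationary_surface A \<alpha> \<Phi>"
    and c: "c \<in> A" and box: "cbox a b \<subseteq> chart_img c" and r: "r > 0" "cball x0 r \<subseteq> cbox a b"
  shows "integral (cbox a b) (\<lambda>x. \<alpha> * norm (local_rep c \<Phi> x) powr (\<alpha> - 1)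
            * (sgn (local_rep c \<Phi> x) \<bullet> (bump x0 r x *\<^sub>R e)) * norm (coord_normal (local_rep c \<Phi>) x)
        + norm (local_rep c \<Phi> x) powr \<alpha>
            * (unit_normal (local_rep c \<Phi>) x \<bullet> coord_normal_variation (local_rep c \<Phi>) (bump x0 r) e x)) = 0"
proof -
  let ?X = "local_rep c \<Phi>" and ?\<eta> = "bump x0 r" and ?F = "bump_variation \<Phi> c x0 r e" and ?K = "chart_inv c ` cbox a b"
  let ?B = "\<lambda>x. ?\<eta> x *\<^sub>R e" and ?D = "coord_normal_variation ?X ?\<eta> e"
  have V: "open (chart_img c)" by (rule open_img[OF c])
  have X: "smooth_on (chart_img c) ?X" by (rule immersion_smooth[OF \<Phi> c])
  have \<eta>: "smooth_on (chart_img c) ?\<eta>" by (rule smooth_on_subset[OF smooth_on_bump]) simp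
  note cont = continuous_on_subset[OF smooth_on_imp_continuous_on box]
  have A: "continuous_on (cbox a b) ?X" "continuous_on (cbox a b) ?B"
    by (intro cont X smooth_on_scaleR smooth_on_const \<eta> V)+
  have C: "continuous_on (cbox a b) (coord_normal ?X)" "continuous_on (cbox a b) ?D"
    unfolding coord_normal_variation_def[abs_def]
    by (intro cont smooth_on_coord_normal X smooth_on_add smooth_on_cross3 smooth_on_scaleR smooth_on_const
        smooth_on_frechet_derivative \<eta> V)+
  have nz: "?X x \<noteq> 0" "coord_normal ?X x \<noteq> 0" if "x \<in> cbox a b" for x
    using \<Phi>0 coord_normal_nonzero[OF \<Phi> c subsetD[OF box that]] by (auto simp: local_rep_def image_iff)
  obtain e1 where e1: "e1 > 0" "\<forall>x\<in>cbox a b. \<forall>t. \<bar>t\<bar> \<le> e1 \<longrightarrow> ?X x + t *\<^sub>R ?B x \<noteq> 0"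
    using nonzero_perturbation[OF compact_cbox A nz(1)] by blast
  obtain e2 where e2: "e2 > 0" "\<forall>x\<in>cbox a b. \<forall>t. \<bar>t\<bar> \<le> e2 \<longrightarrow> coord_normal ?X x + t *\<^sub>R ?D x \<noteq> 0"
    using nonzero_perturbation[OF compact_cbox C nz(2)] by blast
  define \<epsilon> where "\<epsilon> = min e1 e2"
  have \<epsilon>: "\<epsilon> > 0" using e1(1) e2(1) by (simp add: \<epsilon>_def)
  have imm: "smooth_immersion A (?F t)" if "t \<in> {-\<epsilon><..<\<epsilon>}" for t
    by (rule smooth_immersion_bump_variation[OF \<Phi> c compact_cbox box r])
       (use e2(2) that in \<open>auto simp: \<epsilon>_def abs_le_iff\<close>)
  have "variation A \<Phi> ?K \<epsilon> ?F"
    unfolding variation_def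
  proof (intro conjI ballI allI impI)
    show "compact ?K" by (rule compact_inv_image[OF c compact_cbox box])
    show "smooth_on ({-\<epsilon><..<\<epsilon>} \<times> chart_img d) (\<lambda>(t, x). ?F t (chart_inv d x))" if "d \<in> A" for d
      by (rule smooth_bump_variation[OF \<Phi> c that compact_cbox box r]) simp
    show "?F 0 = \<Phi>" by (simp add: bump_variation_def fun_eq_iff)
    show "?F t p = \<Phi> p" if "p \<notin> ?K" for t p
      by (rule bump_variation_outside[OF c r that])
  qed (use \<epsilon> imm in auto)
  then have E0: "((\<lambda>t. energy A \<alpha> ?K (?F t)) has_real_derivative 0) (at 0)"
    using stationary by (simp add: stationary_surface_def)
  have energy: "energy A \<alpha> ?K (?F t)
      = integral (cbox a b) (\<lambda>x. norm (?X x + t *\<^sub>R ?B x) powr \<alpha> * norm (coord_normal ?X x + t *\<^sub>R ?D x))"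
    if t: "t \<in> {-\<epsilon><..<\<epsilon>}" for t
  proof -
    have F_inv: "?F t (chart_inv c x) = ?X x + t *\<^sub>R ?B x" if "x \<in> chart_img c" for x
      using bump_variation_local[OF c that, of \<Phi> x0 r e t] by (simp add: local_rep_def)
    have K_map: "chart_map c p \<in> cbox a b" "p = chart_inv c (chart_map c p)" if "p \<in> ?K" for p
      using that chart_map_inv[OF c] box by auto
    have "continuous_on ?K (\<lambda>p. norm (?X (chart_map c p) + t *\<^sub>R ?B (chart_map c p)) powr \<alpha>)"
    proof (rule continuous_on_compose2[where g = "\<lambda>x. norm (?X x + t *\<^sub>R ?B x) powr \<alpha>" and t = "cbox a b"])
      show "continuous_on (cbox a b) (\<lambda>x. norm (?X x + t *\<^sub>R ?B x) powr \<alpha>)"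
        using e1(2) t by (intro continuous_on_powr continuous_on_norm continuous_on_add A continuous_on_scaleR
            continuous_on_const) (auto simp: \<epsilon>_def abs_le_iff)
      show "continuous_on ?K (chart_map c)"
        by (rule continuous_on_subset[OF cont_map[OF c]]) (use chart_inv_dom[OF c] box in auto)
    qed (use K_map in auto)
    then have "continuous_on ?K (\<lambda>p. norm (?F t p) powr \<alpha>)"
    proof (rule continuous_on_eq)
      fix p assume p: "p \<in> ?K"
      show "norm (?X (chart_map c p) + t *\<^sub>R ?B (chart_map c p)) powr \<alpha> = norm (?F t p) powr \<alpha>"
        using F_inv[OF subsetD[OF box K_map(1)[OF p]]] K_map(2)[OF p] by simp
    qed
    from integral_area_measure[OF imm[OF t] c compact_cbox box this]
    have "energy A \<alpha> ?K (?F t)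
      = integral (cbox a b) (\<lambda>x. norm (?F t (chart_inv c x)) powr \<alpha> * area_density (local_rep c (?F t)) x)"
      by (simp add: energy_def)
    also have "\<dots> = integral (cbox a b) (\<lambda>x. norm (?X x + t *\<^sub>R ?B x) powr \<alpha> * norm (coord_normal ?X x + t *\<^sub>R ?D x))"
    proof (rule integral_cong)
      fix x assume "x \<in> cbox a b"
      then have x: "x \<in> chart_img c" using box by blast
      show "norm (?F t (chart_inv c x)) powr \<alpha> * area_density (local_rep c (?F t)) x
         = norm (?X x + t *\<^sub>R ?B x) powr \<alpha> * norm (coord_normal ?X x + t *\<^sub>R ?D x)"
        unfolding F_inv[OF x] area_density_def coord_normal_bump_variation(2)[OF \<Phi> c x] ..
    qed
    finally show ?thesis .
  qed
  have "((\<lambda>t. integral (cbox a b) (\<lambda>x. norm (?X x + t *\<^sub>R ?B x) powr \<alpha> * norm (coord_normal ?X x + t *\<^sub>R ?D x)))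
      has_real_derivative 0) (at 0)"
    by (rule has_field_derivative_transform_within_open[OF E0, of "{-\<epsilon><..<\<epsilon>}"]) (use energy \<epsilon> in auto)
  from DERIV_unique[OF weighted_energy_derivative[OF A(1) nz(1) A(2) C(1) nz(2) C(2)] this]
  show ?thesis by (simp add: unit_normal_def)
qed

lemma stationary_Euler_Lagrange:
  assumes \<Phi>: "smooth_immersion A \<Phi>" and \<Phi>0: "0 \<notin> range \<Phi>" and stationary: "stationary_surface A \<alpha> \<Phi>"
    and c: "c \<in> A" and x: "x \<in> chart_img c"
  shows "Euler_Lagrange_at \<alpha> (local_rep c \<Phi>) (unit_normal (local_rep c \<Phi>)) x v w"
proof (rule Euler_Lagrange_from_weak_form[OF open_img[OF c] immersion_smooth[OF \<Phi> c] _ _ _ x])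
  show "local_rep c \<Phi> y \<noteq> 0" for y using \<Phi>0 by (auto simp: local_rep_def image_iff)
  show "coord_normal (local_rep c \<Phi>) y \<noteq> 0" if "y \<in> chart_img c" for y
    by (rule coord_normal_nonzero[OF \<Phi> c that])
qed (rule first_variation_vanishes[OF \<Phi> \<Phi>0 stationary c, unfolded coord_normal_variation_def])


section \<open>Constant principal curvature\<close>

lemma unit_normal_transition:
  assumes \<Phi>: "smooth_immersion A \<Phi>" and "c \<in> A" "d \<in> A" "p \<in> chart_dom c" "p \<in> chart_dom d"
  shows "unit_normal (local_rep c \<Phi>) (chart_map c p) = unit_normal (local_rep d \<Phi>) (chart_map d p)"
proof -
  let ?x = "chart_map c p"
  have ov: "?x \<in> overlap c d" using assms by auto
  have tr: "transition c d ?x = chart_map d p" using chart_inv_map assms by simp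
  have img: "chart_map d p \<in> chart_img d" by (rule chart_map_img[OF assms(3,5)])
  show ?thesis
    using coord_normal_transition[OF assms(2,3) ov, unfolded tr, OF immersion_differentiable[OF \<Phi> assms(3) img]]
      det_transition[OF assms(2,3) ov]
    by (simp add: unit_normal_def sgn_scaleR)
qed

lemma locally_constant_if_derivative_zero:
  fixes f :: "'s \<Rightarrow> 'b::real_normed_vector"
  assumes conn: "connected (UNIV :: 's set)"
    and f: "\<And>c x. c \<in> A \<Longrightarrow> x \<in> chart_img c \<Longrightarrow> (local_rep c f has_derivative (\<lambda>v. 0)) (at x)"
  shows "f p = f q"
proof (rule connected_local_const[OF conn UNIV_I UNIV_I], rule ballI)
  fix p
  obtain c where c: "c \<in> A" "p \<in> chart_dom c" using atlas_cover by blast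
  define x where "x = chart_map c p"
  have x: "x \<in> chart_img c" unfolding x_def by (rule chart_map_img[OF c])
  obtain \<delta> where \<delta>: "\<delta> > 0" "ball x \<delta> \<subseteq> chart_img c" using open_img[OF c(1)] x openE by blast
  have const: "local_rep c f y = local_rep c f x" if "y \<in> ball x \<delta>" for y
  proof -
    have "\<exists>k. \<forall>y\<in>ball x \<delta>. local_rep c f y = k"
    proof (rule has_derivative_zero_constant[OF convex_ball])
      show "(local_rep c f has_derivative (\<lambda>v. 0)) (at y within ball x \<delta>)" if "y \<in> ball x \<delta>" for y
        using f[OF c(1)] \<delta>(2) that has_derivative_at_withinI by blast
    qed
    then show ?thesis using that \<delta>(1) by (metis centre_in_ball)
  qed
  let ?U = "chart_dom c \<inter> chart_map c -` ball x \<delta>"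
  have "open ?U" by (rule continuous_open_preimage[OF cont_map[OF c(1)] open_dom[OF c(1)] open_ball])
  moreover have "p \<in> ?U" using c(2) \<delta>(1) by (simp add: x_def)
  moreover have "f p = f q" if "q \<in> ?U" for q
  proof -
    have "f q = local_rep c f (chart_map c q)" "f p = local_rep c f x"
      using chart_inv_map[OF c(1)] c(2) that by (auto simp: local_rep_def x_def)
    then show ?thesis using const that by auto
  qed
  ultimately show "\<forall>\<^sub>F q in at p within UNIV. f p = f q"
    using eventually_at_topological by blast
qed

text \<open>Any chart around the point may be chosen: transition maps have positive determinant, so all of them yield
the same normal.\<close>

definition gauss_map :: "('s \<Rightarrow> real^3) \<Rightarrow> 's \<Rightarrow> real^3" where
  "gauss_map \<Phi> p = (let c = SOME c. c \<in> A \<and> p \<in> chart_dom c in unit_normal (local_rep c \<Phi>) (chart_map c p))"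

lemma gauss_map_local:
  assumes "smooth_immersion A \<Phi>" "c \<in> A" "x \<in> chart_img c"
  shows "local_rep c (gauss_map \<Phi>) x = unit_normal (local_rep c \<Phi>) x"
proof -
  let ?p = "chart_inv c x"
  define d where "d = (SOME d. d \<in> A \<and> ?p \<in> chart_dom d)"
  have "\<exists>d. d \<in> A \<and> ?p \<in> chart_dom d" using atlas_cover by blast
  then have d: "d \<in> A" "?p \<in> chart_dom d" unfolding d_def by (metis (no_types, lifting) someI_ex)+
  have "gauss_map \<Phi> ?p = unit_normal (local_rep d \<Phi>) (chart_map d ?p)"
    by (simp add: gauss_map_def d_def Let_def)
  also have "\<dots> = unit_normal (local_rep c \<Phi>) (chart_map c ?p)"
    by (rule unit_normal_transition[OF assms(1) d(1) assms(2) d(2) chart_inv_dom[OF assms(2,3)]])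
  also have "chart_map c ?p = x" by (rule chart_map_inv[OF assms(2,3)])
  finally show ?thesis unfolding local_rep_def[of c "gauss_map \<Phi>"] comp_def .
qed

text \<open>The map \<open>N + k \<Phi>\<close> is locally constant, hence constant.  For \<open>k = 0\<close> its value is a common normal vector, and
for \<open>k \<noteq> 0\<close> it is \<open>k\<close> times the centre of the sphere.\<close>

lemma plane_or_sphere_if_umbilic:
  assumes conn: "connected (UNIV :: 's set)" and \<Phi>: "smooth_immersion A \<Phi>"
    and umbilic: "\<And>c x v. c \<in> A \<Longrightarrow> x \<in> chart_img c \<Longrightarrow>
      frechet_derivative (unit_normal (local_rep c \<Phi>)) (at x) v + k *\<^sub>R differential (local_rep c \<Phi>) x v = 0"
  shows "(\<exists>n b. n \<noteq> 0 \<and> range \<Phi> \<subseteq> {x. n \<bullet> x = b}) \<or> (\<exists>z r. r > 0 \<and> range \<Phi> \<subseteq> sphere z r)"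
proof -
  let ?N = "gauss_map \<Phi>"
  have norm_N: "norm (?N p) = 1" for p
  proof -
    obtain c where c: "c \<in> A" "p \<in> chart_dom c" using atlas_cover by blast
    have img: "chart_map c p \<in> chart_img c" by (rule chart_map_img[OF c])
    have "?N p = unit_normal (local_rep c \<Phi>) (chart_map c p)"
      unfolding gauss_map_local[OF \<Phi> c(1) img, symmetric] by (simp add: local_rep_def[of _ ?N] chart_inv_map[OF c])
    then show ?thesis
      using coord_normal_nonzero[OF \<Phi> c(1) img] by (simp add: unit_normal_def norm_sgn)
  qed
  have const: "?N p + k *\<^sub>R \<Phi> p = ?N q + k *\<^sub>R \<Phi> q" for p q
  proof (rule locally_constant_if_derivative_zero[OF conn, where f = "\<lambda>p. ?N p + k *\<^sub>R \<Phi> p"])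
    fix c x assume c: "c \<in> A" and x: "x \<in> chart_img c"
    have "((\<lambda>x. unit_normal (local_rep c \<Phi>) x + k *\<^sub>R local_rep c \<Phi> x) has_derivative
        (\<lambda>v. frechet_derivative (unit_normal (local_rep c \<Phi>)) (at x) v + k *\<^sub>R differential (local_rep c \<Phi>) x v)) (at x)"
      by (intro has_derivative_add has_derivative_scaleR_right smooth_on_has_derivative[OF _ x]
          smooth_unit_normal immersion_smooth \<Phi> c)
    then have "((\<lambda>x. unit_normal (local_rep c \<Phi>) x + k *\<^sub>R local_rep c \<Phi> x) has_derivative (\<lambda>v. 0)) (at x)"
      by (simp add: umbilic[OF c x])
    then show "(local_rep c (\<lambda>p. ?N p + k *\<^sub>R \<Phi> p) has_derivative (\<lambda>v. 0)) (at x)"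
      by (rule has_derivative_transform_within_open[OF _ open_img[OF c] x])
         (subst gauss_map_local[OF \<Phi> c, symmetric], assumption, simp add: local_rep_def)
  qed
  define q where "q = (undefined :: 's)"
  show ?thesis
  proof (cases "k = 0")
    case True
    define n where "n = ?N q"
    have N: "?N p = n" for p using const[of p q] True by (simp add: n_def)
    have "n \<bullet> \<Phi> p = n \<bullet> \<Phi> q" for p
    proof (rule locally_constant_if_derivative_zero[OF conn, where f = "\<lambda>p. n \<bullet> \<Phi> p"])
      fix c x assume c: "c \<in> A" and x: "x \<in> chart_img c"
      have "n = unit_normal (local_rep c \<Phi>) x"
        unfolding gauss_map_local[OF \<Phi> c x, symmetric] by (simp add: local_rep_def[of _ ?N] N)
      then have normal: "n \<bullet> differential (local_rep c \<Phi>) x v = 0" for v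
        using unit_normal_tangent[OF smooth_on_has_derivative[OF immersion_smooth[OF \<Phi> c] x]] by simp
      have "((\<lambda>x. n \<bullet> local_rep c \<Phi> x) has_derivative (\<lambda>v. n \<bullet> differential (local_rep c \<Phi>) x v)) (at x)"
        by (intro has_derivative_inner_right smooth_on_has_derivative[OF _ x] immersion_smooth[OF \<Phi> c])
      then show "(local_rep c (\<lambda>p. n \<bullet> \<Phi> p) has_derivative (\<lambda>v. 0)) (at x)"
        unfolding normal by (simp add: local_rep_def comp_def)
    qed
    moreover have "n \<noteq> 0" using norm_N[of q] by (auto simp: n_def)
    ultimately show ?thesis by blast
  next
    case False
    define z where "z = (1 / k) *\<^sub>R (?N q + k *\<^sub>R \<Phi> q)"
    have "\<Phi> p \<in> sphere z (1 / \<bar>k\<bar>)" for p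
    proof -
      have "z = (1 / k) *\<^sub>R (?N p + k *\<^sub>R \<Phi> p)" unfolding z_def const[of q p] ..
      then have "z - \<Phi> p = (1 / k) *\<^sub>R ?N p" using False by (simp add: scaleR_add_right)
      then have "norm (z - \<Phi> p) = 1 / \<bar>k\<bar>" by (simp add: norm_N)
      then show ?thesis by (simp add: dist_norm)
    qed
    moreover have "1 / \<bar>k\<bar> > 0" using False by simp
    ultimately show ?thesis by blast
  qed
qed

end

text \<open>A principal direction with curvature \<open>k\<close>, pulled back to the parameter plane, is a kernel vector of the
differential of \<open>N + k X\<close>.\<close>

lemma principal_curvature_kernel:
  assumes "inj (differential X x)" "linear (differential X x)" "k \<in> principal_curvatures X x"
  shows "\<exists>\<xi>. \<xi> \<noteq> 0 \<and> differential (unit_normal X) x \<xi> + k *\<^sub>R differential X x \<xi> = 0"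
proof -
  obtain \<xi> where \<xi>: "differential X x \<xi> \<noteq> 0"
    "shape_operator X x (differential X x \<xi>) = k *\<^sub>R differential X x \<xi>"
    using assms(3) by (auto simp: principal_curvatures_def tangent_plane_def)
  have "\<xi> \<noteq> 0" using \<xi>(1) linear_0[OF assms(2)] by auto
  moreover have "differential (unit_normal X) x \<xi> + k *\<^sub>R differential X x \<xi> = 0"
    using \<xi>(2) by (simp add: shape_operator_def inv_f_f[OF assms(1)] neg_eq_iff_add_eq_0)
  ultimately show ?thesis by blast
qed

theorem theorem1p2:
  fixes A :: "'s::{t2_space,second_countable_topology} chart set"
    and \<Phi> :: "'s \<Rightarrow> real^3"
    and \<alpha> :: real
    and \<kappa>\<^sub>1 \<kappa>\<^sub>2 :: "'s \<Rightarrow> real"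
  assumes "\<alpha> \<noteq> 0"
    and "oriented_smooth_atlas A"
    and "connected (UNIV :: 's set)"
    and "smooth_immersion A \<Phi>"
    and "0 \<notin> range \<Phi>"
    and "stationary_surface A \<alpha> \<Phi>"
    and "\<And>c p. c \<in> A \<Longrightarrow> p \<in> chart_dom c \<Longrightarrow>
           principal_curvatures (local_rep c \<Phi>) (chart_map c p) = {\<kappa>\<^sub>1 p, \<kappa>\<^sub>2 p}"
    and "\<kappa>\<^sub>1 constant_on UNIV \<or> \<kappa>\<^sub>2 constant_on UNIV"
  shows "(\<exists>n b. n \<noteq> 0 \<and> range \<Phi> \<subseteq> {x. n \<bullet> x = b}) \<or>
         (\<exists>z r. r > 0 \<and> range \<Phi> \<subseteq> sphere z r)"
proof -
  interpret surface_atlas A by unfold_locales fact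
  note \<Phi> = assms(4)
  obtain k where "(\<forall>p. \<kappa>\<^sub>1 p = k) \<or> (\<forall>p. \<kappa>\<^sub>2 p = k)"
    using assms(8) by (auto simp: constant_on_def)
  then have k: "k \<in> {\<kappa>\<^sub>1 p, \<kappa>\<^sub>2 p}" for p by auto
  show ?thesis
  proof (rule plane_or_sphere_if_umbilic[OF assms(3) \<Phi>])
    fix c x v assume c: "c \<in> A" and x: "x \<in> chart_img c"
    let ?X = "local_rep c \<Phi>"
    show "differential (unit_normal ?X) x v + k *\<^sub>R differential ?X x v = 0"
    proof (rule umbilic_if_principal_curvature_constant[OF open_img[OF c] immersion_smooth[OF \<Phi> c] _ _ _ _
          stationary_Euler_Lagrange[OF \<Phi> assms(5,6) c] _ x])
      show "smooth_on (chart_img c) (unit_normal ?X)" by (rule smooth_unit_normal[OF \<Phi> c])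
      fix y assume y: "y \<in> chart_img c"
      have D: "(?X has_derivative differential ?X y) (at y)"
        by (rule smooth_on_has_derivative[OF immersion_smooth[OF \<Phi> c] y])
      show "unit_normal ?X y \<bullet> unit_normal ?X y = 1"
        using coord_normal_nonzero[OF \<Phi> c y] by (simp add: unit_normal_def dot_square_norm norm_sgn)
      show "unit_normal ?X y \<bullet> differential ?X y v = 0" for v
        by (rule unit_normal_tangent[OF D])
      show inj: "inj (differential ?X y)" using \<Phi> c y by (simp add: smooth_immersion_def)
      have "k \<in> principal_curvatures ?X (chart_map c (chart_inv c y))"
        using assms(7)[OF c chart_inv_dom[OF c y]] k by simp
      then have "k \<in> principal_curvatures ?X y" by (simp add: chart_map_inv[OF c y])
      then show "\<exists>\<xi>. \<xi> \<noteq> 0 \<and> differential (unit_normal ?X) y \<xi> + k *\<^sub>R differential ?X y \<xi> = 0"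
        by (rule principal_curvature_kernel[OF inj has_derivative_linear[OF D]])
    qed
  qed
qed

end
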